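(* Let $(M_0,\Phi_0)$ be the conical Bryant--Salamon $\mathrm{Spin}(7)$ manifold constructed over the round sphere $S^4$, and let $\mathrm{SU}(2)$ act on $M_0$ by the lift of the (left multiplication) $\mathrm{Sp}(1)\times\mathrm{Id}_1$ action on $S^4\subset\mathbb{H}\oplus\mathbb{R}$. Then $M_0$ admits an $\mathrm{SU}(2)$-invariant Cayley fibration parametrized by $\mathcal{B}\cong\mathbb{R}^4$. The fibres are topologically $S^3\times\mathbb{R}$ or $\mathbb{R}^4$ and are all smooth. Moreover, as these do not intersect, the $\mathrm{SU}(2)$-invariant Cayley fibration is a fibration in the usual differential geometric sense with fibres Cayley submanifolds.
   Context: **The manifold.** $S^4\subset\mathbb{R}^5$ is the unit sphere with its round metric of constant curvature $1$, with the orientation fixed below. $P_{\mathrm{SO}(4)}$ is its oriented orthonormal frame bundle and $P_{\mathrm{Spin}(4)}$ its spin structure. Identify $\mathrm{Spin}(4)\cong\mathrm{Sp}(1)\times\mathrm{Sp}(1)$, with covering map $\mathrm{Spin}(4)\to\mathrm{SO}(4)$, $(l,r)\cdot a=la\bar r$ for $a\in\mathbb{H}\cong\mathbb{R}^4$, and set $\mu_-(p_+,p_-)(v)=v\bar p_-$ for $v\in\mathbb{H}$. $M:=P_{\mathrm{Spin}(4)}\times_{\mu_-}\mathbb{H}$ is the negative spinor bundle of $S^4$, and $M_0:=M\setminus S^4\cong\mathbb{R}^+\times S^7$ is the complement of the zero section. For a local oriented orthonormal frame of $S^4$ with dual coframe $b_0,\dots,b_3$, put $\Omega_i=b_0\wedge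 b_i-b_j\wedge b_k$ ($(i,j,k)$ cyclic permutation of $(1,2,3)$); let the 1-forms $\rho_i$ be characterized by $d\Omega_1=2\rho_3\wedge\Omega_2-2\rho_2\wedge\Omega_3$, $d\Omega_2=-2\rho_3\wedge\Omega_1+2\rho_1\wedge\Omega_3$, $d\Omega_3=2\rho_2\wedge\Omega_1-2\rho_1\wedge\Omega_2$. Lifting the frame to $P_{\mathrm{Spin}(4)}$ trivializes $M$, with linear fibre coordinates $(a_0,a_1,a_2,a_3)$ with respect to $1,i,j,k\in\mathbb{H}$. The vertical 1-forms are $\xi_0=da_0+\rho_1a_1+\rho_2a_2+\rho_3a_3$, $\xi_1=da_1-\rho_1a_0-\rho_3a_2+\rho_2a_3$, $\xi_2=da_2-\rho_2a_0+\rho_3a_1-\rho_1a_3$, $\xi_3=da_3-\rho_3a_0-\rho_2a_1+\rho_1a_2$. With $r^2=a_0^2+a_1^2+a_2^2+a_3^2$ and $A_i=\xi_0\wedge\xi_i-\xi_j\wedge\xi_k$, on $M_0$ (where $r>0$) $$\Phi_0=16\,r^{-8/5}\xi_0\wedge\xi_1\wedge\xi_2\wedge\xi_3+25\,r^{12/5}b_0\wedge b_1\wedge b_2\wedge b_3+20\,r^{2/5}\sum_{i=1}^3A_i\wedge\Omega_i,$$ with induced metric $g_0=4r^{-4/5}\sum_i\xi_i^2+5r^{6/5}\sum_ib_i^2$. **Orientation.** Write points of $S^4\subset\mathbb{H}\oplus\mathbb{R}$ as $(\cos\alpha\,\mathbf{u},\sin\alpha)$, $\alpha\in[-\pi/2,\pi/2]$,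 $\mathbf{u}\in S^3\cong\mathrm{Sp}(1)$. Let $\{\partial_1,\partial_2,\partial_3\}$ be the left-invariant orthonormal frame on $S^3$ with dual coframe $\sigma_i$ satisfying $d\sigma_i=2\sigma_j\wedge\sigma_k$ ($(i,j,k)$ cyclic). $S^4$ is oriented so that $\{\partial_\alpha,\partial_1,\partial_2,\partial_3\}$ is a positive basis on $\alpha\ne\pm\pi/2$. **The action.** $\mathrm{SU}(2)\cong\mathrm{Sp}(1)$ acts on $\mathbb{R}^5=\mathbb{H}\oplus\mathbb{R}$ by left multiplication on $\mathbb{H}$ and trivially on $\mathbb{R}$, hence on $S^4$ and, by the differential, on $P_{\mathrm{SO}(4)}$. This lifts to an action of $\mathrm{Sp}(1)$ on $P_{\mathrm{Spin}(4)}$; combining it with the trivial action on $\mathbb{H}$, it descends to $M$ and restricts to $M_0$. **Cayley.** A 4-dimensional oriented submanifold $N$ of $(M_0,\Phi_0)$ is Cayley if $\Phi_0|_N=\mathrm{vol}_N$. **Cayley fibration.** $M_0$ admits a Cayley fibration if there is a family of Cayley submanifolds $N_b$ (possibly singular) parametrized by a $4$-dimensional space $\mathcal{B}$ such that: $M_0$ is covered by $\{N_b\}_{b\in\mathcal{B}}$; there is an open dense set $\mathcal{B}^\circ\subset\mathcal{B}$ such that $N_b$ is smooth for all $b\in\mathcal{B}^\circ$; there is an open dense $M'\subset M_0$ and a smooth fibration $\pi:M'\to\mathcal{B}$ with fibre $N_b$ (i.e. its restriction to $M'$) for all $b\in\mathcal{B}$. It is $\mathrm{SU}(2)$-invariant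 if every $N_b$ is $\mathrm{SU}(2)$-invariant.
   Formalization: For the final claim B≅R^4 carries some smooth 4-dimensional structure, possibly non-Hausdorff, since no continuous map from M_0 to R^4 has these fibres; "fibration" means smooth submersion; and π: M'→B need only reach the open dense B°, not every b. *)

theory Defs
  imports "HOL-Analysis.Analysis"
begin

section \<open>Smooth maps\<close>

primrec times_differentiable_on ::
  "nat \<Rightarrow> ('a::real_normed_vector \<Rightarrow> 'b::real_normed_vector) \<Rightarrow> 'a set \<Rightarrow> bool" where
  "times_differentiable_on 0 f S \<longleftrightarrow> continuous_on S f"
| "times_differentiable_on (Suc n) f S \<longleftrightarrow>
     (\<forall>x\<in>S. f differentiable (at x)) \<and>
     (\<forall>v. times_differentiable_on n (\<lambda>x. frechet_derivative f (at x) v) S)"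

text \<open>Only used for open \<open>S\<close>.\<close>

definition smooth_on :: "'a::real_normed_vector set \<Rightarrow> ('a \<Rightarrow> 'b::real_normed_vector) \<Rightarrow> bool" where
  "smooth_on S f \<longleftrightarrow> (\<forall>n. times_differentiable_on n f S)"


section \<open>Quaternions and Sp(2)\<close>

text \<open>The index type \<open>4\<close> has the elements 0, 1, 2, 3, so that \<open>q $ 0, \<dots>, q $ 3\<close> are the coefficients
  of \<open>1, i, j, k\<close>.\<close>

type_synonym quat = "real^4"
type_synonym qmat = "quat^2^2"
type_synonym vec5 = "quat \<times> real"

definition mkq :: "real \<Rightarrow> real \<Rightarrow> real \<Rightarrow> real \<Rightarrow> quat" where
  "mkq a b c d = (\<chi> i. if i = 0 then a else if i = 1 then b else if i = 2 then c else d)"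

definition qmul :: "quat \<Rightarrow> quat \<Rightarrow> quat"  (infixl "\<odot>" 70) where
  "x \<odot> y = mkq
     (x$0 * y$0 - x$1 * y$1 - x$2 * y$2 - x$3 * y$3)
     (x$0 * y$1 + x$1 * y$0 + x$2 * y$3 - x$3 * y$2)
     (x$0 * y$2 + x$2 * y$0 + x$3 * y$1 - x$1 * y$3)
     (x$0 * y$3 + x$3 * y$0 + x$1 * y$2 - x$2 * y$1)"

definition qcnj :: "quat \<Rightarrow> quat" where
  "qcnj x = mkq (x$0) (- x$1) (- x$2) (- x$3)"

definition qreal :: "real \<Rightarrow> quat" where
  "qreal t = mkq t 0 0 0"

definition qunit :: "4 \<Rightarrow> quat" where
  "qunit i = axis i 1"

definition Sp1 :: "quat set" where
  "Sp1 = {q. norm q = 1}"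

definition mk2 :: "quat \<Rightarrow> quat \<Rightarrow> quat \<Rightarrow> quat \<Rightarrow> qmat" where
  "mk2 a b c d = (\<chi> i j. if i = 1 then (if j = 1 then a else b) else (if j = 1 then c else d))"

definition qmm :: "qmat \<Rightarrow> qmat \<Rightarrow> qmat" where
  "qmm A B = (\<chi> i j. \<Sum>k\<in>UNIV. A$i$k \<odot> B$k$j)"

definition qadj :: "qmat \<Rightarrow> qmat" where
  "qadj A = (\<chi> i j. qcnj (A$j$i))"

definition qdiag :: "quat \<Rightarrow> quat \<Rightarrow> qmat" where
  "qdiag l r = mk2 l 0 0 r"

definition Sp2 :: "qmat set" where
  "Sp2 = {A. qmm (qadj A) A = qdiag (qreal 1) (qreal 1) \<and> qmm A (qadj A) = qdiag (qreal 1) (qreal 1)}"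


section \<open>The spin structure of the round 4-sphere\<close>

text \<open>
  \<open>S\<^sup>4\<close> is the unit sphere of \<open>\<real>\<^sup>5 = \<bbbH> \<oplus> \<real>\<close>. Identify \<open>(q, t)\<close> with the traceless Hermitian quaternionic
  matrix with rows \<open>(t, q)\<close> and \<open>(q\<^sup>*, - t)\<close>; then Sp(2) acts on \<open>\<real>\<^sup>5\<close> by \<open>X \<mapsto> A X A\<^sup>*\<close>, which is the
  double cover \<open>Sp(2) = Spin(5) \<rightarrow> SO(5)\<close>.  The stabiliser of the pole \<open>(0, 1)\<close> is
  \<open>Spin(4) = Sp(1) \<times> Sp(1)\<close>, embedded as \<open>diag(l, r)\<close>, and it acts on the tangent space \<open>\<bbbH>\<close> at the pole
  by \<open>a \<mapsto> l a r\<^sup>*\<close>.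

  Hence the spin structure of \<open>S\<^sup>4\<close> is Sp(2) itself, with right action
  \<open>A \<mapsto> A diag(l, r)\<close> of Spin(4): the point \<open>A\<close> lies over \<open>sphere_point A\<close> and covers the oriented
  orthonormal frame \<open>frame A 0, \<dots>, frame A 3\<close> there (lemmas \<open>frame_orthonormal\<close>, \<open>frame_tangent\<close>,
  \<open>frame_positive\<close>); the frames of \<open>A diag(l, r)\<close> and \<open>A\<close> differ by \<open>a \<mapsto> l a r\<^sup>*\<close> (lemmas
  \<open>sphere_point_rmul\<close>, \<open>spin_act_rmul\<close>).
\<close>

definition herm :: "vec5 \<Rightarrow> qmat" where
  "herm v = mk2 (qreal (snd v)) (fst v) (qcnj (fst v)) (qreal (- snd v))"

definition spin_act :: "qmat \<Rightarrow> vec5 \<Rightarrow> vec5" where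
  "spin_act A v = (let B = qmm (qmm A (herm v)) (qadj A) in (B$1$2, B$1$1$0))"

abbreviation P_Spin :: "qmat set" where
  "P_Spin \<equiv> Sp2"

definition sphere_point :: "qmat \<Rightarrow> vec5" where
  "sphere_point A = spin_act A (0, 1)"

definition frame :: "qmat \<Rightarrow> 4 \<Rightarrow> vec5" where
  "frame A i = spin_act A (qunit i, 0)"

definition spin_rmul :: "qmat \<Rightarrow> quat \<times> quat \<Rightarrow> qmat" where
  "spin_rmul A h = qmm A (qdiag (fst h) (snd h))"

text \<open>
  The orientation of \<open>S\<^sup>4\<close>, at the point \<open>(cos \<alpha> u, sin \<alpha>)\<close>.  The left-invariant fields \<open>u i, u j, u k\<close>
  satisfy \<open>[u i, u j] = 2 u k\<close>, so that their dual coframe has \<open>d\<sigma>\<^sub>1 = - 2 \<sigma>\<^sub>2 \<and> \<sigma>\<^sub>3\<close>.  The frame with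
  \<open>d\<sigma>\<^sub>1 = 2 \<sigma>\<^sub>2 \<and> \<sigma>\<^sub>3\<close> is therefore \<open>-u i, -u j, -u k\<close>.  That the spin structure above belongs to this
  orientation is the lemma \<open>frame_positive\<close> below.
\<close>

definition orient_frame :: "real \<Rightarrow> quat \<Rightarrow> 4 \<Rightarrow> vec5" where
  "orient_frame \<alpha> u i =
     (if i = 0 then (- sin \<alpha> *\<^sub>R u, cos \<alpha>) else (- (u \<odot> qunit i), 0))"


section \<open>The negative spinor bundle\<close>

definition mu_minus :: "quat \<times> quat \<Rightarrow> quat \<Rightarrow> quat" where
  "mu_minus p v = v \<odot> qcnj (snd p)"

text \<open>A point of \<open>M = P\<^bsub>Spin(4)\<^esub> \<times>\<^bsub>\<mu>\<^esub> \<bbbH>\<close> is an orbit of \<open>(A, a) \<mapsto> (A h, \<mu>(h\<^sup>-\<^sup>1) a)\<close>.\<close>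

type_synonym spinor = "(qmat \<times> quat) set"

definition assoc :: "qmat \<Rightarrow> quat \<Rightarrow> spinor" where
  "assoc A a = {(spin_rmul A (l, r), mu_minus (qcnj l, qcnj r) a) | l r. l \<in> Sp1 \<and> r \<in> Sp1}"

definition M :: "spinor set" where
  "M = {assoc A a | A a. A \<in> P_Spin}"

definition M0 :: "spinor set" where
  "M0 = {assoc A a | A a. A \<in> P_Spin \<and> a \<noteq> 0}"

text \<open>The quotient topology.\<close>

definition M_top :: "spinor topology" where
  "M_top = topology (\<lambda>W. W \<subseteq> M \<and>
     openin (top_of_set (P_Spin \<times> UNIV)) {z \<in> P_Spin \<times> UNIV. assoc (fst z) (snd z) \<in> W})"

definition M0_top :: "spinor topology" where
  "M0_top = subtopology M_top M0"

text \<open>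
  Left multiplication by \<open>p \<in> Sp(1)\<close> on the summand \<open>\<bbbH>\<close> of \<open>\<real>\<^sup>5\<close> is the action of
  \<open>diag(p, 1) \<in> Sp(2)\<close> (lemma \<open>spin_act_lift\<close>), so its lift to the spin structure is left
  multiplication by \<open>diag(p, 1)\<close> (lemmas \<open>sphere_point_lift\<close> and \<open>frame_lift\<close>).
\<close>

definition act5 :: "quat \<Rightarrow> vec5 \<Rightarrow> vec5" where
  "act5 p v = (p \<odot> fst v, snd v)"

definition act_Spin :: "quat \<Rightarrow> qmat \<Rightarrow> qmat" where
  "act_Spin p A = qmm (qdiag p (qreal 1)) A"

definition act_M :: "quat \<Rightarrow> spinor \<Rightarrow> spinor" where
  "act_M p c = (\<lambda>(A, a). (act_Spin p A, a)) ` c"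


section \<open>Exterior algebra\<close>

definition wedge11 :: "('v \<Rightarrow> real) \<Rightarrow> ('v \<Rightarrow> real) \<Rightarrow> 'v \<Rightarrow> 'v \<Rightarrow> real" where
  "wedge11 \<alpha> \<beta> u v = \<alpha> u * \<beta> v - \<alpha> v * \<beta> u"

definition wedge12 :: "('v \<Rightarrow> real) \<Rightarrow> ('v \<Rightarrow> 'v \<Rightarrow> real) \<Rightarrow> 'v \<Rightarrow> 'v \<Rightarrow> 'v \<Rightarrow> real" where
  "wedge12 \<alpha> Q u v w = \<alpha> u * Q v w - \<alpha> v * Q u w + \<alpha> w * Q u v"

definition wedge22 ::
  "('v \<Rightarrow> 'v \<Rightarrow> real) \<Rightarrow> ('v \<Rightarrow> 'v \<Rightarrow> real) \<Rightarrow> 'v \<Rightarrow> 'v \<Rightarrow> 'v \<Rightarrow> 'v \<Rightarrow> real" where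
  "wedge22 P Q u v w x =
     P u v * Q w x - P u w * Q v x + P u x * Q v w +
     P v w * Q u x - P v x * Q u w + P w x * Q u v"

text \<open>For a coframe \<open>\<theta>\<^sub>0, \<dots>, \<theta>\<^sub>3\<close>: the 2-form \<open>\<theta>\<^sub>0 \<and> \<theta>\<^sub>i - \<theta>\<^sub>j \<and> \<theta>\<^sub>k\<close>, \<open>(i, j, k)\<close> cyclic.\<close>

definition cyc :: "4 \<Rightarrow> 4" where
  "cyc i = (if i = 1 then 2 else if i = 2 then 3 else 1)"

definition asd_form :: "(4 \<Rightarrow> 'v \<Rightarrow> real) \<Rightarrow> 4 \<Rightarrow> 'v \<Rightarrow> 'v \<Rightarrow> real" where
  "asd_form \<theta> i u v = wedge11 (\<theta> 0) (\<theta> i) u v - wedge11 (\<theta> (cyc i)) (\<theta> (cyc (cyc i))) u v"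

definition vol_form :: "(4 \<Rightarrow> 'v \<Rightarrow> real) \<Rightarrow> 'v \<Rightarrow> 'v \<Rightarrow> 'v \<Rightarrow> 'v \<Rightarrow> real" where
  "vol_form \<theta> = wedge22 (wedge11 (\<theta> 0) (\<theta> 1)) (wedge11 (\<theta> 2) (\<theta> 3))"

text \<open>Exterior derivative of a 2-form on an open subset of a vector space.\<close>

definition ext_deriv2 ::
  "('v::real_normed_vector \<Rightarrow> 'v \<Rightarrow> 'v \<Rightarrow> real) \<Rightarrow> 'v \<Rightarrow> 'v \<Rightarrow> 'v \<Rightarrow> 'v \<Rightarrow> real" where
  "ext_deriv2 \<Omega> y u v w =
     frechet_derivative (\<lambda>z. \<Omega> z v w) (at y) u -
     frechet_derivative (\<lambda>z. \<Omega> z u w) (at y) v +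
     frechet_derivative (\<lambda>z. \<Omega> z u v) (at y) w"


section \<open>Local frames and the Bryant--Salamon structure\<close>

text \<open>
  A smooth map \<open>g : U \<rightarrow> P\<^bsub>Spin(4)\<^esub>\<close> on an open set \<open>U \<subseteq> \<real>\<^sup>4\<close> whose base point \<open>y \<mapsto> sphere_point (g y)\<close> is
  an injective immersion consists of local coordinates \<open>U\<close> on \<open>S\<^sup>4\<close>, a local oriented orthonormal
  frame \<open>frame (g y)\<close>, and a lift of this frame to the spin structure.  All forms on \<open>S\<^sup>4\<close> are written
  in the coordinates \<open>U\<close>.
\<close>

definition coframe :: "(quat \<Rightarrow> qmat) \<Rightarrow> quat \<Rightarrow> 4 \<Rightarrow> quat \<Rightarrow> real" where
  "coframe g y i v = frame (g y) i \<bullet> frechet_derivative (\<lambda>z. sphere_point (g z)) (at y) v"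

definition Omega :: "(quat \<Rightarrow> qmat) \<Rightarrow> 4 \<Rightarrow> quat \<Rightarrow> quat \<Rightarrow> quat \<Rightarrow> real" where
  "Omega g i y = asd_form (coframe g y) i"

definition connection_forms :: "quat set \<Rightarrow> (quat \<Rightarrow> qmat) \<Rightarrow> (4 \<Rightarrow> quat \<Rightarrow> quat \<Rightarrow> real) \<Rightarrow> bool" where
  "connection_forms U g \<rho> \<longleftrightarrow>
     (\<forall>y\<in>U. linear (\<rho> 1 y) \<and> linear (\<rho> 2 y) \<and> linear (\<rho> 3 y) \<and>
       (\<forall>u v w.
         ext_deriv2 (Omega g 1) y u v w =
             2 * wedge12 (\<rho> 3 y) (Omega g 2 y) u v w - 2 * wedge12 (\<rho> 2 y) (Omega g 3 y) u v w \<and>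
         ext_deriv2 (Omega g 2) y u v w =
           - 2 * wedge12 (\<rho> 3 y) (Omega g 1 y) u v w + 2 * wedge12 (\<rho> 1 y) (Omega g 3 y) u v w \<and>
         ext_deriv2 (Omega g 3) y u v w =
             2 * wedge12 (\<rho> 2 y) (Omega g 1 y) u v w - 2 * wedge12 (\<rho> 1 y) (Omega g 2 y) u v w))"

definition spin_gauge :: "quat set \<Rightarrow> (quat \<Rightarrow> qmat) \<Rightarrow> (4 \<Rightarrow> quat \<Rightarrow> quat \<Rightarrow> real) \<Rightarrow> bool" where
  "spin_gauge U g \<rho> \<longleftrightarrow>
     open U \<and> smooth_on U g \<and> g ` U \<subseteq> P_Spin \<and>
     inj_on (\<lambda>y. sphere_point (g y)) U \<and>
     (\<forall>y\<in>U. inj (frechet_derivative (\<lambda>z. sphere_point (g z)) (at y))) \<and>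
     connection_forms U g \<rho>"

text \<open>The trivialisation of \<open>M\<close> over \<open>U\<close>, with fibre coordinates \<open>a\<close>.\<close>

definition triv :: "(quat \<Rightarrow> qmat) \<Rightarrow> quat \<times> quat \<Rightarrow> spinor" where
  "triv g z = assoc (g (fst z)) (snd z)"

text \<open>In a trivialisation, \<open>(y, a)\<close> is a point of \<open>U \<times> \<bbbH>\<close> and \<open>v = (dy, da)\<close> a tangent vector there.\<close>

definition base_form :: "(quat \<Rightarrow> qmat) \<Rightarrow> quat \<times> quat \<Rightarrow> 4 \<Rightarrow> quat \<times> quat \<Rightarrow> real" where
  "base_form g z i v = coframe g (fst z) i (fst v)"

definition vert_form ::
  "(4 \<Rightarrow> quat \<Rightarrow> quat \<Rightarrow> real) \<Rightarrow> quat \<times> quat \<Rightarrow> 4 \<Rightarrow> quat \<times> quat \<Rightarrow> real" where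
  "vert_form \<rho> z i v =
     (let a = snd z; da = snd v;
          r1 = \<rho> 1 (fst z) (fst v); r2 = \<rho> 2 (fst z) (fst v); r3 = \<rho> 3 (fst z) (fst v)
      in if i = 0 then da$0 + r1 * a$1 + r2 * a$2 + r3 * a$3
         else if i = 1 then da$1 - r1 * a$0 - r3 * a$2 + r2 * a$3
         else if i = 2 then da$2 - r2 * a$0 + r3 * a$1 - r1 * a$3
         else da$3 - r3 * a$0 - r2 * a$1 + r1 * a$2)"

definition Phi0 ::
  "(quat \<Rightarrow> qmat) \<Rightarrow> (4 \<Rightarrow> quat \<Rightarrow> quat \<Rightarrow> real) \<Rightarrow> quat \<times> quat \<Rightarrow>
   quat \<times> quat \<Rightarrow> quat \<times> quat \<Rightarrow> quat \<times> quat \<Rightarrow> quat \<times> quat \<Rightarrow> real" where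
  "Phi0 g \<rho> z u v w x =
     (let r = norm (snd z); b = base_form g z; \<xi> = vert_form \<rho> z in
        16 * r powr (-8/5) * vol_form \<xi> u v w x +
        25 * r powr (12/5) * vol_form b u v w x +
        20 * r powr (2/5) * (\<Sum>i\<in>{1,2,3}. wedge22 (asd_form \<xi> i) (asd_form b i) u v w x))"

definition metric0 ::
  "(quat \<Rightarrow> qmat) \<Rightarrow> (4 \<Rightarrow> quat \<Rightarrow> quat \<Rightarrow> real) \<Rightarrow> quat \<times> quat \<Rightarrow>
   quat \<times> quat \<Rightarrow> quat \<times> quat \<Rightarrow> real" where
  "metric0 g \<rho> z u v =
     (let r = norm (snd z); b = base_form g z; \<xi> = vert_form \<rho> z in
        4 * r powr (-4/5) * (\<Sum>i\<in>UNIV. \<xi> i u * \<xi> i v) +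
        5 * r powr (6/5) * (\<Sum>i\<in>UNIV. b i u * b i v))"


section \<open>Submanifolds, Cayley submanifolds and submersions\<close>

text \<open>
  Below, smoothness, \<open>\<Phi>\<^sub>0\<close> and \<open>g\<^sub>0\<close> are evaluated at each point in some trivialisation around it.  All
  trivialisations are compatible: replacing \<open>g\<close> by \<open>g diag(l, r)\<close> replaces, with
  \<open>b = b\<^sub>0 + b\<^sub>1 i + b\<^sub>2 j + b\<^sub>3 k\<close>, \<open>\<rho> = \<rho>\<^sub>1 i + \<rho>\<^sub>2 j + \<rho>\<^sub>3 k\<close> and \<open>\<xi> = da - a \<rho>\<close>, the fibre coordinate
  \<open>a\<close> by \<open>a r\<close>, \<open>b\<close> by \<open>l\<^sup>* b r\<close>, \<open>\<rho>\<close> by \<open>r\<^sup>* \<rho> r + r\<^sup>* dr\<close> and \<open>\<xi>\<close> by \<open>\<xi> r\<close>.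
\<close>

text \<open>\<open>\<psi>\<close> expresses the map \<open>\<phi>\<close> into \<open>M\<^sub>0\<close> near \<open>y\<close> in the trivialisation of \<open>g\<close>.\<close>

definition local_rep ::
  "(quat \<Rightarrow> spinor) \<Rightarrow> quat \<Rightarrow> quat set \<Rightarrow> (quat \<Rightarrow> qmat) \<Rightarrow> (quat \<Rightarrow> quat \<times> quat) \<Rightarrow> bool" where
  "local_rep \<phi> y U g \<psi> \<longleftrightarrow>
     (\<exists>T. open T \<and> y \<in> T \<and> smooth_on T \<psi> \<and>
          (\<forall>t\<in>T. \<psi> t \<in> U \<times> (- {0}) \<and> \<phi> t = triv g (\<psi> t)))"

definition immersion :: "quat set \<Rightarrow> (quat \<Rightarrow> spinor) \<Rightarrow> bool" where
  "immersion V \<phi> \<longleftrightarrow>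
     (\<forall>y\<in>V. \<exists>U g \<rho> \<psi>. spin_gauge U g \<rho> \<and> local_rep \<phi> y U g \<psi> \<and> inj (frechet_derivative \<psi> (at y)))"

definition local_param :: "spinor set \<Rightarrow> quat set \<Rightarrow> (quat \<Rightarrow> spinor) \<Rightarrow> bool" where
  "local_param N V \<phi> \<longleftrightarrow>
     open V \<and> immersion V \<phi> \<and> openin (subtopology M0_top N) (\<phi> ` V) \<and>
     homeomorphic_map (top_of_set V) (subtopology M0_top (\<phi> ` V)) \<phi>"

text \<open>
  \<open>N\<close> is an embedded 4-dimensional submanifold of \<open>M\<^sub>0\<close>, and the local parametrisations in \<open>\<A>\<close> cover it
  with transition maps of positive Jacobian, thus defining an orientation of \<open>N\<close>.
\<close>

definition oriented_atlas :: "spinor set \<Rightarrow> (quat set \<times> (quat \<Rightarrow> spinor)) set \<Rightarrow> bool" where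
  "oriented_atlas N \<A> \<longleftrightarrow>
     N \<subseteq> M0 \<and>
     (\<forall>(V, \<phi>)\<in>\<A>. local_param N V \<phi>) \<and>
     N = (\<Union>(V, \<phi>)\<in>\<A>. \<phi> ` V) \<and>
     (\<forall>(V, \<phi>)\<in>\<A>. \<forall>(V', \<phi>')\<in>\<A>. \<forall>y\<in>V. \<phi> y \<in> \<phi>' ` V' \<longrightarrow>
        (\<exists>D. ((\<lambda>z. the_inv_into V' \<phi>' (\<phi> z)) has_derivative D) (at y) \<and> det (matrix D) > 0))"

text \<open>\<open>\<Phi>\<^sub>0\<close> restricts to the Riemannian volume form: both are evaluated on the coordinate vector fields
  of each parametrisation in the oriented atlas.\<close>

definition calibrated_at :: "(quat \<Rightarrow> spinor) \<Rightarrow> quat \<Rightarrow> bool" where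
  "calibrated_at \<phi> y \<longleftrightarrow>
     (\<exists>U g \<rho> \<psi>. spin_gauge U g \<rho> \<and> local_rep \<phi> y U g \<psi> \<and>
        (let e = (\<lambda>i. frechet_derivative \<psi> (at y) (axis i 1)) in
           Phi0 g \<rho> (\<psi> y) (e 0) (e 1) (e 2) (e 3) =
           sqrt (det (\<chi> i j. metric0 g \<rho> (\<psi> y) (e i) (e j)))))"

definition Cayley :: "spinor set \<Rightarrow> bool" where
  "Cayley N \<longleftrightarrow> (\<exists>\<A>. oriented_atlas N \<A> \<and> (\<forall>(V, \<phi>)\<in>\<A>. \<forall>y\<in>V. calibrated_at \<phi> y))"

text \<open>A possibly singular Cayley submanifold: Cayley away from a closed, nowhere dense subset.\<close>

definition singular_Cayley :: "spinor set \<Rightarrow> bool" where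
  "singular_Cayley N \<longleftrightarrow> N \<subseteq> M0 \<and>
     (\<exists>R. openin (subtopology M0_top N) R \<and> N \<subseteq> M0_top closure_of R \<and> Cayley R)"

definition smooth_submersion :: "spinor set \<Rightarrow> (spinor \<Rightarrow> real^4) \<Rightarrow> bool" where
  "smooth_submersion W f \<longleftrightarrow>
     openin M0_top W \<and>
     (\<forall>p\<in>W. \<exists>U g \<rho> T z. spin_gauge U g \<rho> \<and> open T \<and> T \<subseteq> U \<times> (- {0}) \<and> z \<in> T \<and> triv g z = p \<and>
        smooth_on T (\<lambda>x. f (triv g x)) \<and> surj (frechet_derivative (\<lambda>x. f (triv g x)) (at z)))"


section \<open>Cayley fibrations\<close>

text \<open>
  Families of subsets of \<open>M\<^sub>0\<close> are parametrised by \<open>\<B> = \<real>\<^sup>4\<close>.  A smooth fibration is understood as a smooth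
  submersion: local triviality is not meant, since fibres over a connected base may change topology.
  The generic fibration \<open>\<pi> : M' \<rightarrow> \<B>\<close> is required to reach every point of the dense set \<open>\<B>\<degree>\<close>;
  over the remaining points \<open>N b\<close> may be disjoint from \<open>M'\<close>.
\<close>

definition Cayley_fibration :: "(real^4 \<Rightarrow> spinor set) \<Rightarrow> bool" where
  "Cayley_fibration N \<longleftrightarrow>
     (\<forall>b. singular_Cayley (N b)) \<and>
     (\<Union>b. N b) = M0 \<and>
     (\<exists>B0 M' \<pi>.
        open B0 \<and> closure B0 = UNIV \<and> (\<forall>b\<in>B0. Cayley (N b)) \<and>
        openin M0_top M' \<and> M0_top closure_of M' = M0 \<and>
        smooth_submersion M' \<pi> \<and> (\<forall>b. {p\<in>M'. \<pi> p = b} = N b \<inter> M') \<and> B0 \<subseteq> \<pi> ` M')"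

definition SU2_invariant :: "spinor set \<Rightarrow> bool" where
  "SU2_invariant N \<longleftrightarrow> (\<forall>p\<in>Sp1. act_M p ` N = N)"

text \<open>
  Fibration of all of \<open>M\<^sub>0\<close> with fibres \<open>N b\<close>: every point lies on exactly one \<open>N b\<close>, and the resulting
  projection \<open>\<pi> : M\<^sub>0 \<rightarrow> \<B>\<close> is a smooth submersion for a smooth 4-dimensional structure on the set \<open>\<B>\<close>.
  This structure is given by its charts \<open>(D, \<kappa>)\<close>; the transition maps are smooth because the
  maps \<open>\<kappa> \<circ> \<pi>\<close> are submersions.

  The structure cannot be asked to be the standard one of \<open>\<real>\<^sup>4\<close> everywhere.  Write \<open>M\<^sub>0 = \<bbbH>\<^sup>2 - {0}\<close> by
  sending the class of \<open>(A, a)\<close> to \<open>(q\<^sub>1, q\<^sub>2) = c a\<^sup>*\<close>, \<open>c\<close> the second column of \<open>A\<close>.  The group acts on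
  \<open>q\<^sub>1\<close> only, and with \<open>s = |q\<^sub>1|\<close>, \<open>t = |q\<^sub>2|\<close> the invariant Cayley submanifolds meeting \<open>q\<^sub>1 \<noteq> 0\<close> lie in
  \<open>q\<^sub>2 = 0\<close> or have constant \<open>q\<^sub>2 / t\<close> and constant \<open>t\<^sup>2 (5 t\<^sup>2 - 3 s\<^sup>2)\<^sup>5 / (s\<^sup>2 + t\<^sup>2)\<^sup>3\<close>.  When this constant
  tends to 0 from below, the submanifolds with \<open>q\<^sub>2 / t = v\<close> converge both to \<open>q\<^sub>2 = 0\<close> and to the cone
  \<open>5 t\<^sup>2 = 3 s\<^sup>2\<close>, \<open>q\<^sub>2 / t = v\<close>, so the space of all fibres is not Hausdorff.  The standard structure
  of \<open>\<real>\<^sup>4\<close> is the one induced by the generic fibration in \<open>Cayley_fibration\<close>.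
\<close>

definition fibration_with_fibres :: "(real^4 \<Rightarrow> spinor set) \<Rightarrow> bool" where
  "fibration_with_fibres N \<longleftrightarrow>
     (\<exists>\<pi>. (\<forall>b. {p\<in>M0. \<pi> p = b} = N b) \<and> \<pi> ` M0 = UNIV \<and>
       (\<exists>\<K> :: (real^4) set \<Rightarrow> (real^4 \<Rightarrow> real^4) \<Rightarrow> bool.
          (\<forall>b. \<exists>D \<kappa>. \<K> D \<kappa> \<and> b \<in> D) \<and>
          (\<forall>D \<kappa>. \<K> D \<kappa> \<longrightarrow> inj_on \<kappa> D \<and> smooth_submersion {p\<in>M0. \<pi> p \<in> D} (\<lambda>p. \<kappa> (\<pi> p)))))"

definition S3_times_R :: "vec5 topology" where
  "S3_times_R = top_of_set (sphere 0 1 \<times> UNIV)"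

section \<open>Compatibility of the conventions\<close>

lemma mkq_nth [simp]:
  "mkq a b c d $ 0 = a" "mkq a b c d $ 1 = b" "mkq a b c d $ 2 = c" "mkq a b c d $ 3 = d"
  by (simp_all add: mkq_def)

lemma UNIV_4': "(UNIV :: 4 set) = {0, 1, 2, 3}"
proof -
  have "(4 :: 4) = 0" by simp
  then show ?thesis
    by (simp only: UNIV_4 insert_commute)
qed

lemma sum_4': "(\<Sum>i\<in>(UNIV :: 4 set). f i) = f 0 + f 1 + f 2 + (f 3 :: 'a::comm_monoid_add)"
proof -
  have "(4 :: 4) = 0" by simp
  then show ?thesis
    by (simp only: sum_4 ac_simps)
qed

lemma all_4': "(\<forall>i::4. P i) \<longleftrightarrow> P 0 \<and> P 1 \<and> P 2 \<and> P 3"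
proof -
  have "(\<forall>i::4. P i) \<longleftrightarrow> (\<forall>i\<in>UNIV. P i)" by simp
  then show ?thesis by (simp only: UNIV_4') simp
qed

lemma quat_eq_iff: "(x::quat) = y \<longleftrightarrow> x$0 = y$0 \<and> x$1 = y$1 \<and> x$2 = y$2 \<and> x$3 = y$3"
  by (simp add: vec_eq_iff all_4')

lemma qmul_assoc: "(x \<odot> y) \<odot> z = x \<odot> (y \<odot> z)"
  by (simp add: quat_eq_iff qmul_def algebra_simps)

lemma qmul_add: "x \<odot> (y + z) = x \<odot> y + x \<odot> z" "(x + y) \<odot> z = x \<odot> z + y \<odot> z"
  by (simp_all add: quat_eq_iff qmul_def algebra_simps)

lemma qmul_diff: "x \<odot> (y - z) = x \<odot> y - x \<odot> z" "(x - y) \<odot> z = x \<odot> z - y \<odot> z"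
  by (simp_all add: quat_eq_iff qmul_def algebra_simps)

lemma qmul_minus: "x \<odot> (- y) = - (x \<odot> y)" "(- x) \<odot> y = - (x \<odot> y)"
  by (simp_all add: quat_eq_iff qmul_def algebra_simps)

lemma qmul_scaleR: "x \<odot> (t *\<^sub>R y) = t *\<^sub>R (x \<odot> y)" "(t *\<^sub>R x) \<odot> y = t *\<^sub>R (x \<odot> y)"
  by (simp_all add: quat_eq_iff qmul_def algebra_simps)

lemma qmul_zero [simp]: "x \<odot> 0 = 0" "0 \<odot> x = 0"
  by (simp_all add: quat_eq_iff qmul_def)

lemma qmul_qreal [simp]: "x \<odot> qreal t = t *\<^sub>R x" "qreal t \<odot> x = t *\<^sub>R x"
  by (simp_all add: quat_eq_iff qmul_def qreal_def algebra_simps)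

lemma qreal_minus: "qreal (- t) = - qreal t" and qreal_0 [simp]: "qreal 0 = 0"
  by (simp_all add: quat_eq_iff qreal_def)

lemma qcnj_qmul: "qcnj (x \<odot> y) = qcnj y \<odot> qcnj x"
  by (simp add: quat_eq_iff qmul_def qcnj_def algebra_simps)

lemma qcnj_simps [simp]: "qcnj (qcnj x) = x" "qcnj 0 = 0" "qcnj (qreal t) = qreal t"
  by (simp_all add: quat_eq_iff qcnj_def qreal_def)

lemma quat_inner: "(x::quat) \<bullet> y = x$0 * y$0 + x$1 * y$1 + x$2 * y$2 + x$3 * y$3"
  by (simp add: inner_vec_def sum_4')

lemma qmul_qcnj: "x \<odot> qcnj x = qreal (x \<bullet> x)" "qcnj x \<odot> x = qreal (x \<bullet> x)"
  by (simp_all add: quat_eq_iff qmul_def qcnj_def qreal_def quat_inner algebra_simps)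

lemma qmul_inner: "(u \<odot> x) \<bullet> (u \<odot> y) = (u \<bullet> u) * (x \<bullet> y)"
  by (simp add: quat_inner qmul_def algebra_simps)

lemma Sp1_mult_qcnj: "p \<in> Sp1 \<Longrightarrow> p \<odot> qcnj p = qreal 1" "p \<in> Sp1 \<Longrightarrow> qcnj p \<odot> p = qreal 1"
  by (simp_all add: Sp1_def qmul_qcnj norm_eq_1)

lemma mk2_nth [simp]:
  "mk2 a b c d $ 1 $ 1 = a" "mk2 a b c d $ 1 $ 2 = b" "mk2 a b c d $ 2 $ 1 = c" "mk2 a b c d $ 2 $ 2 = d"
  by (simp_all add: mk2_def)

lemma qmat_eq_iff:
  "(A::qmat) = B \<longleftrightarrow> A$1$1 = B$1$1 \<and> A$1$2 = B$1$2 \<and> A$2$1 = B$2$1 \<and> A$2$2 = B$2$2"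
  by (auto simp: vec_eq_iff forall_2)

lemma qmm_nth: "qmm A B $ i $ j = A$i$1 \<odot> B$1$j + A$i$2 \<odot> B$2$j"
  by (simp add: qmm_def sum_2)

lemma qadj_nth: "qadj A $ i $ j = qcnj (A$j$i)"
  by (simp add: qadj_def)

lemma qmm_assoc: "qmm (qmm A B) C = qmm A (qmm B C)"
  by (simp add: qmat_eq_iff qmm_nth qmul_add qmul_assoc algebra_simps)

lemma qcnj_add: "qcnj (x + y) = qcnj x + qcnj y"
  by (simp add: quat_eq_iff qcnj_def)

lemma qadj_qmm: "qadj (qmm A B) = qmm (qadj B) (qadj A)"
  by (simp add: qmat_eq_iff qmm_nth qadj_nth qcnj_add qcnj_qmul)

lemma qadj_qdiag: "qadj (qdiag l r) = qdiag (qcnj l) (qcnj r)"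
  by (simp add: qmat_eq_iff qadj_nth qdiag_def)

lemma Re_conj: "(p \<odot> (x \<odot> qcnj p)) $ 0 = (p \<bullet> p) * x$0"
  by (simp add: qmul_def qcnj_def quat_inner algebra_simps)

lemma spin_act_lift:
  assumes "p \<in> Sp1"
  shows "spin_act (act_Spin p A) v = act5 p (spin_act A v)"
proof -
  define B where "B = qmm (qmm A (herm v)) (qadj A)"
  have "qmm (qmm (act_Spin p A) (herm v)) (qadj (act_Spin p A)) =
        qmm (qdiag p (qreal 1)) (qmm B (qdiag (qcnj p) (qreal 1)))"
    by (simp add: act_Spin_def B_def qadj_qmm qadj_qdiag qmm_assoc)
  moreover have "p \<bullet> p = 1"
    using assms by (simp add: Sp1_def norm_eq_1)
  ultimately show ?thesis
    by (simp add: spin_act_def act5_def Let_def qmm_nth qdiag_def Re_conj flip: B_def)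
qed

lemma sphere_point_lift: "p \<in> Sp1 \<Longrightarrow> sphere_point (act_Spin p A) = act5 p (sphere_point A)"
  by (simp add: sphere_point_def spin_act_lift)

lemma frame_lift: "p \<in> Sp1 \<Longrightarrow> frame (act_Spin p A) i = act5 p (frame A i)"
  by (simp add: frame_def spin_act_lift)

lemma sphere_point_rmul:
  assumes "l \<in> Sp1" "r \<in> Sp1"
  shows "sphere_point (spin_rmul A (l, r)) = sphere_point A"
proof -
  have "qmm (qdiag l r) (qmm (herm (0, 1)) (qdiag (qcnj l) (qcnj r))) = herm (0, 1)"
    using assms by (simp add: qmat_eq_iff qmm_nth qdiag_def herm_def qreal_minus qmul_minus qmul_scaleR Sp1_mult_qcnj)
  moreover have "qmm (qmm (spin_rmul A (l, r)) X) (qadj (spin_rmul A (l, r))) =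
      qmm (qmm A (qmm (qdiag l r) (qmm X (qdiag (qcnj l) (qcnj r))))) (qadj A)" for X
    by (simp add: spin_rmul_def qadj_qmm qadj_qdiag qmm_assoc)
  ultimately show ?thesis
    by (simp add: sphere_point_def spin_act_def)
qed

lemma spin_act_rmul:
  "spin_act (spin_rmul A (l, r)) (q, 0) = spin_act A (l \<odot> q \<odot> qcnj r, 0)"
proof -
  have "qmm (qdiag l r) (qmm (herm (q, 0)) (qdiag (qcnj l) (qcnj r))) = herm (l \<odot> q \<odot> qcnj r, 0)"
    by (simp add: qmat_eq_iff qmm_nth qdiag_def herm_def qcnj_qmul qmul_assoc)
  moreover have "qmm (qmm (spin_rmul A (l, r)) X) (qadj (spin_rmul A (l, r))) =
      qmm (qmm A (qmm (qdiag l r) (qmm X (qdiag (qcnj l) (qcnj r))))) (qadj A)" for X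
    by (simp add: spin_rmul_def qadj_qmm qadj_qdiag qmm_assoc)
  ultimately show ?thesis
    by (simp add: spin_act_def)
qed

lemma istopology_M_top:
  "istopology (\<lambda>W. W \<subseteq> M \<and>
     openin (top_of_set (P_Spin \<times> UNIV)) {z \<in> P_Spin \<times> UNIV. assoc (fst z) (snd z) \<in> W})"
proof -
  let ?pre = "\<lambda>W. {z \<in> P_Spin \<times> UNIV. assoc (fst z) (snd z) \<in> W}"
  have "?pre (S \<inter> T) = ?pre S \<inter> ?pre T" for S T by auto
  moreover have "?pre (\<Union>\<K>) = (\<Union>K\<in>\<K>. ?pre K)" for \<K> by auto
  ultimately show ?thesis
    unfolding istopology_def by (auto intro!: openin_Int openin_Union)
qed

lemma openin_M_top:
  "openin M_top W \<longleftrightarrow> W \<subseteq> M \<and>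
     openin (top_of_set (P_Spin \<times> UNIV)) {z \<in> P_Spin \<times> UNIV. assoc (fst z) (snd z) \<in> W}"
  unfolding M_top_def by (simp add: topology_inverse'[OF istopology_M_top])

text \<open>\<open>frame A\<close> is an orthonormal basis of the tangent space at \<open>sphere_point A\<close>.\<close>

definition qtr :: "qmat \<Rightarrow> real" where
  "qtr X = X$1$1$0 + X$2$2$0"

lemma qtr_comm: "qtr (qmm X Y) = qtr (qmm Y X)"
  by (simp add: qtr_def qmm_nth qmul_def algebra_simps)

lemma qtr_herm: "qtr (qmm (herm v) (herm w)) = 2 * (v \<bullet> w)"
  by (cases v; cases w)
     (simp add: qtr_def qmm_nth herm_def qmul_def qcnj_def qreal_def inner_prod_def quat_inner algebra_simps)

lemma qmm_one: "qmm A (qdiag (qreal 1) (qreal 1)) = A" "qmm (qdiag (qreal 1) (qreal 1)) A = A"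
  by (simp_all add: qmat_eq_iff qmm_nth qdiag_def)

lemma qadj_herm: "qadj (herm v) = herm v"
  by (simp add: qmat_eq_iff qadj_nth herm_def)

lemma qadj_qadj: "qadj (qadj A) = A"
  by (simp add: qmat_eq_iff qadj_nth)

lemma herm_spin_act:
  assumes "A \<in> Sp2"
  shows "herm (spin_act A v) = qmm (qmm A (herm v)) (qadj A)"
proof -
  define B where "B = qmm (qmm A (herm v)) (qadj A)"
  have "qadj B = B"
    by (simp add: B_def qadj_qmm qadj_herm qadj_qadj qmm_assoc)
  then have self: "qcnj (B$1$1) = B$1$1" "qcnj (B$1$2) = B$2$1" "qcnj (B$2$2) = B$2$2"
    by (metis qadj_nth)+
  have "qtr B = qtr (qmm (qadj A) (qmm A (herm v)))"
    by (simp add: B_def qtr_comm[of "qmm A (herm v)"])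
  also have "\<dots> = qtr (qmm (qmm (qadj A) A) (herm v))"
    by (simp add: qmm_assoc)
  also have "\<dots> = 0"
    using assms by (simp add: Sp2_def qmm_one) (simp add: qtr_def herm_def qreal_def)
  finally have tr: "B$2$2$0 = - B$1$1$0"
    by (simp add: qtr_def)
  have "herm (B$1$2, B$1$1$0) = B"
    using self tr by (simp add: qmat_eq_iff herm_def) (simp add: quat_eq_iff qcnj_def qreal_def)
  then show ?thesis
    by (simp add: spin_act_def Let_def flip: B_def)
qed

lemma spin_act_inner:
  assumes "A \<in> Sp2"
  shows "spin_act A v \<bullet> spin_act A w = v \<bullet> w"
proof -
  have AA: "qmm (qadj A) A = qdiag (qreal 1) (qreal 1)"
    using assms by (simp add: Sp2_def)
  have "2 * (spin_act A v \<bullet> spin_act A w) =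
        qtr (qmm (qmm (qmm A (herm v)) (qadj A)) (qmm (qmm A (herm w)) (qadj A)))"
    by (simp add: assms herm_spin_act flip: qtr_herm)
  also have "\<dots> = qtr (qmm (qmm A (herm v)) (qmm (qmm (qadj A) A) (qmm (herm w) (qadj A))))"
    by (simp add: qmm_assoc)
  also have "\<dots> = qtr (qmm (qmm A (qmm (herm v) (herm w))) (qadj A))"
    by (simp add: AA qmm_one) (simp add: qmm_assoc)
  also have "\<dots> = qtr (qmm (qadj A) (qmm A (qmm (herm v) (herm w))))"
    by (rule qtr_comm)
  also have "\<dots> = qtr (qmm (qmm (qadj A) A) (qmm (herm v) (herm w)))"
    by (simp add: qmm_assoc)
  also have "\<dots> = 2 * (v \<bullet> w)"
    by (simp add: AA qmm_one qtr_herm)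
  finally show ?thesis by simp
qed

lemma sphere_point_in_sphere: "A \<in> P_Spin \<Longrightarrow> sphere_point A \<in> sphere 0 1"
  by (simp add: sphere_point_def norm_eq_1 spin_act_inner)

lemma frame_orthonormal:
  "A \<in> P_Spin \<Longrightarrow> frame A i \<bullet> frame A j = (if i = j then 1 else 0)"
  by (simp add: frame_def spin_act_inner qunit_def inner_axis_axis)

lemma frame_tangent: "A \<in> P_Spin \<Longrightarrow> frame A i \<bullet> sphere_point A = 0"
  by (simp add: frame_def sphere_point_def spin_act_inner)

lemma det_4':
  fixes X :: "real^4^4"
  shows "det X =
    X$0$0 * (X$1$1 * (X$2$2 * X$3$3 - X$2$3 * X$3$2) - X$1$2 * (X$2$1 * X$3$3 - X$2$3 * X$3$1)
           + X$1$3 * (X$2$1 * X$3$2 - X$2$2 * X$3$1)) -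
    X$0$1 * (X$1$0 * (X$2$2 * X$3$3 - X$2$3 * X$3$2) - X$1$2 * (X$2$0 * X$3$3 - X$2$3 * X$3$0)
           + X$1$3 * (X$2$0 * X$3$2 - X$2$2 * X$3$0)) +
    X$0$2 * (X$1$0 * (X$2$1 * X$3$3 - X$2$3 * X$3$1) - X$1$1 * (X$2$0 * X$3$3 - X$2$3 * X$3$0)
           + X$1$3 * (X$2$0 * X$3$1 - X$2$1 * X$3$0)) -
    X$0$3 * (X$1$0 * (X$2$1 * X$3$2 - X$2$2 * X$3$1) - X$1$1 * (X$2$0 * X$3$2 - X$2$2 * X$3$0)
           + X$1$2 * (X$2$0 * X$3$1 - X$2$1 * X$3$0))"
proof -
  have f: "finite {1, 2, 3 :: 4}" "0 \<notin> {1, 2, 3 :: 4}" "finite {2, 3 :: 4}" "1 \<notin> {2, 3 :: 4}"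
    "finite {3 :: 4}" "2 \<notin> {3 :: 4}" by auto
  show ?thesis
    unfolding det_def UNIV_4'
    unfolding sum_over_permutations_insert[OF f(1,2)]
    unfolding sum_over_permutations_insert[OF f(3,4)]
    unfolding sum_over_permutations_insert[OF f(5,6)]
    unfolding permutes_sing
    apply (simp add: sign_swap_id permutation_swap_id permutation_compose sign_compose sign_id swap_id_eq)
    by (simp add: algebra_simps)
qed

lemma det_qmul_left: "det (\<chi> i j. (l \<odot> qunit i) $ j) = (l \<bullet> l)\<^sup>2"
  by (simp add: det_4' qmul_def qunit_def axis_def quat_inner power2_eq_square algebra_simps)

lemma det_qmul_right: "det (\<chi> i j. (qunit i \<odot> r) $ j) = (r \<bullet> r)\<^sup>2"
  by (simp add: det_4' qmul_def qunit_def axis_def quat_inner power2_eq_square algebra_simps)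

lemma det_qmul_qmul: "det (\<chi> i j. (l \<odot> qunit i \<odot> r) $ j) = (l \<bullet> l)\<^sup>2 * (r \<bullet> r)\<^sup>2"
proof -
  have "(\<chi> i j. (l \<odot> qunit i \<odot> r) $ j) = (\<chi> i j. (l \<odot> qunit i) $ j) ** (\<chi> i j. (qunit i \<odot> r) $ j)"
    by (simp add: matrix_matrix_mult_def vec_eq_iff sum_4' all_4' qmul_def qunit_def axis_def algebra_simps)
  then show ?thesis
    by (simp only: det_mul det_qmul_left det_qmul_right)
qed

lemma frame_positive:
  assumes A: "A \<in> P_Spin" and u: "norm u = 1" and pos: "cos \<alpha> > 0"
    and x: "sphere_point A = (cos \<alpha> *\<^sub>R u, sin \<alpha>)"
  shows "det (\<chi> i j. frame A i \<bullet> orient_frame \<alpha> u j) > 0"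
proof -
  define a b c d where "a = A$1$1" and "b = A$2$1" and "c = A$1$2" and "d = A$2$2"
  note abcd = a_def b_def c_def d_def
  have uu: "u \<bullet> u = 1" using u by (simp add: norm_eq_1)
  have rows: "a \<bullet> a + c \<bullet> c = 1" "b \<bullet> b + d \<bullet> d = 1" "a \<odot> qcnj b + c \<odot> qcnj d = 0"
    and cols: "a \<bullet> a + b \<bullet> b = 1" "c \<bullet> c + d \<bullet> d = 1"
  proof -
    have "qmm A (qadj A) $ 1 $ 1 $ 0 = 1" "qmm A (qadj A) $ 2 $ 2 $ 0 = 1" "qmm A (qadj A) $ 1 $ 2 = 0"
      "qmm (qadj A) A $ 1 $ 1 $ 0 = 1" "qmm (qadj A) A $ 2 $ 2 $ 0 = 1"
      using A by (simp_all add: Sp2_def qdiag_def qreal_def)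
    then show "a \<bullet> a + c \<bullet> c = 1" "b \<bullet> b + d \<bullet> d = 1" "a \<odot> qcnj b + c \<odot> qcnj d = 0"
      "a \<bullet> a + b \<bullet> b = 1" "c \<bullet> c + d \<bullet> d = 1"
      unfolding qmm_nth qadj_nth qmul_qcnj abcd by (simp_all add: qreal_def)
  qed
  have x1: "a \<odot> qcnj b - c \<odot> qcnj d = cos \<alpha> *\<^sub>R u" and x2: "a \<bullet> a - c \<bullet> c = sin \<alpha>"
  proof -
    define B where "B = qmm (qmm A (herm (0, 1))) (qadj A)"
    have "sphere_point A = (B$1$2, B$1$1$0)"
      by (simp add: sphere_point_def spin_act_def B_def Let_def)
    then have B: "B$1$2 = cos \<alpha> *\<^sub>R u" "B$1$1$0 = sin \<alpha>"
      using x by simp_all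
    have "B$1$2 = a \<odot> qcnj b - c \<odot> qcnj d" "B$1$1 = qreal (a \<bullet> a) - qreal (c \<bullet> c)"
      unfolding B_def qmm_nth qadj_nth herm_def mk2_nth abcd
      by (simp_all add: qreal_minus qmul_minus qmul_scaleR qmul_qcnj)
    with B show "a \<odot> qcnj b - c \<odot> qcnj d = cos \<alpha> *\<^sub>R u" "a \<bullet> a - c \<bullet> c = sin \<alpha>"
      by (simp_all add: qreal_def)
  qed
  define k where "k = a \<bullet> a"
  have k: "2 * k = 1 + sin \<alpha>" "d \<bullet> d = k"
    using rows cols x2 by (auto simp: k_def)
  have "sin \<alpha> > -1"
  proof -
    have "(sin \<alpha>)\<^sup>2 < 1"
      using pos by (simp add: sin_squared_eq)
    then show ?thesis
      by (metis abs_square_less_1 abs_less_iff minus_less_iff)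
  qed
  then have k0: "k > 0" using k by simp
  have neg: "c \<odot> qcnj d = - (a \<odot> qcnj b)"
    using rows(3) by (simp only: add_eq_0_iff)
  have ab: "2 *\<^sub>R (a \<odot> qcnj b) = cos \<alpha> *\<^sub>R u" and cd: "2 *\<^sub>R (c \<odot> qcnj d) = - (cos \<alpha> *\<^sub>R u)"
    unfolding x1[symmetric] neg by (simp_all add: scaleR_2)
  have cd2: "c = - (cos \<alpha> / (2 * k)) *\<^sub>R (u \<odot> d)"
  proof -
    have "(2 *\<^sub>R (c \<odot> qcnj d)) \<odot> d = (2 * k) *\<^sub>R c"
      by (simp add: qmul_scaleR qmul_assoc qmul_qcnj k)
    then have "(2 * k) *\<^sub>R c = - (cos \<alpha> *\<^sub>R (u \<odot> d))"
      by (simp add: cd qmul_scaleR qmul_minus)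
    then have "(1 / (2 * k)) *\<^sub>R ((2 * k) *\<^sub>R c) = (1 / (2 * k)) *\<^sub>R (- (cos \<alpha> *\<^sub>R (u \<odot> d)))"
      by simp
    then show ?thesis using k0 by simp
  qed
  have ab2: "qcnj b = (cos \<alpha> / (2 * k)) *\<^sub>R (qcnj a \<odot> u)"
  proof -
    have "qcnj a \<odot> (2 *\<^sub>R (a \<odot> qcnj b)) = (2 * k) *\<^sub>R qcnj b"
      by (simp add: qmul_scaleR qmul_qcnj k_def flip: qmul_assoc)
    then have "(2 * k) *\<^sub>R qcnj b = cos \<alpha> *\<^sub>R (qcnj a \<odot> u)"
      by (simp add: ab qmul_scaleR)
    then have "(1 / (2 * k)) *\<^sub>R ((2 * k) *\<^sub>R qcnj b) = (1 / (2 * k)) *\<^sub>R (cos \<alpha> *\<^sub>R (qcnj a \<odot> u))"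
      by simp
    then show ?thesis using k0 by simp
  qed
  define P where "P i = qcnj u \<odot> a \<odot> qunit i \<odot> qcnj d" for i
  have uP: "u \<odot> P i = a \<odot> qunit i \<odot> qcnj d" for i
    by (simp add: P_def uu qmul_qcnj flip: qmul_assoc)
  have Pu: "qcnj (P i) = d \<odot> qcnj (qunit i) \<odot> qcnj a \<odot> u" for i
    by (simp add: P_def qcnj_qmul qmul_assoc)
  have F1: "fst (frame A i) = u \<odot> P i - (cos \<alpha> / (2 * k))\<^sup>2 *\<^sub>R (u \<odot> qcnj (P i))" for i
  proof -
    have "fst (frame A i) = a \<odot> qunit i \<odot> qcnj d + c \<odot> qcnj (qunit i) \<odot> qcnj b"
      by (simp add: frame_def spin_act_def Let_def qmm_nth qadj_nth herm_def abcd add.commute)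
    then show ?thesis
      by (simp add: uP Pu cd2 ab2 qmul_scaleR qmul_minus qmul_assoc power2_eq_square)
  qed
  have F2: "snd (frame A i) = - (cos \<alpha> / k) * P i $ 0" for i
  proof -
    have "snd (frame A i) = 2 * (a \<odot> qunit i \<odot> qcnj c) $ 0"
      unfolding frame_def spin_act_def Let_def qmm_nth qadj_nth herm_def mk2_nth abcd snd_conv fst_conv
      by (simp add: qmul_def qcnj_def qreal_def algebra_simps)
    also have "qcnj c = - (cos \<alpha> / (2 * k)) *\<^sub>R (qcnj d \<odot> qcnj u)"
      by (simp add: cd2 quat_eq_iff qmul_def qcnj_def algebra_simps)
    also have "a \<odot> qunit i \<odot> (- (cos \<alpha> / (2 * k)) *\<^sub>R (qcnj d \<odot> qcnj u)) =
        - (cos \<alpha> / (2 * k)) *\<^sub>R (u \<odot> (P i \<odot> qcnj u))"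
      by (simp add: qmul_scaleR qmul_minus uP flip: qmul_assoc)
    finally show ?thesis
      by (simp add: Re_conj uu)
  qed
  have "(cos \<alpha> / (2 * k))\<^sup>2 * k = 1 - k"
  proof -
    have "(cos \<alpha>)\<^sup>2 = (1 - sin \<alpha>) * (1 + sin \<alpha>)"
      by (simp add: cos_squared_eq power2_eq_square algebra_simps)
    also have "\<dots> = (2 - 2 * k) * (2 * k)"
      using k(1) by (simp add: algebra_simps)
    finally show ?thesis
      using k0 by (simp add: field_simps power2_eq_square)
  qed
  then have mm: "(cos \<alpha> / (2 * k))\<^sup>2 = (1 - k) / k"
    using k0 by (simp add: field_simps)
  have entry: "frame A i \<bullet> orient_frame \<alpha> u j = (- 1 / k) * P i $ j" for i j
  proof -
    define m where "m = (cos \<alpha> / (2 * k))\<^sup>2"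
    have fr: "frame A i = (u \<odot> (P i - m *\<^sub>R qcnj (P i)), - (cos \<alpha> / k) * P i $ 0)"
      using F1[of i] F2[of i] by (simp add: prod_eq_iff m_def qmul_diff qmul_scaleR)
    have m: "m = (1 - k) / k" by (simp add: m_def mm)
    have s: "sin \<alpha> = 2 * k - 1" using k by simp
    have c2: "cos \<alpha> * cos \<alpha> = 4 * k * (1 - k)"
    proof -
      have "cos \<alpha> * cos \<alpha> = 1 - sin \<alpha> * sin \<alpha>"
        using cos_squared_eq[of \<alpha>] by (simp add: power2_eq_square)
      then show ?thesis by (simp only: s) (simp add: algebra_simps)
    qed
    have X: "(u \<odot> X) \<bullet> u = X $ 0" for X
    proof -
      have "X \<bullet> qreal 1 = X $ 0" by (simp add: quat_inner qreal_def)
      then show ?thesis using qmul_inner[of u X "qreal 1"] uu by simp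
    qed
    have Y: "(u \<odot> X) \<bullet> (u \<odot> qunit j) = X $ j" for X
      using qmul_inner[of u X "qunit j"] uu by (simp add: qunit_def inner_axis)
    show ?thesis
    proof (cases "j = 0")
      case True
      have "frame A i \<bullet> orient_frame \<alpha> u j =
          - sin \<alpha> * (P i $ 0 - m * P i $ 0) - (cos \<alpha> * cos \<alpha>) / k * P i $ 0"
        using True by (simp add: fr orient_frame_def X qcnj_def)
      also have "\<dots> = (- 1 / k) * P i $ j"
        using k0 True by (simp add: s c2 m field_simps)
      finally show ?thesis .
    next
      case False
      have "\<forall>j. j \<noteq> 0 \<longrightarrow> qcnj (P i) $ j = - P i $ j"
        unfolding all_4' by (simp add: qcnj_def)
      with False have "frame A i \<bullet> orient_frame \<alpha> u j = - (P i $ j + m * P i $ j)"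
        using False by (simp add: fr orient_frame_def Y)
      also have "\<dots> = (- 1 / k) * P i $ j"
        using k0 by (simp add: m field_simps)
      finally show ?thesis .
    qed
  qed
  have "(\<chi> i j. frame A i \<bullet> orient_frame \<alpha> u j) = (\<chi> i j. (((- 1 / k) *\<^sub>R (qcnj u \<odot> a)) \<odot> qunit i \<odot> qcnj d) $ j)"
    by (simp add: vec_eq_iff entry P_def qmul_scaleR qmul_minus)
  then have "det (\<chi> i j. frame A i \<bullet> orient_frame \<alpha> u j) =
      (((- 1 / k) *\<^sub>R (qcnj u \<odot> a)) \<bullet> ((- 1 / k) *\<^sub>R (qcnj u \<odot> a)))\<^sup>2 * (qcnj d \<bullet> qcnj d)\<^sup>2"
    by (simp only: det_qmul_qmul)
  also have "\<dots> > 0"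
  proof -
    have 1: "qcnj d \<bullet> qcnj d = k" using k by (simp add: quat_inner qcnj_def)
    have 2: "(qcnj u \<odot> a) \<bullet> (qcnj u \<odot> a) = k"
      using uu by (simp add: qmul_inner k_def) (simp add: quat_inner qcnj_def)
    show ?thesis using k0 by (simp add: 1 2)
  qed
  finally show ?thesis .
qed

end

theory Submission
  imports Defs
begin

text \<open>
  Sending the class of \<open>(A, a)\<close> to \<open>(q\<^sub>1, q\<^sub>2) = c a\<^sup>*\<close>, with \<open>c\<close> the second column of \<open>A\<close>, identifies \<open>M\<^sub>0\<close>
  with \<open>\<bbbH>\<^sup>2 - {0}\<close>, and the group acts by left multiplication on \<open>q\<^sub>1\<close>.  The orbits of \<open>q\<^sub>1 \<noteq> 0\<close> are
  3-spheres, so an invariant Cayley submanifold is swept out by a curve in the orbit space, and the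
  Cayley condition is an ordinary differential equation with first integrals \<open>q\<^sub>2 / |q\<^sub>2|\<close> and
  \<open>t\<^sup>2 (5 t\<^sup>2 - 3 s\<^sup>2)\<^sup>5 / (s\<^sup>2 + t\<^sup>2)\<^sup>3\<close>, where \<open>s = |q\<^sub>1|\<close> and \<open>t = |q\<^sub>2|\<close>.

  Since the second integral is homogeneous, each of its level sets is parametrised by \<open>q\<^sub>1 q\<^sub>2\<^sup>-\<^sup>1\<close> alone:
  over \<open>3 s\<^sup>2 < 5 t\<^sup>2\<close> by a ball, over \<open>3 s\<^sup>2 > 5 t\<^sup>2\<close> by the complement of one.  The zero level is a cone,
  and the remaining fibre is \<open>q\<^sub>2 = 0\<close>.  Every fibre thus has a single chart \<open>z \<mapsto> (f(|z|) z, h(|z|))\<close> in a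
  suitable stereographic gauge, where calibration comes down to the identity
  \<open>S (15 - S)\<^sup>2 + 5 (5 - 3 S)\<^sup>2 = (S + 5)\<^sup>3\<close> for \<open>S = s\<^sup>2 / t\<^sup>2\<close>.
\<close>

section \<open>Smooth functions\<close>

text \<open>The gauge is chosen to make the Cayley equation scalar. In
  \<open>stereo_gauge (qdiag (qreal 1) v)\<close> the condition q2 / |q2| = v says exactly that the
  fibre coordinate is a positive real number, so a fibre becomes a graph with real fibre coordinate
  \<open>h\<close>. The coframe is conformal to \<open>dy\<close> and the connection form is an
  imaginary part, hence everything pulled back to the chart depends only on |z|, \<open>f\<close>,
  \<open>h\<close> and the two radial slopes \<open>h1\<close> and \<open>p = f + f1 |z|^2\<close>.
  In these slopes \<open>Phi0\<close> is linear, while the volume is the square root of a quadratic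
  form. Equality is the equality case of the Cauchy-Schwarz inequality and fixes the ratio of the
  slopes, h1 : p = h f (15 - S) : (1 + S) (5 - 3 S). Only the ratio matters, which is why the cone,
  where \<open>p = 0\<close>, fits the same scheme. The sign is an orientation condition: a
  parametrisation of the right set can still have volume \<open>- Phi0\<close>. The obstacle at the
  end is global: no single chart of the parameter space sees both the fibre over 0 and the cones, so
  the submersion property is checked in two charts with different gauges.\<close>

lemma times_differentiable_on_cong:
  assumes "open S" "\<And>x. x \<in> S \<Longrightarrow> f x = g x"
  shows "times_differentiable_on n f S \<longleftrightarrow> times_differentiable_on n g S"
  using assms(2)
proof (induction n arbitrary: f g)
  case 0
  then show ?case by (simp cong: continuous_on_cong)
next
  case (Suc n)
  have d: "(f has_derivative D) (at x) \<longleftrightarrow> (g has_derivative D) (at x)" if "x \<in> S" for x D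
    using Suc.prems that assms(1)
    by (metis has_derivative_transform_within_open)
  then have "f differentiable (at x) \<longleftrightarrow> g differentiable (at x)" if "x \<in> S" for x
    using that by (simp add: differentiable_def)
  moreover have "frechet_derivative f (at x) = frechet_derivative g (at x)" if "x \<in> S" for x
    using d that by (simp add: frechet_derivative_def)
  then have "times_differentiable_on n (\<lambda>x. frechet_derivative f (at x) v) S \<longleftrightarrow>
      times_differentiable_on n (\<lambda>x. frechet_derivative g (at x) v) S" for v
    by (intro Suc.IH) simp
  ultimately show ?case by simp
qed

text \<open>Replaces the \<open>frechet_derivative\<close> of the recursive definition by an
  explicit formula \<open>D\<close>, to which the induction hypotheses of the closure rules below
  can be applied.\<close>

lemma times_differentiable_on_SucI:
  assumes "open S" "\<And>x. x \<in> S \<Longrightarrow> (f has_derivative D x) (at x)"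
    and "\<And>v. times_differentiable_on n (\<lambda>x. D x v) S"
  shows "times_differentiable_on (Suc n) f S"
proof -
  have "frechet_derivative f (at x) = D x" if "x \<in> S" for x
    using assms(2)[OF that] by (metis frechet_derivative_at)
  then have "times_differentiable_on n (\<lambda>x. frechet_derivative f (at x) v) S \<longleftrightarrow>
      times_differentiable_on n (\<lambda>x. D x v) S" for v
    by (intro times_differentiable_on_cong assms(1)) simp
  then show ?thesis
    using assms(2,3) by (auto simp: differentiable_def)
qed

lemma times_differentiable_on_Suc_derivative:
  assumes "times_differentiable_on (Suc n) f S" "x \<in> S"
  shows "(f has_derivative frechet_derivative f (at x)) (at x)"
  using assms by (simp add: frechet_derivative_works)

text \<open>Product and chain rules leave undifferentiated factors, which the induction needs at one
  order less than they are given.\<close>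

lemma times_differentiable_on_SucD:
  "times_differentiable_on (Suc n) f S \<Longrightarrow> times_differentiable_on n f S"
proof (induction n arbitrary: f)
  case 0
  then show ?case
    by (auto intro!: continuous_at_imp_continuous_on differentiable_imp_continuous_within)
next
  case (Suc n)
  from Suc.prems have "times_differentiable_on (Suc n) (\<lambda>x. frechet_derivative f (at x) v) S" for v
    by simp
  then have "times_differentiable_on n (\<lambda>x. frechet_derivative f (at x) v) S" for v
    by (rule Suc.IH)
  moreover have "\<forall>x\<in>S. f differentiable (at x)" using Suc.prems by simp
  ultimately show ?case by simp
qed

lemma times_differentiable_on_const:
  "open S \<Longrightarrow> times_differentiable_on n (\<lambda>x. c) S"
proof (induction n arbitrary: c)
  case (Suc n)
  show ?case
    by (rule times_differentiable_on_SucI[where D = "\<lambda>x v. 0"]) (use Suc in auto)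
qed auto

lemma times_differentiable_on_linear:
  assumes "open S" "bounded_linear L"
  shows "times_differentiable_on n L S"
proof (cases n)
  case (Suc k)
  show ?thesis
    unfolding Suc
    by (rule times_differentiable_on_SucI[where D = "\<lambda>x. L"])
      (use assms in \<open>auto intro: times_differentiable_on_const bounded_linear_imp_has_derivative\<close>)
qed (use assms in \<open>auto intro: bounded_linear.continuous_on continuous_on_id\<close>)

lemma times_differentiable_on_compose_linear:
  assumes "open S" "bounded_linear L"
  shows "times_differentiable_on n f S \<Longrightarrow> times_differentiable_on n (\<lambda>x. L (f x)) S"
proof (induction n arbitrary: f)
  case 0
  then show ?case using assms(2) by (auto intro: bounded_linear.continuous_on)
next
  case (Suc n)
  show ?case
  proof (rule times_differentiable_on_SucI[where D = "\<lambda>x v. L (frechet_derivative f (at x) v)"])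
    show "((\<lambda>x. L (f x)) has_derivative (\<lambda>v. L (frechet_derivative f (at x) v))) (at x)"
      if "x \<in> S" for x
      by (rule bounded_linear.has_derivative[OF assms(2)
            times_differentiable_on_Suc_derivative[OF Suc.prems that]])
    show "times_differentiable_on n (\<lambda>x. L (frechet_derivative f (at x) v)) S" for v
      using Suc.prems by (intro Suc.IH) simp
  qed (rule assms(1))
qed

lemma times_differentiable_on_add:
  assumes "open S"
  shows "times_differentiable_on n f S \<Longrightarrow> times_differentiable_on n g S \<Longrightarrow>
    times_differentiable_on n (\<lambda>x. f x + g x) S"
proof (induction n arbitrary: f g)
  case 0
  then show ?case by (auto intro: continuous_on_add)
next
  case (Suc n)
  show ?case
  proof (rule times_differentiable_on_SucI[where
        D = "\<lambda>x v. frechet_derivative f (at x) v + frechet_derivative g (at x) v"])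
    show "((\<lambda>x. f x + g x) has_derivative
        (\<lambda>v. frechet_derivative f (at x) v + frechet_derivative g (at x) v)) (at x)" if "x \<in> S" for x
      by (rule has_derivative_add[OF times_differentiable_on_Suc_derivative[OF Suc.prems(1) that]
            times_differentiable_on_Suc_derivative[OF Suc.prems(2) that]])
    show "times_differentiable_on n
        (\<lambda>x. frechet_derivative f (at x) v + frechet_derivative g (at x) v) S" for v
      using Suc.prems by (intro Suc.IH) simp_all
  qed (rule assms)
qed

text \<open>One rule for real products, scalings, inner products and quaternion
  multiplication.\<close>

lemma times_differentiable_on_bilinear:
  assumes "open S" "bounded_bilinear B"
  shows "times_differentiable_on n f S \<Longrightarrow> times_differentiable_on n g S \<Longrightarrow>
    times_differentiable_on n (\<lambda>x. B (f x) (g x)) S"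
proof (induction n arbitrary: f g)
  case 0
  then show ?case using bounded_bilinear.continuous_on[OF assms(2)] by auto
next
  case (Suc n)
  show ?case
  proof (rule times_differentiable_on_SucI[where D =
        "\<lambda>x v. B (f x) (frechet_derivative g (at x) v) + B (frechet_derivative f (at x) v) (g x)"])
    show "((\<lambda>x. B (f x) (g x)) has_derivative
        (\<lambda>v. B (f x) (frechet_derivative g (at x) v) + B (frechet_derivative f (at x) v) (g x))) (at x)"
      if "x \<in> S" for x
      using Suc.prems that
      by (intro bounded_bilinear.FDERIV[OF assms(2)] times_differentiable_on_Suc_derivative)
    show "times_differentiable_on n
        (\<lambda>x. B (f x) (frechet_derivative g (at x) v) + B (frechet_derivative f (at x) v) (g x)) S" for v
      using Suc.prems
      by (intro times_differentiable_on_add Suc.IH assms(1) times_differentiable_on_SucD[OF Suc.prems(1)]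
           times_differentiable_on_SucD[OF Suc.prems(2)]) auto
  qed (rule assms(1))
qed

text \<open>The derivative contains the exponent \<open>c - 1\<close>, hence the induction over all
  exponents at once. Norms, roots and reciprocals are later written with \<open>powr\<close> of a
  positive function so that this rule covers them.\<close>

lemma times_differentiable_on_powr:
  fixes f :: "'a::real_normed_vector \<Rightarrow> real"
  assumes "open S" "\<And>x. x \<in> S \<Longrightarrow> f x > 0"
  shows "times_differentiable_on n f S \<Longrightarrow> times_differentiable_on n (\<lambda>x. f x powr c) S"
proof (induction n arbitrary: c)
  case 0
  have "\<forall>x\<in>S. f x \<noteq> 0" using assms(2) by force
  with 0 show ?case by (auto intro!: continuous_on_powr)
next
  case (Suc n)
  show ?case
  proof (rule times_differentiable_on_SucI[where D =
        "\<lambda>x v. (c * f x powr (c - 1)) * frechet_derivative f (at x) v"])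
    show "((\<lambda>x. f x powr c) has_derivative
        (\<lambda>v. (c * f x powr (c - 1)) * frechet_derivative f (at x) v)) (at x)" if "x \<in> S" for x
    proof -
      have "((\<lambda>t. t powr c) has_real_derivative c * f x powr (c - 1)) (at (f x))"
        using assms(2)[OF that] by (rule has_real_derivative_powr)
      from has_derivative_compose[OF times_differentiable_on_Suc_derivative[OF Suc.prems that]
          this[unfolded has_field_derivative_def]]
      show ?thesis .
    qed
    show "times_differentiable_on n (\<lambda>x. (c * f x powr (c - 1)) * frechet_derivative f (at x) v) S" for v
      using Suc.prems
      by (intro times_differentiable_on_bilinear[OF _ bounded_bilinear_mult] Suc.IH assms(1)
           times_differentiable_on_const times_differentiable_on_SucD[OF Suc.prems]) auto
  qed (rule assms(1))
qed

lemma times_differentiable_on_exp: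
  fixes f :: "'a::real_normed_vector \<Rightarrow> real"
  assumes "open S"
  shows "times_differentiable_on n f S \<Longrightarrow> times_differentiable_on n (\<lambda>x. exp (f x)) S"
proof (induction n)
  case 0
  then show ?case by (auto intro: continuous_on_exp)
next
  case (Suc n)
  show ?case
  proof (rule times_differentiable_on_SucI[where D = "\<lambda>x v. exp (f x) * frechet_derivative f (at x) v"])
    show "((\<lambda>x. exp (f x)) has_derivative (\<lambda>v. exp (f x) * frechet_derivative f (at x) v)) (at x)"
      if "x \<in> S" for x
      using has_derivative_exp[OF times_differentiable_on_Suc_derivative[OF Suc.prems that]]
      by (simp add: mult.commute)
    show "times_differentiable_on n (\<lambda>x. exp (f x) * frechet_derivative f (at x) v) S" for v
      using Suc.prems
      by (intro times_differentiable_on_bilinear[OF _ bounded_bilinear_mult] Suc.IH assms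
           times_differentiable_on_SucD[OF Suc.prems]) auto
  qed (rule assms)
qed

lemma smooth_on_cong:
  assumes "open S" "\<And>x. x \<in> S \<Longrightarrow> f x = g x"
  shows "smooth_on S f \<longleftrightarrow> smooth_on S g"
  unfolding smooth_on_def by (simp add: times_differentiable_on_cong[OF assms])

lemma smooth_on_const: "open S \<Longrightarrow> smooth_on S (\<lambda>x. c)"
  by (simp add: smooth_on_def times_differentiable_on_const)

lemma smooth_on_linear: "open S \<Longrightarrow> bounded_linear L \<Longrightarrow> smooth_on S L"
  by (simp add: smooth_on_def times_differentiable_on_linear)

lemma smooth_on_id: "open S \<Longrightarrow> smooth_on S (\<lambda>x. x)"
  by (rule smooth_on_linear[OF _ bounded_linear_ident])

lemma smooth_on_compose_linear:
  "open S \<Longrightarrow> bounded_linear L \<Longrightarrow> smooth_on S f \<Longrightarrow> smooth_on S (\<lambda>x. L (f x))"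
  by (simp add: smooth_on_def times_differentiable_on_compose_linear)

lemma smooth_on_add:
  "open S \<Longrightarrow> smooth_on S f \<Longrightarrow> smooth_on S g \<Longrightarrow> smooth_on S (\<lambda>x. f x + g x)"
  by (simp add: smooth_on_def times_differentiable_on_add)

lemma smooth_on_diff:
  assumes "open S" "smooth_on S f" "smooth_on S g"
  shows "smooth_on S (\<lambda>x. f x - g x)"
  using smooth_on_add[OF assms(1,2) smooth_on_compose_linear[OF assms(1) bounded_linear_minus[OF bounded_linear_ident] assms(3)]]
  by simp

lemma smooth_on_bilinear:
  "open S \<Longrightarrow> bounded_bilinear B \<Longrightarrow> smooth_on S f \<Longrightarrow> smooth_on S g \<Longrightarrow> smooth_on S (\<lambda>x. B (f x) (g x))"
  by (simp add: smooth_on_def times_differentiable_on_bilinear)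

lemmas smooth_on_mult = smooth_on_bilinear[OF _ bounded_bilinear_mult]
lemmas smooth_on_scaleR = smooth_on_bilinear[OF _ bounded_bilinear_scaleR]
lemmas smooth_on_inner = smooth_on_bilinear[OF _ bounded_bilinear_inner]
lemmas smooth_on_fst = smooth_on_compose_linear[OF _ bounded_linear_fst]
lemmas smooth_on_snd = smooth_on_compose_linear[OF _ bounded_linear_snd]

lemma smooth_on_powr:
  fixes f :: "'a::real_normed_vector \<Rightarrow> real"
  shows "open S \<Longrightarrow> (\<And>x. x \<in> S \<Longrightarrow> f x > 0) \<Longrightarrow> smooth_on S f \<Longrightarrow> smooth_on S (\<lambda>x. f x powr c)"
  by (simp add: smooth_on_def times_differentiable_on_powr)

lemma smooth_on_exp:
  fixes f :: "'a::real_normed_vector \<Rightarrow> real"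
  shows "open S \<Longrightarrow> smooth_on S f \<Longrightarrow> smooth_on S (\<lambda>x. exp (f x))"
  by (simp add: smooth_on_def times_differentiable_on_exp)

lemma smooth_on_Pair:
  assumes "open S" "smooth_on S f" "smooth_on S g"
  shows "smooth_on S (\<lambda>x. (f x, g x))"
proof -
  have "bounded_linear (\<lambda>a. (a, 0::'c))" "bounded_linear (\<lambda>b. (0::'b, b))"
    by (intro bounded_linear_Pair bounded_linear_ident bounded_linear_zero)+
  from smooth_on_add[OF assms(1) smooth_on_compose_linear[OF assms(1) this(1) assms(2)]
      smooth_on_compose_linear[OF assms(1) this(2) assms(3)]]
  show ?thesis by simp
qed

lemma smooth_on_imp_continuous_on: "smooth_on S f \<Longrightarrow> continuous_on S f"
  by (metis smooth_on_def times_differentiable_on.simps(1))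

section \<open>Stereographic gauges\<close>

lemma bounded_linear_mkq:
  assumes "bounded_linear a" "bounded_linear b" "bounded_linear c" "bounded_linear d"
  shows "bounded_linear (\<lambda>x. mkq (a x) (b x) (c x) (d x))"
proof -
  have "(\<lambda>x. mkq (a x) (b x) (c x) (d x)) =
      (\<lambda>x. a x *\<^sub>R axis 0 1 + b x *\<^sub>R axis 1 1 + c x *\<^sub>R axis 2 1 + d x *\<^sub>R axis 3 1)"
    by (simp add: fun_eq_iff quat_eq_iff axis_def)
  then show ?thesis
    using assms by (auto intro!: bounded_linear_add bounded_linear_scaleR_const)
qed

lemma bounded_linear_qcnj: "bounded_linear qcnj"
  unfolding qcnj_def
  by (intro bounded_linear_mkq bounded_linear_minus bounded_linear_vec_nth)

lemma bounded_bilinear_qmul: "bounded_bilinear qmul"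
proof -
  have "bilinear qmul"
    by (auto simp: bilinear_def linear_iff qmul_add qmul_scaleR)
  then show ?thesis
    by (simp add: bilinear_conv_bounded_bilinear)
qed

lemma bounded_linear_qreal: "bounded_linear qreal"
  unfolding qreal_def by (intro bounded_linear_mkq bounded_linear_ident bounded_linear_zero)

lemma inner_qcnj: "qcnj x \<bullet> qcnj y = x \<bullet> y"
  by (simp add: quat_inner qcnj_def)

lemma norm_qcnj [simp]: "norm (qcnj x) = norm x"
  by (simp add: norm_eq_sqrt_inner inner_qcnj)

lemma qcnj_eq_0 [simp]: "qcnj x = 0 \<longleftrightarrow> x = 0"
  by (metis norm_qcnj norm_eq_zero)

lemma inner_qmul_qmul: "(x \<odot> y) \<bullet> (x \<odot> y) = (x \<bullet> x) * (y \<bullet> y)"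
  by (rule qmul_inner)

lemma norm_qmul: "norm (x \<odot> y) = norm x * norm y"
  by (simp add: norm_eq_sqrt_inner inner_qmul_qmul real_sqrt_mult)

lemma qmul_eq_0 [simp]: "x \<odot> y = 0 \<longleftrightarrow> x = 0 \<or> y = 0"
  by (metis norm_qmul norm_eq_zero mult_eq_0_iff)

lemma qcnj_scaleR: "qcnj (t *\<^sub>R x) = t *\<^sub>R qcnj x"
  by (simp add: quat_eq_iff qcnj_def)

lemma qmul_right_inverse: "(x \<odot> y) \<odot> qcnj y = (y \<bullet> y) *\<^sub>R x"
  by (simp add: qmul_assoc qmul_qcnj)

lemma qmul_right_inverse': "(x \<odot> qcnj y) \<odot> y = (y \<bullet> y) *\<^sub>R x"
  by (simp add: qmul_assoc qmul_qcnj)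

definition qone :: qmat where
  "qone = qdiag (qreal 1) (qreal 1)"

text \<open>The second column of \<open>affine_gauge y\<close> spans the quaternionic line with affine coordinate
  \<open>q\<^sub>1 q\<^sub>2\<^sup>-\<^sup>1 = y\<close>; on \<open>S\<^sup>4\<close> this is stereographic projection.  Left multiplication by \<open>B \<in> Sp(2)\<close>
  is an isometry, so that one set of connection forms serves all \<open>B\<close>.\<close>

definition affine_gauge :: "quat \<Rightarrow> qmat" where
  "affine_gauge y = (1 + y \<bullet> y) powr (-1/2) *\<^sub>R mk2 (qreal 1) y (- qcnj y) (qreal 1)"

definition stereo_gauge :: "qmat \<Rightarrow> quat \<Rightarrow> qmat" where
  "stereo_gauge B y = qmm B (affine_gauge y)"

text \<open>For \<open>i = 1, 2, 3\<close> these are the components of \<open>c\<^sup>* dc\<close>,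
  where \<open>c\<close> is the second column of \<open>affine_gauge y\<close>: the canonical
  connection of the tautological quaternionic line bundle, i.e. the standard instanton on the
  4-sphere.\<close>

definition conn :: "4 \<Rightarrow> quat \<Rightarrow> quat \<Rightarrow> real" where
  "conn i y v = (qcnj y \<odot> v) $ i / (1 + y \<bullet> y)"

lemma one_plus_inner_pos: "1 + y \<bullet> (y::quat) > 0" "1 + y \<bullet> y \<noteq> 0"
  using inner_ge_zero[of y] by linarith+

lemma powr_half_square:
  assumes "x > (0::real)"
  shows "x powr - (1/2) * x powr - (1/2) = 1 / x" "x powr - (1/2) * (x powr - (1/2) * x) = 1"
proof -
  show "x powr - (1/2) * x powr - (1/2) = 1 / x"
    using assms by (simp flip: powr_add add: powr_minus_divide)
  with assms show "x powr - (1/2) * (x powr - (1/2) * x) = 1"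
    by (simp flip: mult.assoc)
qed

lemma qadj_scaleR: "qadj (t *\<^sub>R A) = t *\<^sub>R qadj A"
  by (simp add: qmat_eq_iff qadj_nth qcnj_scaleR)

lemma qmm_scaleR: "qmm (t *\<^sub>R A) B = t *\<^sub>R qmm A B" "qmm A (t *\<^sub>R B) = t *\<^sub>R qmm A B"
  by (simp_all add: qmat_eq_iff qmm_nth qmul_scaleR scaleR_add_right)

lemma qmm_add: "qmm (A + B) C = qmm A C + qmm B C" "qmm A (B + C) = qmm A B + qmm A C"
  by (simp_all add: qmat_eq_iff qmm_nth qmul_add algebra_simps)

lemma qcnj_minus: "qcnj (- x) = - qcnj x"
  by (simp add: quat_eq_iff qcnj_def)

lemma affine_gauge_in_Sp2: "affine_gauge y \<in> Sp2"
proof -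
  let ?G = "mk2 (qreal 1) y (- qcnj y) (qreal 1)"
  have s: "qreal s + qreal t = qreal (s + t)" "t *\<^sub>R qreal s = qreal (t * s)" for s t
    by (simp_all add: quat_eq_iff qreal_def)
  have "qmm (qadj ?G) ?G = (1 + y \<bullet> y) *\<^sub>R qone" "qmm ?G (qadj ?G) = (1 + y \<bullet> y) *\<^sub>R qone"
    by (simp_all add: qmat_eq_iff qmm_nth qadj_nth qone_def qdiag_def qcnj_minus qmul_minus qmul_qcnj s add.commute)
  then show ?thesis
    using one_plus_inner_pos[of y]
    by (simp add: Sp2_def affine_gauge_def qadj_scaleR qmm_scaleR powr_half_square qone_def)
qed

lemma qmm_in_Sp2:
  assumes "A \<in> Sp2" "B \<in> Sp2"
  shows "qmm A B \<in> Sp2"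
proof -
  have "qmm (qadj B) (qmm (qmm (qadj A) A) B) = qone" "qmm A (qmm (qmm B (qadj B)) (qadj A)) = qone"
    using assms by (simp_all add: Sp2_def qmm_one qone_def)
  then show ?thesis
    by (simp add: Sp2_def qadj_qmm qmm_assoc qone_def)
qed

lemma gauge_in_Sp2: "B \<in> Sp2 \<Longrightarrow> stereo_gauge B y \<in> Sp2"
  by (simp add: stereo_gauge_def qmm_in_Sp2 affine_gauge_in_Sp2)

section \<open>Base point, frame and coframe of the stereographic gauges\<close>

lemma spin_act_qmm:
  assumes "A \<in> Sp2"
  shows "spin_act (qmm B A) v = spin_act B (spin_act A v)"
  using herm_spin_act[OF assms, of v]
  by (simp add: spin_act_def Let_def qadj_qmm qmm_assoc)

lemma sphere_point_gauge: "sphere_point (stereo_gauge B y) = spin_act B (sphere_point (affine_gauge y))"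
  and frame_gauge: "frame (stereo_gauge B y) i = spin_act B (frame (affine_gauge y) i)"
  by (simp_all add: sphere_point_def frame_def stereo_gauge_def spin_act_qmm affine_gauge_in_Sp2)

lemma bounded_linear_spin_act: "bounded_linear (spin_act B)"
proof -
  have h: "herm (v + w) = herm v + herm w" "herm (c *\<^sub>R v) = c *\<^sub>R herm v" for v w c
    by (simp_all add: qmat_eq_iff herm_def quat_eq_iff qcnj_def qreal_def)
  have "linear (spin_act B)"
    unfolding linear_iff by (simp add: spin_act_def Let_def h qmm_add qmm_scaleR)
  then show ?thesis by (simp add: linear_conv_bounded_linear)
qed

text \<open>Inverse stereographic projection from the pole (0, -1), applied to \<open>- y\<close>;
  the origin goes to the pole (0, 1).\<close>

lemma sphere_point_affine_gauge:
  "sphere_point (affine_gauge y) = ((- 2 / (1 + y \<bullet> y)) *\<^sub>R y, 2 / (1 + y \<bullet> y) - 1)"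
proof -
  let ?G = "mk2 (qreal 1) y (- qcnj y) (qreal 1)"
  have "qmm (qmm (affine_gauge y) (herm (0, 1))) (qadj (affine_gauge y)) =
      (1 / (1 + y \<bullet> y)) *\<^sub>R qmm (qmm ?G (herm (0, 1))) (qadj ?G)"
    unfolding affine_gauge_def qadj_scaleR qmm_scaleR scaleR_scaleR
    by (simp add: powr_half_square one_plus_inner_pos)
  moreover have "qmm (qmm ?G (herm (0, 1))) (qadj ?G) $ 1 $ 2 = - 2 *\<^sub>R y"
    by (simp add: qmm_nth qadj_nth herm_def qcnj_minus qreal_minus qmul_minus qmul_scaleR) (simp add: scaleR_2)
  moreover have "qmm (qmm ?G (herm (0, 1))) (qadj ?G) $ 1 $ 1 $ 0 = 1 - y \<bullet> y"
    by (simp add: qmm_nth qadj_nth herm_def qreal_minus qmul_minus qmul_scaleR qmul_qcnj) (simp add: qreal_def)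
  ultimately show ?thesis
    using one_plus_inner_pos[of y]
    by (simp add: sphere_point_def spin_act_def Let_def field_simps)
qed

lemma frame_affine_gauge:
  "frame (affine_gauge y) i =
     (qunit i - (2 * y $ i / (1 + y \<bullet> y)) *\<^sub>R y, 2 * y $ i / (1 + y \<bullet> y))"
proof -
  let ?G = "mk2 (qreal 1) y (- qcnj y) (qreal 1)"
  let ?q = "qunit i"
  have yi: "y $ i = ?q \<bullet> y" by (simp add: qunit_def inner_axis')
  have "qmm (qmm (affine_gauge y) (herm (?q, 0))) (qadj (affine_gauge y)) =
      (1 / (1 + y \<bullet> y)) *\<^sub>R qmm (qmm ?G (herm (?q, 0))) (qadj ?G)"
    unfolding affine_gauge_def qadj_scaleR qmm_scaleR scaleR_scaleR
    by (simp add: powr_half_square one_plus_inner_pos)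
  moreover have "qmm (qmm ?G (herm (?q, 0))) (qadj ?G) $ 1 $ 2 = (1 + y \<bullet> y) *\<^sub>R ?q - (2 * (?q \<bullet> y)) *\<^sub>R y"
    by (simp add: qmm_nth qadj_nth herm_def qcnj_minus qmul_minus)
      (simp add: quat_eq_iff qmul_def qcnj_def quat_inner algebra_simps)
  moreover have "qmm (qmm ?G (herm (?q, 0))) (qadj ?G) $ 1 $ 1 $ 0 = 2 * (?q \<bullet> y)"
    by (simp add: qmm_nth qadj_nth herm_def)
      (simp add: qmul_def qcnj_def quat_inner algebra_simps)
  ultimately show ?thesis
    using one_plus_inner_pos[of y]
    by (simp add: frame_def spin_act_def Let_def yi scaleR_diff_right)
qed

lemma has_derivative_sphere_point_affine_gauge:
  "((\<lambda>y. sphere_point (affine_gauge y)) has_derivative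
     (\<lambda>v. ((- 2 / (1 + y \<bullet> y)) *\<^sub>R v + (4 * (y \<bullet> v) / (1 + y \<bullet> y)\<^sup>2) *\<^sub>R y,
            - 4 * (y \<bullet> v) / (1 + y \<bullet> y)\<^sup>2))) (at y)"
  unfolding sphere_point_affine_gauge
  using one_plus_inner_pos[of y]
  by (auto intro!: derivative_eq_intros ext simp: inner_commute power2_eq_square field_simps)

lemma has_derivative_sphere_point_gauge:
  "((\<lambda>y. sphere_point (stereo_gauge B y)) has_derivative
     (\<lambda>v. spin_act B ((- 2 / (1 + y \<bullet> y)) *\<^sub>R v + (4 * (y \<bullet> v) / (1 + y \<bullet> y)\<^sup>2) *\<^sub>R y,
            - 4 * (y \<bullet> v) / (1 + y \<bullet> y)\<^sup>2))) (at y)"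
  unfolding sphere_point_gauge
  by (rule bounded_linear.has_derivative[OF bounded_linear_spin_act
        has_derivative_sphere_point_affine_gauge])

text \<open>Stereographic projection is conformal and the frame is the normalised coordinate frame
  up to sign, so the coframe is a scalar multiple of \<open>dy\<close>. The matrix \<open>B\<close>
  drops out because \<open>spin_act B\<close> is an isometry.\<close>

lemma coframe_gauge:
  assumes "B \<in> Sp2"
  shows "coframe (stereo_gauge B) y i v = - 2 / (1 + y \<bullet> y) * v $ i"
proof -
  have "coframe (stereo_gauge B) y i v = frame (affine_gauge y) i \<bullet>
      ((- 2 / (1 + y \<bullet> y)) *\<^sub>R v + (4 * (y \<bullet> v) / (1 + y \<bullet> y)\<^sup>2) *\<^sub>R y, - 4 * (y \<bullet> v) / (1 + y \<bullet> y)\<^sup>2)"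
    unfolding coframe_def frechet_derivative_at[OF has_derivative_sphere_point_gauge, symmetric]
      frame_gauge
    by (rule spin_act_inner[OF assms])
  also have "\<dots> = - 2 / (1 + y \<bullet> y) * v $ i"
  proof -
    define n where "n = 1 + y \<bullet> y"
    have n: "n > 0" by (simp add: n_def one_plus_inner_pos)
    have e: "qunit i \<bullet> w = w $ i" for w by (simp add: qunit_def inner_axis')
    have yy: "y \<bullet> y = n - 1" by (simp add: n_def)
    show ?thesis
      unfolding frame_affine_gauge inner_prod_def fst_conv snd_conv inner_diff_left inner_add_right
        inner_scaleR_left inner_scaleR_right e n_def[symmetric] yy inner_real_def
      using n by (simp add: field_simps power2_eq_square)
  qed
  finally show ?thesis .
qed

lemma inj_sphere_point_affine_gauge: "inj (\<lambda>y. sphere_point (affine_gauge y))"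
proof (rule injI)
  fix y z
  assume "sphere_point (affine_gauge y) = sphere_point (affine_gauge z)"
  then have *: "(- 2 / (1 + y \<bullet> y)) *\<^sub>R y = (- 2 / (1 + z \<bullet> z)) *\<^sub>R z"
    and e: "2 / (1 + y \<bullet> y) - 1 = 2 / (1 + z \<bullet> z) - 1"
    by (simp_all only: sphere_point_affine_gauge prod.inject)
  from e have "y \<bullet> y = z \<bullet> z"
    using one_plus_inner_pos[of y] one_plus_inner_pos[of z] by (simp add: field_simps)
  with * have "(- 2 / (1 + z \<bullet> z)) *\<^sub>R y = (- 2 / (1 + z \<bullet> z)) *\<^sub>R z"
    by (simp only:)
  then have "- 2 / (1 + z \<bullet> z) = 0 \<or> y = z"
    by (auto simp only: scaleR_cancel_left)
  moreover have "- 2 / (1 + z \<bullet> z) \<noteq> 0"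
    using one_plus_inner_pos(2)[of z] by (metis divide_eq_0_iff neg_equal_0_iff_equal zero_neq_numeral)
  ultimately show "y = z" by blast
qed

lemma inj_spin_act:
  assumes "B \<in> Sp2"
  shows "inj (spin_act B)"
proof (rule injI)
  fix v w
  assume "spin_act B v = spin_act B w"
  then have "spin_act B (v - w) = 0"
    using bounded_linear.linear[OF bounded_linear_spin_act] by (simp add: linear_diff)
  then have "(v - w) \<bullet> (v - w) = 0"
    using spin_act_inner[OF assms, of "v - w" "v - w"] by simp
  then show "v = w" by simp
qed

lemma bounded_linear_qmm: "bounded_linear (qmm B)"
proof -
  have "linear (qmm B)" by (simp add: linear_iff qmm_add qmm_scaleR)
  then show ?thesis by (simp add: linear_conv_bounded_linear)
qed

lemma smooth_on_one_plus_inner: "open S \<Longrightarrow> smooth_on S f \<Longrightarrow> smooth_on S (\<lambda>x. 1 + f x \<bullet> f x)"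
  by (intro smooth_on_add smooth_on_const smooth_on_inner)

lemma smooth_on_gauge: "open U \<Longrightarrow> smooth_on U (stereo_gauge B)"
proof -
  assume U: "open U"
  let ?L = "\<lambda>y. mk2 0 y (- qcnj y) 0"
  have "linear ?L"
    by (simp add: linear_iff qmat_eq_iff qcnj_add qcnj_scaleR)
  then have L: "bounded_linear ?L" by (simp add: linear_conv_bounded_linear)
  have "smooth_on U (\<lambda>y. qmm B ((1 + y \<bullet> y) powr (-1/2) *\<^sub>R (qone + ?L y)))"
    by (intro smooth_on_compose_linear[OF _ bounded_linear_qmm] smooth_on_scaleR smooth_on_powr
        smooth_on_add smooth_on_const smooth_on_linear[OF _ L] smooth_on_one_plus_inner smooth_on_id U
        one_plus_inner_pos)
  moreover have "qone + ?L y = mk2 (qreal 1) y (- qcnj y) (qreal 1)" for y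
    by (simp add: qmat_eq_iff qone_def qdiag_def)
  ultimately show ?thesis
    by (simp add: stereo_gauge_def[abs_def] affine_gauge_def)
qed

lemma linear_conn: "linear (conn i y)"
  by (simp add: linear_iff conn_def qmul_add qmul_scaleR add_divide_distrib)

section \<open>The connection forms of the stereographic gauges\<close>

lemma Omega_gauge:
  assumes "B \<in> Sp2"
  shows "Omega (stereo_gauge B) i y u v = 4 / (1 + y \<bullet> y)\<^sup>2 * asd_form (\<lambda>i v. v $ i) i u v"
proof -
  have k: "a / n * s * (a / n * t) - a / n * s' * (a / n * t') - (a / n * p * (a / n * q) - a / n * p' * (a / n * q')) =
      a\<^sup>2 / n\<^sup>2 * (s * t - s' * t' - (p * q - p' * q'))" for a n s t s' t' p q p' q' :: real
    by (simp add: power2_eq_square algebra_simps diff_divide_distrib add_divide_distrib)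
  show ?thesis
    unfolding Omega_def asd_form_def wedge11_def coframe_gauge[OF assms] k by simp
qed

text \<open>\<open>Omega\<close> is a constant form times 4 / (1 + |y|^2)^2, and only this factor is
  differentiated.\<close>

lemma ext_deriv2_Omega_gauge:
  assumes "B \<in> Sp2"
  shows "ext_deriv2 (Omega (stereo_gauge B) i) y u v w =
    - 16 / (1 + y \<bullet> y) ^ 3 * wedge12 (\<lambda>u. y \<bullet> u) (asd_form (\<lambda>i v. v $ i) i) u v w"
proof -
  have d: "frechet_derivative (\<lambda>z. Omega (stereo_gauge B) i z v w) (at y) u =
      - 16 / (1 + y \<bullet> y) ^ 3 * (y \<bullet> u) * asd_form (\<lambda>i v. v $ i) i v w" for u v w
  proof -
    have "((\<lambda>z. Omega (stereo_gauge B) i z v w) has_derivative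
        (\<lambda>u. - 16 / (1 + y \<bullet> y) ^ 3 * (y \<bullet> u) * asd_form (\<lambda>i v. v $ i) i v w)) (at y)"
    proof -
      define n where "n = 1 + y \<bullet> y"
      have n: "n > 0" by (simp add: n_def one_plus_inner_pos)
      let ?c = "asd_form (\<lambda>i v. v $ i) i v w"
      have "((\<lambda>t. 4 / t\<^sup>2 * ?c) has_real_derivative - 8 / n ^ 3 * ?c) (at n)"
        using n by (auto intro!: derivative_eq_intros simp: field_simps power2_eq_square power3_eq_cube)
      moreover have "((\<lambda>z. 1 + z \<bullet> z) has_derivative (\<lambda>u. 2 * (y \<bullet> u))) (at y)"
        by (auto intro!: derivative_eq_intros simp: inner_commute)
      ultimately have "((\<lambda>z. 4 / (1 + z \<bullet> z)\<^sup>2 * ?c) has_derivative (\<lambda>u. - 8 / n ^ 3 * ?c * (2 * (y \<bullet> u)))) (at y)"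
        unfolding has_field_derivative_def n_def by (rule has_derivative_compose[rotated])
      then show ?thesis
        unfolding Omega_gauge[OF assms] n_def[symmetric] by (simp add: mult_ac)
    qed
    then show ?thesis by (metis frechet_derivative_at)
  qed
  show ?thesis
    unfolding ext_deriv2_def d wedge12_def by (simp add: algebra_simps)
qed

lemma connection_forms_gauge:
  assumes "B \<in> Sp2"
  shows "connection_forms U (stereo_gauge B) conn"
proof -
  define om :: "4 \<Rightarrow> quat \<Rightarrow> quat \<Rightarrow> real" where "om i = asd_form (\<lambda>i v. v $ i) i" for i
  have om: "om 1 u v = u $ 0 * v $ 1 - v $ 0 * u $ 1 - (u $ 2 * v $ 3 - v $ 2 * u $ 3)"
     "om 2 u v = u $ 0 * v $ 2 - v $ 0 * u $ 2 - (u $ 3 * v $ 1 - v $ 3 * u $ 1)"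
     "om 3 u v = u $ 0 * v $ 3 - v $ 0 * u $ 3 - (u $ 1 * v $ 2 - v $ 1 * u $ 2)" for u v
    by (simp_all add: om_def asd_form_def wedge11_def cyc_def)
  have w12: "wedge12 (conn j y) (Omega (stereo_gauge B) i y) u v w =
      4 / (1 + y \<bullet> y) ^ 3 * wedge12 (\<lambda>v. (qcnj y \<odot> v) $ j) (om i) u v w" for i j y u v w
  proof -
    have "p / n * (4 / n\<^sup>2 * x) - q / n * (4 / n\<^sup>2 * y) + r / n * (4 / n\<^sup>2 * z) =
        4 / n ^ 3 * (p * x - q * y + r * z)" for n p q r x y z :: real
      by (simp add: power2_eq_square power3_eq_cube algebra_simps add_divide_distrib diff_divide_distrib)
    then show ?thesis
      unfolding wedge12_def conn_def Omega_gauge[OF assms] om_def .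
  qed
  \<comment> \<open>\<open>k\<close> and \<open>c\<close> strip the common factor 8 / (1 + |y|^2)^3
    from the structure equations, which leaves polynomial identities in the coordinates.\<close>
  have k: "a * x = b * (c * y) - b * (c * z) \<longleftrightarrow> a * x = b * c * (y - z)"
    "a * x = - b * (c * y) + b * (c * z) \<longleftrightarrow> a * x = b * c * (z - y)" for a b c x y z :: real
    by (simp_all add: algebra_simps)
  have c: "- 16 / m * x = 2 * (4 / m) * z \<longleftrightarrow> - 2 * x = z" if "m > 0" for m x z :: real
    using that by (simp add: field_simps)
  show ?thesis
    unfolding connection_forms_def
  proof (intro ballI conjI allI linear_conn)
    fix y u v w :: quat
    have m: "(1 + y \<bullet> y) ^ 3 > 0" by (rule zero_less_power[OF one_plus_inner_pos(1)])
    show "ext_deriv2 (Omega (stereo_gauge B) 1) y u v w =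
        2 * wedge12 (conn 3 y) (Omega (stereo_gauge B) 2 y) u v w - 2 * wedge12 (conn 2 y) (Omega (stereo_gauge B) 3 y) u v w"
      unfolding ext_deriv2_Omega_gauge[OF assms] w12 k c[OF m] om_def[symmetric]
      by (simp add: wedge12_def om qmul_def qcnj_def quat_inner algebra_simps)
    show "ext_deriv2 (Omega (stereo_gauge B) 2) y u v w =
        - 2 * wedge12 (conn 3 y) (Omega (stereo_gauge B) 1 y) u v w + 2 * wedge12 (conn 1 y) (Omega (stereo_gauge B) 3 y) u v w"
      unfolding ext_deriv2_Omega_gauge[OF assms] w12 k c[OF m] om_def[symmetric]
      by (simp add: wedge12_def om qmul_def qcnj_def quat_inner algebra_simps)
    show "ext_deriv2 (Omega (stereo_gauge B) 3) y u v w =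
        2 * wedge12 (conn 2 y) (Omega (stereo_gauge B) 1 y) u v w - 2 * wedge12 (conn 1 y) (Omega (stereo_gauge B) 2 y) u v w"
      unfolding ext_deriv2_Omega_gauge[OF assms] w12 k c[OF m] om_def[symmetric]
      by (simp add: wedge12_def om qmul_def qcnj_def quat_inner algebra_simps)
  qed
qed

lemma inj_derivative_sphere_point_gauge:
  assumes "B \<in> Sp2"
  shows "inj (frechet_derivative (\<lambda>z. sphere_point (stereo_gauge B z)) (at y))"
proof (rule injI)
  fix u v
  assume *: "frechet_derivative (\<lambda>z. sphere_point (stereo_gauge B z)) (at y) u =
    frechet_derivative (\<lambda>z. sphere_point (stereo_gauge B z)) (at y) v"
  have "coframe (stereo_gauge B) y i u = coframe (stereo_gauge B) y i v" for i
    by (simp add: coframe_def *)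
  then have "u $ i = v $ i" for i
    using one_plus_inner_pos[of y] by (simp add: coframe_gauge[OF assms])
  then show "u = v" by (simp add: vec_eq_iff)
qed

lemma spin_gauge_gauge:
  assumes "B \<in> Sp2"
  shows "spin_gauge UNIV (stereo_gauge B) conn"
proof -
  have "inj (\<lambda>y. sphere_point (stereo_gauge B y))"
    unfolding sphere_point_gauge
    using inj_compose[OF inj_spin_act[OF assms] inj_sphere_point_affine_gauge]
    by (simp only: comp_def)
  then show ?thesis
    unfolding spin_gauge_def
    using connection_forms_gauge[OF assms] inj_derivative_sphere_point_gauge[OF assms]
      gauge_in_Sp2[OF assms] smooth_on_gauge
    by auto
qed

section \<open>Homogeneous coordinates\<close>

definition col_coord :: "qmat \<times> quat \<Rightarrow> quat \<times> quat" where
  "col_coord z = (fst z $ 1 $ 2 \<odot> qcnj (snd z), fst z $ 2 $ 2 \<odot> qcnj (snd z))"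

text \<open>The choice of representative is harmless: by \<open>col_coord_in_assoc\<close> the unit
  quaternion \<open>r\<close> of the right action cancels against its conjugate.\<close>

definition hom_coord :: "spinor \<Rightarrow> quat \<times> quat" where
  "hom_coord p = col_coord (SOME z. z \<in> p)"

lemma qreal_1_in_Sp1 [simp]: "qreal 1 \<in> Sp1"
  by (simp add: Sp1_def norm_eq_1 quat_inner qreal_def)

lemma qcnj_in_Sp1: "qcnj p \<in> Sp1 \<longleftrightarrow> p \<in> Sp1"
  by (simp add: Sp1_def)

lemma qmul_in_Sp1: "p \<in> Sp1 \<Longrightarrow> q \<in> Sp1 \<Longrightarrow> p \<odot> q \<in> Sp1"
  by (simp add: Sp1_def norm_qmul)

lemma col_coord_in_assoc:
  assumes "z \<in> assoc A a"
  shows "col_coord z = col_coord (A, a)"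
proof -
  obtain l r where z: "z = (spin_rmul A (l, r), mu_minus (qcnj l, qcnj r) a)" and "r \<in> Sp1"
    using assms by (auto simp: assoc_def)
  then have "x \<odot> r \<odot> qcnj (a \<odot> r) = x \<odot> qcnj a" for x
    by (simp add: qcnj_qmul qmul_assoc) (simp add: Sp1_mult_qcnj flip: qmul_assoc)
  then show ?thesis
    by (simp add: z col_coord_def spin_rmul_def qmm_nth qdiag_def mu_minus_def)
qed

lemma mem_assoc: "(A, a) \<in> assoc A a"
proof -
  have "(A, a) = (spin_rmul A (qreal 1, qreal 1), mu_minus (qcnj (qreal 1), qcnj (qreal 1)) a)"
    by (simp add: spin_rmul_def mu_minus_def qmm_one)
  then show ?thesis
    unfolding assoc_def using qreal_1_in_Sp1 by blast
qed

lemma hom_coord_assoc: "hom_coord (assoc A a) = (A$1$2 \<odot> qcnj a, A$2$2 \<odot> qcnj a)"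
proof -
  have "(SOME z. z \<in> assoc A a) \<in> assoc A a"
    using mem_assoc by (rule someI)
  from col_coord_in_assoc[OF this] show ?thesis
    by (simp add: hom_coord_def col_coord_def)
qed

lemma Sp2_second_column:
  assumes "A \<in> Sp2"
  shows "A$1$2 \<bullet> A$1$2 + A$2$2 \<bullet> A$2$2 = 1"
proof -
  have "qmm (qadj A) A $ 2 $ 2 $ 0 = 1"
    using assms by (simp add: Sp2_def qdiag_def qreal_def)
  then show ?thesis
    unfolding qmm_nth qadj_nth qmul_qcnj by (simp add: qreal_def)
qed

text \<open>The second column is a unit vector and quaternion norms are multiplicative. Consequently
  only the zero section has vanishing homogeneous coordinates.\<close>

lemma norm_col_coord:
  assumes "A \<in> Sp2"
  shows "norm (col_coord (A, a)) = norm a"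
proof -
  have "(norm (col_coord (A, a)))\<^sup>2 = (A$1$2 \<bullet> A$1$2 + A$2$2 \<bullet> A$2$2) * (norm a)\<^sup>2"
    by (simp add: col_coord_def norm_Pair norm_qmul power_mult_distrib dot_square_norm distrib_right)
  then show ?thesis
    by (simp add: Sp2_second_column[OF assms])
qed

lemma spin_rmul_spin_rmul:
  "spin_rmul (spin_rmul A (l, r)) (l', r') = spin_rmul A (l \<odot> l', r \<odot> r')"
proof -
  have "qmm (qdiag l r) (qdiag l' r') = qdiag (l \<odot> l') (r \<odot> r')"
    by (simp add: qmat_eq_iff qmm_nth qdiag_def)
  then show ?thesis by (simp add: spin_rmul_def qmm_assoc)
qed

lemma assoc_spin_rmul_subset:
  assumes "l \<in> Sp1" "r \<in> Sp1"
  shows "assoc (spin_rmul A (l, r)) (a \<odot> r) \<subseteq> assoc A a"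
proof
  fix z
  assume "z \<in> assoc (spin_rmul A (l, r)) (a \<odot> r)"
  then obtain l' r' where "l' \<in> Sp1" "r' \<in> Sp1"
    "z = (spin_rmul A (l \<odot> l', r \<odot> r'), a \<odot> (r \<odot> r'))"
    by (auto simp: assoc_def spin_rmul_spin_rmul mu_minus_def qmul_assoc)
  with assms have "z = (spin_rmul A (l \<odot> l', r \<odot> r'), mu_minus (qcnj (l \<odot> l'), qcnj (r \<odot> r')) a)"
    and "l \<odot> l' \<in> Sp1" "r \<odot> r' \<in> Sp1"
    by (simp_all add: mu_minus_def qmul_in_Sp1)
  then show "z \<in> assoc A a"
    unfolding assoc_def by blast
qed

lemma assoc_spin_rmul:
  assumes "l \<in> Sp1" "r \<in> Sp1"
  shows "assoc (spin_rmul A (l, r)) (a \<odot> r) = assoc A a"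
proof
  have "assoc (spin_rmul (spin_rmul A (l, r)) (qcnj l, qcnj r)) ((a \<odot> r) \<odot> qcnj r)
      \<subseteq> assoc (spin_rmul A (l, r)) (a \<odot> r)"
    using assms by (intro assoc_spin_rmul_subset) (simp_all add: qcnj_in_Sp1)
  moreover have "spin_rmul A (qreal 1, qreal 1) = A"
    by (simp add: spin_rmul_def qmm_one)
  ultimately show "assoc A a \<subseteq> assoc (spin_rmul A (l, r)) (a \<odot> r)"
    using assms by (simp add: spin_rmul_spin_rmul Sp1_mult_qcnj qmul_assoc)
qed (rule assoc_spin_rmul_subset[OF assms])

text \<open>The quaternionic form of the fact that a unitary triangular matrix is diagonal.\<close>

lemma Sp2_lower_triangular:
  assumes "B \<in> Sp2" "B$1$2 = 0"
  shows "B = qdiag (B$1$1) (B$2$2)" "B$1$1 \<in> Sp1"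
proof -
  have e: "qmm B (qadj B) $ 1 $ 1 = qreal 1" "qmm B (qadj B) $ 1 $ 2 = 0"
    using assms(1) by (simp_all add: Sp2_def qdiag_def)
  then have "B$1$1 \<bullet> B$1$1 = 1" "B$1$1 \<odot> qcnj (B$2$1) = 0"
    by (simp_all add: qmm_nth qadj_nth assms(2) qmul_qcnj quat_eq_iff qreal_def)
  then show "B$1$1 \<in> Sp1" and "B = qdiag (B$1$1) (B$2$2)"
    using assms(2) by (auto simp: Sp1_def norm_eq_1 qmat_eq_iff qdiag_def)
qed

text \<open>Equal coordinates force |a| = |a'|, so the second columns differ by the unit quaternion
  \<open>r = a\<^sup>-\<^sup>1 a'\<close>. Then \<open>qmm (qadj A) A'\<close> has second column (0,
  r); being triangular and in Sp(2) it is diagonal, hence an element of Spin(4) that carries one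
  representative to the other.\<close>

lemma assoc_eq_if_hom_coord_eq:
  assumes A: "A \<in> Sp2" "A' \<in> Sp2" and a: "a \<noteq> 0"
    and eq: "hom_coord (assoc A a) = hom_coord (assoc A' a')"
  shows "assoc A a = assoc A' a'"
proof -
  have n: "norm a = norm a'"
    using eq norm_col_coord[OF A(1), of a] norm_col_coord[OF A(2), of a']
    by (simp add: hom_coord_assoc col_coord_def)
  then have na: "a' \<bullet> a' = a \<bullet> a" "a \<bullet> a \<noteq> 0"
    using a by (simp add: dot_square_norm, simp)
  define r where "r = (1 / (a \<bullet> a)) *\<^sub>R (qcnj a \<odot> a')"
  have r: "r \<in> Sp1"
    using a unfolding Sp1_def r_def mem_Collect_eq norm_scaleR norm_qmul norm_qcnj n[symmetric]
    by (simp add: dot_square_norm power2_eq_square)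
  have a': "a' = a \<odot> r"
    using na by (simp add: r_def qmul_scaleR qmul_qcnj flip: qmul_assoc)
  have col: "A' $ i $ 2 = A $ i $ 2 \<odot> r" if "A' $ i $ 2 \<odot> qcnj a' = A $ i $ 2 \<odot> qcnj a" for i
  proof -
    have "(a' \<bullet> a') *\<^sub>R (A' $ i $ 2) = (A' $ i $ 2 \<odot> qcnj a') \<odot> a'"
      by (simp add: qmul_right_inverse')
    also have "\<dots> = (a \<bullet> a) *\<^sub>R (A $ i $ 2 \<odot> r)"
      using na by (simp add: that r_def qmul_scaleR qmul_assoc)
    finally show ?thesis using na by simp
  qed
  have c: "A' $ 1 $ 2 = A $ 1 $ 2 \<odot> r" "A' $ 2 $ 2 = A $ 2 $ 2 \<odot> r"
    using eq by (auto simp: hom_coord_assoc intro!: col)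
  define B where "B = qmm (qadj A) A'"
  have "qadj A \<in> Sp2" using A(1) by (simp add: Sp2_def qadj_qadj)
  then have B: "B \<in> Sp2" unfolding B_def using A(2) by (rule qmm_in_Sp2)
  have AA: "qmm (qadj A) A = qone" "qmm A (qadj A) = qone"
    using A(1) by (simp_all add: Sp2_def qone_def)
  have "B $ i $ 2 = qmm (qadj A) A $ i $ 2 \<odot> r" for i
    by (simp add: B_def qmm_nth c qmul_add qmul_assoc)
  then have B2: "B $ 1 $ 2 = 0" "B $ 2 $ 2 = r"
    by (simp_all add: AA qone_def qdiag_def)
  have "A' = qmm A B"
    by (simp add: B_def AA qone_def qmm_one flip: qmm_assoc)
  also have "\<dots> = spin_rmul A (B $ 1 $ 1, r)"
    using Sp2_lower_triangular(1)[OF B B2(1)] B2(2) by (simp add: spin_rmul_def)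
  finally have "A' = spin_rmul A (B $ 1 $ 1, r)" .
  then show ?thesis
    using assoc_spin_rmul[OF Sp2_lower_triangular(2)[OF B B2(1)] r] by (simp add: a')
qed

lemma hom_coord_assoc_eq_0:
  assumes "A \<in> Sp2"
  shows "hom_coord (assoc A a) = 0 \<longleftrightarrow> a = 0"
proof -
  have "hom_coord (assoc A a) = col_coord (A, a)"
    by (simp add: hom_coord_assoc col_coord_def)
  then show ?thesis
    using norm_col_coord[OF assms, of a] by (metis norm_eq_zero)
qed

lemma assoc_in_M0: "A \<in> Sp2 \<Longrightarrow> assoc A a \<in> M0 \<longleftrightarrow> a \<noteq> 0"
  unfolding M0_def by auto (metis hom_coord_assoc_eq_0)

lemma inj_on_hom_coord: "inj_on hom_coord M0"
proof (rule inj_onI)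
  fix p p'
  assume "p \<in> M0" "p' \<in> M0" and *: "hom_coord p = hom_coord p'"
  then obtain A a A' a' where "p = assoc A a" "p' = assoc A' a'" "A \<in> Sp2" "A' \<in> Sp2" "a \<noteq> 0"
    by (auto simp: M0_def)
  with * assoc_eq_if_hom_coord_eq[of A A' a a'] show "p = p'" by simp
qed

lemma hom_coord_M0_nonzero: "p \<in> M0 \<Longrightarrow> hom_coord p \<noteq> 0"
  by (auto simp: M0_def hom_coord_assoc_eq_0)

definition chart_coord :: "quat \<times> quat \<Rightarrow> quat \<times> quat" where
  "chart_coord Q = (let y = (1 / (snd Q \<bullet> snd Q)) *\<^sub>R (fst Q \<odot> qcnj (snd Q))
     in (y, sqrt (1 + y \<bullet> y) *\<^sub>R qcnj (snd Q)))"

definition qswap :: qmat where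
  "qswap = mk2 0 (qreal 1) (qreal 1) 0"

lemma qone_in_Sp2: "qone \<in> Sp2" and qswap_in_Sp2: "qswap \<in> Sp2"
  and qdiag_in_Sp2: "v \<in> Sp1 \<Longrightarrow> qdiag (qreal 1) v \<in> Sp2"
  by (simp_all add: Sp2_def qone_def qswap_def qdiag_def qmat_eq_iff qmm_nth qadj_nth Sp1_mult_qcnj)

lemma hom_coord_triv_gauge:
  "hom_coord (triv (stereo_gauge B) (y, a)) = (1 + y \<bullet> y) powr (-1/2) *\<^sub>R
     ((B$1$1 \<odot> y + B$1$2) \<odot> qcnj a, (B$2$1 \<odot> y + B$2$2) \<odot> qcnj a)"
  by (simp add: triv_def hom_coord_assoc stereo_gauge_def affine_gauge_def qmm_nth qmul_scaleR qmul_add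
      scaleR_add_right)

lemma hom_coord_triv_gauge_simps:
  "hom_coord (triv (stereo_gauge qone) (y, a)) = (1 + y \<bullet> y) powr (-1/2) *\<^sub>R (y \<odot> qcnj a, qcnj a)"
  "hom_coord (triv (stereo_gauge qswap) (y, a)) = (1 + y \<bullet> y) powr (-1/2) *\<^sub>R (qcnj a, y \<odot> qcnj a)"
  "hom_coord (triv (stereo_gauge (qdiag (qreal 1) v)) (y, a)) =
     (1 + y \<bullet> y) powr (-1/2) *\<^sub>R (y \<odot> qcnj a, v \<odot> qcnj a)"
  by (simp_all add: hom_coord_triv_gauge qone_def qswap_def qdiag_def)

lemma powr_half_times_sqrt: "x > 0 \<Longrightarrow> x powr (-1/2) * sqrt x = 1"
  by (simp add: powr_minus_divide powr_half_sqrt)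

lemma chart_coord_inverse:
  assumes "snd Q \<noteq> 0"
  shows "hom_coord (triv (stereo_gauge qone) (chart_coord Q)) = Q"
    and "hom_coord (triv (stereo_gauge qswap) (chart_coord Q)) = prod.swap Q"
proof -
  define y where "y = (1 / (snd Q \<bullet> snd Q)) *\<^sub>R (fst Q \<odot> qcnj (snd Q))"
  have "y \<odot> snd Q = fst Q"
    using assms by (simp add: y_def qmul_scaleR qmul_right_inverse')
  then show "hom_coord (triv (stereo_gauge qone) (chart_coord Q)) = Q"
     "hom_coord (triv (stereo_gauge qswap) (chart_coord Q)) = prod.swap Q"
    using powr_half_times_sqrt[OF one_plus_inner_pos(1)[of y]]
    by (simp_all add: chart_coord_def Let_def hom_coord_triv_gauge_simps qcnj_scaleR qmul_scaleR
        prod_eq_iff flip: y_def)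
qed

lemma continuous_on_chart_coord: "continuous_on {Q. snd Q \<noteq> 0} chart_coord"
  unfolding chart_coord_def Let_def
  by (intro continuous_intros bounded_bilinear.continuous_on[OF bounded_bilinear_qmul]
      bounded_linear.continuous_on[OF bounded_linear_qcnj]) auto

lemma triv_gauge_in_M0: "B \<in> Sp2 \<Longrightarrow> triv (stereo_gauge B) z \<in> M0 \<longleftrightarrow> snd z \<noteq> 0"
  by (simp add: triv_def assoc_in_M0 gauge_in_Sp2)

lemma snd_chart_coord: "snd (chart_coord Q) = 0 \<longleftrightarrow> snd Q = 0"
proof -
  define y where "y = (1 / (snd Q \<bullet> snd Q)) *\<^sub>R (fst Q \<odot> qcnj (snd Q))"
  show ?thesis
    using one_plus_inner_pos(2)[of y] by (simp only: chart_coord_def Let_def flip: y_def) simp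
qed

lemma hom_coord_image_M0: "hom_coord ` M0 = - {0}"
proof (intro equalityI subsetI)
  fix Q :: "quat \<times> quat"
  assume Q: "Q \<in> - {0}"
  show "Q \<in> hom_coord ` M0"
  proof (cases "snd Q = 0")
    case False
    then show ?thesis
      using chart_coord_inverse(1)[OF False]
      by (intro image_eqI[of _ _ "triv (stereo_gauge qone) (chart_coord Q)"])
        (simp_all add: triv_gauge_in_M0 qone_in_Sp2 snd_chart_coord)
  next
    case True
    then have *: "snd (prod.swap Q) \<noteq> 0" using Q by (cases Q) (auto simp: zero_prod_def)
    then show ?thesis
      using chart_coord_inverse(2)[OF *]
      by (intro image_eqI[of _ _ "triv (stereo_gauge qswap) (chart_coord (prod.swap Q))"])
        (simp_all add: triv_gauge_in_M0 qswap_in_Sp2 snd_chart_coord)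
  qed
qed (use hom_coord_M0_nonzero in auto)

section \<open>The quotient topology of \<open>M0\<close>\<close>

lemma M0_subset_M: "M0 \<subseteq> M"
  by (auto simp: M0_def M_def)

lemma continuous_col_coord: "continuous_on S col_coord"
  unfolding col_coord_def
  by (intro continuous_intros bounded_bilinear.continuous_on[OF bounded_bilinear_qmul]
      bounded_linear.continuous_on[OF bounded_linear_qcnj])

lemma hom_coord_assoc': "hom_coord (assoc (fst z) (snd z)) = col_coord z"
  by (simp add: hom_coord_assoc col_coord_def)

lemma openin_M_top_preimage:
  assumes "open O'" "0 \<notin> O'"
  shows "openin M_top {p \<in> M0. hom_coord p \<in> O'}"
proof -
  have "{z \<in> P_Spin \<times> UNIV. assoc (fst z) (snd z) \<in> {p \<in> M0. hom_coord p \<in> O'}} =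
      (P_Spin \<times> UNIV) \<inter> col_coord -` O'"
    using assms(2) by (auto simp: hom_coord_assoc' assoc_in_M0) (metis hom_coord_assoc' hom_coord_assoc_eq_0 fst_conv snd_conv)
  moreover have "openin (top_of_set (P_Spin \<times> UNIV)) ((P_Spin \<times> UNIV) \<inter> col_coord -` O')"
    using assms(1) by (intro continuous_openin_preimage_gen continuous_col_coord)
  ultimately show ?thesis
    using M0_subset_M by (auto simp: openin_M_top)
qed

lemma openin_nonzero: "openin (top_of_set (- {0 :: quat \<times> quat})) S \<longleftrightarrow> open S \<and> S \<subseteq> - {0}"
  by (rule openin_open_eq) (simp add: open_Compl)

lemma openin_M_top_M0: "openin M_top M0"
proof -
  have "{p \<in> M0. hom_coord p \<in> - {0}} = M0"
    using hom_coord_M0_nonzero by auto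
  then show ?thesis using openin_M_top_preimage[of "- {0}"] by (simp add: open_Compl)
qed

lemma openin_M0_top: "openin M0_top W \<longleftrightarrow> openin M_top W \<and> W \<subseteq> M0"
  unfolding M0_top_def by (rule openin_open_subtopology[OF openin_M_top_M0])

lemma topspace_M0_top: "topspace M0_top = M0"
  unfolding M0_top_def using openin_subset[OF openin_M_top_M0] by auto

text \<open>A continuous local section of the quotient map pulls the open preimage of
  \<open>W\<close> in \<open>P_Spin \<times> UNIV\<close> back to an open subset of
  \<open>D\<close>; by injectivity of \<open>hom_coord\<close> this subset is the image of
  \<open>W\<close> within \<open>D\<close>.\<close>

lemma open_hom_coord_image_section:
  assumes W: "openin M0_top W" and D: "open D" "continuous_on D c" and B: "B \<in> Sp2"
    and c: "\<And>Q. Q \<in> D \<Longrightarrow> snd (c Q) \<noteq> 0 \<and> hom_coord (triv (stereo_gauge B) (c Q)) = Q"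
  shows "open (D \<inter> hom_coord ` W)"
proof -
  define s where "s Q = (stereo_gauge B (fst (c Q)), snd (c Q))" for Q
  have s: "assoc (fst (s Q)) (snd (s Q)) = triv (stereo_gauge B) (c Q)" for Q
    by (simp add: s_def triv_def)
  have sM: "triv (stereo_gauge B) (c Q) \<in> M0" if "Q \<in> D" for Q
    using c[OF that] by (simp add: triv_gauge_in_M0 B)
  have WM: "W \<subseteq> M0" using W by (simp add: openin_M0_top)
  let ?T = "{z \<in> P_Spin \<times> UNIV. assoc (fst z) (snd z) \<in> W}"
  have "continuous_on UNIV (stereo_gauge B)"
    by (intro smooth_on_imp_continuous_on smooth_on_gauge open_UNIV)
  then have "continuous_on D s"
    unfolding s_def
    by (intro continuous_intros continuous_on_compose2[OF _ continuous_on_fst[OF D(2)]]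
        continuous_on_snd[OF D(2)]) auto
  moreover have "s \<in> D \<rightarrow> P_Spin \<times> UNIV"
    by (auto simp: s_def gauge_in_Sp2 B)
  moreover have "openin (top_of_set (P_Spin \<times> UNIV)) ?T"
    using W by (simp add: openin_M0_top openin_M_top)
  ultimately have "openin (top_of_set D) (D \<inter> s -` ?T)"
    by (rule continuous_openin_preimage)
  then have "open (D \<inter> s -` ?T)"
    using D(1) by (simp add: openin_open_eq)
  moreover have "D \<inter> s -` ?T = D \<inter> hom_coord ` W"
  proof -
    have "Q \<in> s -` ?T \<longleftrightarrow> Q \<in> hom_coord ` W" if "Q \<in> D" for Q
    proof -
      have "Q \<in> s -` ?T \<longleftrightarrow> triv (stereo_gauge B) (c Q) \<in> W"
        by (simp add: s) (simp add: s_def gauge_in_Sp2 B)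
      also have "\<dots> \<longleftrightarrow> Q \<in> hom_coord ` W"
        using c[OF that] inj_on_image_mem_iff[OF inj_on_hom_coord sM[OF that] WM] by simp
      finally show ?thesis .
    qed
    then have "Q \<in> D \<and> Q \<in> s -` ?T \<longleftrightarrow> Q \<in> D \<and> Q \<in> hom_coord ` W" for Q
      by (rule conj_cong[OF refl])
    then show ?thesis unfolding set_eq_iff Int_iff by (rule allI)
  qed
  ultimately show ?thesis by simp
qed

text \<open>Continuity is that of \<open>col_coord\<close>. Openness comes from two sections, in the
  gauges of \<open>qone\<close> and \<open>qswap\<close>, whose domains q2 \<noteq> 0 and q1
  \<noteq> 0 cover everything but the origin.\<close>

lemma homeomorphic_map_hom_coord: "homeomorphic_map M0_top (top_of_set (- {0})) hom_coord"
proof (rule bijective_open_imp_homeomorphic_map)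
  show "continuous_map M0_top (top_of_set (- {0})) hom_coord"
    unfolding continuous_map_def
  proof (intro conjI allI impI)
    show "hom_coord \<in> topspace M0_top \<rightarrow> topspace (top_of_set (- {0}))"
      using hom_coord_M0_nonzero by (auto simp: topspace_M0_top)
    fix V :: "(quat \<times> quat) set"
    assume "openin (top_of_set (- {0})) V"
    then have "open V" "0 \<notin> V"
      by (auto simp: openin_nonzero)
    then show "openin M0_top {x \<in> topspace M0_top. hom_coord x \<in> V}"
      using openin_M_top_preimage[of V] by (auto simp: openin_M0_top topspace_M0_top)
  qed
  show "open_map M0_top (top_of_set (- {0})) hom_coord"
    unfolding open_map_def
  proof (intro allI impI)
    fix W
    assume W: "openin M0_top W"
    have o: "open {Q::quat \<times> quat. snd Q \<noteq> 0}" "open {Q::quat \<times> quat. fst Q \<noteq> 0}"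
      by (auto intro!: open_Collect_neq continuous_intros)
    have "open ({Q. snd Q \<noteq> 0} \<inter> hom_coord ` W)"
      using chart_coord_inverse(1)
      by (intro open_hom_coord_image_section[OF W o(1) continuous_on_chart_coord qone_in_Sp2])
        (simp add: snd_chart_coord)
    moreover have "open ({Q. fst Q \<noteq> 0} \<inter> hom_coord ` W)"
    proof (rule open_hom_coord_image_section[OF W o(2) _ qswap_in_Sp2, where c = "\<lambda>Q. chart_coord (prod.swap Q)"])
      show "continuous_on {Q::quat \<times> quat. fst Q \<noteq> 0} (\<lambda>Q. chart_coord (prod.swap Q))"
        by (rule continuous_on_compose2[OF continuous_on_chart_coord])
          (auto intro!: continuous_intros simp: prod.swap_def)
    qed (use chart_coord_inverse(2) in \<open>auto simp: snd_chart_coord\<close>)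
    ultimately have "open (({Q. snd Q \<noteq> 0} \<inter> hom_coord ` W) \<union> ({Q. fst Q \<noteq> 0} \<inter> hom_coord ` W))"
      by (rule open_Un)
    moreover have sub: "hom_coord ` W \<subseteq> - {0}"
      using W hom_coord_M0_nonzero by (auto simp: openin_M0_top)
    then have "({Q. snd Q \<noteq> 0} \<inter> hom_coord ` W) \<union> ({Q. fst Q \<noteq> 0} \<inter> hom_coord ` W) = hom_coord ` W"
      by (auto simp: zero_prod_def prod_eq_iff)
    ultimately show "openin (top_of_set (- {0})) (hom_coord ` W)"
      using sub by (simp add: openin_nonzero)
  qed
qed (simp_all add: topspace_M0_top hom_coord_image_M0 inj_on_hom_coord)

lemma openin_M0_top_iff:
  "openin M0_top W \<longleftrightarrow> W \<subseteq> M0 \<and> open (hom_coord ` W)"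
proof -
  have "openin M0_top W \<longleftrightarrow> W \<subseteq> M0 \<and> openin (top_of_set (- {0})) (hom_coord ` W)"
    using homeomorphic_map_openness_eq[OF homeomorphic_map_hom_coord, of W] by (simp add: topspace_M0_top)
  moreover have "W \<subseteq> M0 \<Longrightarrow> hom_coord ` W \<subseteq> - {0}"
    using hom_coord_M0_nonzero by auto
  ultimately show ?thesis by (auto simp: openin_nonzero)
qed

lemma hom_coord_act_M:
  assumes "P = assoc A a"
  shows "hom_coord (act_M p P) = (p \<odot> fst (hom_coord P), snd (hom_coord P))"
    and "act_M p P = assoc (act_Spin p A) a"
proof -
  have "(\<lambda>(A, a). (act_Spin p A, a)) (spin_rmul A (l, r), b) = (spin_rmul (act_Spin p A) (l, r), b)" for l r b
    by (simp add: spin_rmul_def act_Spin_def qmm_assoc)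
  then show *: "act_M p P = assoc (act_Spin p A) a"
    unfolding assms assoc_def act_M_def by (auto simp: image_iff) (metis+)
  show "hom_coord (act_M p P) = (p \<odot> fst (hom_coord P), snd (hom_coord P))"
    unfolding * by (simp add: assms hom_coord_assoc act_Spin_def qmm_nth qdiag_def qmul_assoc)
qed

section \<open>Calibration of radial parametrisations\<close>

lemma axis4_nth: "axis i (1::real) $ j = (if i = j then 1 else 0)"
  by (simp add: axis_def)

text \<open>Moves the tangent map of a parametrisation into the coframe, so that forms are evaluated
  on coordinate axes only.\<close>

lemma vol_form_comp: "vol_form \<theta> (L u) (L v) (L w) (L x) = vol_form (\<lambda>i s. \<theta> i (L s)) u v w x"
  by (simp add: vol_form_def wedge22_def wedge11_def)

lemma wedge22_asd_form_comp:
  "wedge22 (asd_form \<theta> i) (asd_form \<eta> j) (L u) (L v) (L w) (L x) =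
     wedge22 (asd_form (\<lambda>i s. \<theta> i (L s)) i) (asd_form (\<lambda>i s. \<eta> i (L s)) j) u v w x"
  by (simp add: wedge22_def asd_form_def wedge11_def)

context
  fixes z :: quat and h1 \<kappa> c f f1 :: real
begin

text \<open>The vertical forms pulled back along z \<mapsto> (f z, h) with real \<open>h\<close>:
  the real component is \<open>dh\<close>, the imaginary ones are multiples of the imaginary part of
  conj(z) dz.\<close>

definition radial_vert :: "4 \<Rightarrow> quat \<Rightarrow> real" where
  "radial_vert i w = (if i = 0 then h1 * (z \<bullet> w) else \<kappa> * (qcnj z \<odot> w) $ i)"

text \<open>The conformal coframe \<open>c dy\<close> pulled back along
  \<open>y = f z\<close>.\<close>

definition radial_base :: "4 \<Rightarrow> quat \<Rightarrow> real" where
  "radial_base i w = c * (f * w $ i + f1 * (z \<bullet> w) * z $ i)"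

lemma vol_form_radial_vert:
  "vol_form radial_vert (axis 0 1) (axis 1 1) (axis 2 1) (axis 3 1) = h1 * \<kappa> ^ 3 * (z \<bullet> z)\<^sup>2"
  unfolding vol_form_def wedge22_def wedge11_def radial_vert_def
  by (simp add: qmul_def qcnj_def quat_inner axis4_nth power2_eq_square power3_eq_cube algebra_simps)

lemma vol_form_radial_base:
  "vol_form radial_base (axis 0 1) (axis 1 1) (axis 2 1) (axis 3 1) = c ^ 4 * f ^ 3 * (f + f1 * (z \<bullet> z))"
  unfolding vol_form_def wedge22_def wedge11_def radial_base_def
  by (simp add: quat_inner axis4_nth power4_eq_xxxx power3_eq_cube algebra_simps)

text \<open>The three summands have the same value, whence the factor 3.\<close>

lemma mixed_form_radial:
  "(\<Sum>i\<in>{1,2,3}. wedge22 (asd_form radial_vert i) (asd_form radial_base i)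
      (axis 0 1) (axis 1 1) (axis 2 1) (axis 3 1)) =
    - 3 * c\<^sup>2 * (z \<bullet> z) * f * \<kappa> * (h1 * f + \<kappa> * (f + f1 * (z \<bullet> z)))"
proof -
  have v: "asd_form radial_vert i (axis j 1) (axis k 1) =
     (h1 * \<kappa>) * (z $ j * (qcnj z \<odot> axis k 1) $ i - z $ k * (qcnj z \<odot> axis j 1) $ i) -
     \<kappa>\<^sup>2 * ((qcnj z \<odot> axis j 1) $ cyc i * (qcnj z \<odot> axis k 1) $ cyc (cyc i) -
           (qcnj z \<odot> axis k 1) $ cyc i * (qcnj z \<odot> axis j 1) $ cyc (cyc i))" if "i \<noteq> 0" for i j k
    using that unfolding asd_form_def wedge11_def radial_vert_def
    by (simp add: cyc_def inner_axis power2_eq_square algebra_simps)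
  have "wedge22 (asd_form radial_vert i) (asd_form radial_base i) (axis 0 1) (axis 1 1) (axis 2 1) (axis 3 1) =
    - c\<^sup>2 * (z \<bullet> z) * f * \<kappa> * (h1 * f + \<kappa> * (f + f1 * (z \<bullet> z)))" if i: "i \<in> {1,2,3}" for i
  proof -
    have "i = 1 \<or> i = 2 \<or> i = 3" using i by auto
    then show ?thesis
      by (elim disjE; simp only:; unfold wedge22_def;
          simp add: v cyc_def; simp add: asd_form_def wedge11_def radial_base_def cyc_def;
          simp add: qmul_def qcnj_def quat_inner axis4_nth power2_eq_square algebra_simps)
  qed
  then show ?thesis by simp
qed

text \<open>Since |conj(z) w| = |z| |w|, all four components with weight \<kappa> would give the
  first term; the second corrects the weight of the real component \<open>z \<bullet> w\<close> from
  \<kappa> to \<open>h1\<close>.\<close>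

lemma inner_radial_vert:
  "(\<Sum>i\<in>UNIV. radial_vert i u * radial_vert i v) =
     \<kappa>\<^sup>2 * (z \<bullet> z) * (u \<bullet> v) + (h1\<^sup>2 - \<kappa>\<^sup>2) * (z \<bullet> u) * (z \<bullet> v)"
  by (simp add: sum_4' radial_vert_def qmul_def qcnj_def quat_inner power2_eq_square algebra_simps)

lemma inner_radial_base:
  "(\<Sum>i\<in>UNIV. radial_base i u * radial_base i v) =
     c\<^sup>2 * (f\<^sup>2 * (u \<bullet> v) + (2 * f * f1 + f1\<^sup>2 * (z \<bullet> z)) * (z \<bullet> u) * (z \<bullet> v))"
  by (simp add: sum_4' radial_base_def quat_inner power2_eq_square algebra_simps)

end

text \<open>The eigenvalue is \<alpha> on the three-dimensional complement of \<open>z\<close> and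
  \<alpha> + \<beta> |z|^2 along \<open>z\<close>.\<close>

lemma det_scalar_plus_rank_one:
  fixes z :: quat
  shows "det (\<chi> i j. \<alpha> * (axis i 1 \<bullet> (axis j 1 :: quat)) + \<beta> * (z $ i) * (z $ j)) = \<alpha> ^ 3 * (\<alpha> + \<beta> * (z \<bullet> z))"
  by (simp add: det_4' inner_axis axis4_nth quat_inner power3_eq_cube algebra_simps)

text \<open>For real \<open>a\<close> the form \<open>da - a \<rho>\<close> separates into its real
  part \<open>da\<close> and its imaginary part \<open>- a \<rho>\<close>.\<close>

lemma vert_form_conn_real:
  "vert_form conn (y, qreal t) i (dy, qreal dt) = (if i = 0 then dt else - t * conn i y dy)"
proof -
  have "i = 0 \<or> i = 1 \<or> i = 2 \<or> i = 3"
    using UNIV_4' UNIV_I[of i] by blast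
  then show ?thesis
    by (auto simp: vert_form_def Let_def qreal_def)
qed

lemma base_form_gauge: "B \<in> Sp2 \<Longrightarrow> base_form (stereo_gauge B) z i v = - 2 / (1 + fst z \<bullet> fst z) * fst v $ i"
  by (simp add: base_form_def coframe_gauge)

text \<open>The three values that calibration compares: \<open>Phi0\<close>, the metric coefficient
  tangential to the orbits (which counts three times) and the radial one. The radial one is where
  the assumed ratio of \<open>h1\<close> and \<open>p\<close> enters as the equality case: it turns
  a sum of two squares into (S + 5)^3.\<close>

lemma calibration_identity:
  fixes R h f \<kappa> c h1 p m n S \<mu> :: real
  assumes n: "n > 0" and S: "S = f\<^sup>2 * m" and k: "\<kappa> = - h * f\<^sup>2 / n" and c: "c = - 2 / n"
    and h1: "h1 = \<mu> * h * f * (15 - S)" and p: "p = \<mu> * n * (5 - 3 * S)"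
  shows "16 * R\<^sup>2 * (h1 * \<kappa> ^ 3 * m\<^sup>2) + 25 * (R\<^sup>2 * h ^ 4) * (c ^ 4 * f ^ 3 * p) +
           20 * (R\<^sup>2 * h\<^sup>2) * (- 3 * c\<^sup>2 * m * f * \<kappa> * (h1 * f + \<kappa> * p)) =
         16 * R\<^sup>2 * h ^ 4 * f ^ 3 * \<mu> * (S + 5) ^ 3 / n ^ 3" (is ?A)
    and "4 * R * \<kappa>\<^sup>2 * m + 5 * (R * h\<^sup>2) * (c\<^sup>2 * f\<^sup>2) = 4 * R * h\<^sup>2 * f\<^sup>2 * (S + 5) / n\<^sup>2" (is ?B)
    and "4 * R * h1\<^sup>2 * m + 5 * (R * h\<^sup>2) * (c\<^sup>2 * p\<^sup>2) = 4 * R * h\<^sup>2 * \<mu>\<^sup>2 * (S + 5) ^ 3" (is ?C)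
proof -
  \<comment> \<open>With the reciprocal as a separate variable subject to N n = 1, all identities
    become polynomial and are within reach of \<open>algebra\<close>.\<close>
  define N where "N = 1 / n"
  have N: "N * n = 1" using n by (simp add: N_def)
  have k': "\<kappa> = - h * f\<^sup>2 * N" and c': "c = - 2 * N" by (simp_all add: k c N_def)
  have cp: "c * p = - 2 * \<mu> * (5 - 3 * S)" and kp: "\<kappa> * p = - h * f\<^sup>2 * \<mu> * (5 - 3 * S)"
    unfolding c' k' p using N by algebra+
  have t1: "h1 * \<kappa> ^ 3 * m\<^sup>2 = - \<mu> * h ^ 4 * f ^ 3 * N ^ 3 * ((15 - S) * S\<^sup>2)"
    unfolding h1 k' S by algebra
  have "c ^ 4 * f ^ 3 * p = c ^ 3 * f ^ 3 * (c * p)" by algebra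
  also have "\<dots> = 16 * \<mu> * f ^ 3 * N ^ 3 * (5 - 3 * S)"
    unfolding cp unfolding c' by algebra
  finally have t2: "c ^ 4 * f ^ 3 * p = 16 * \<mu> * f ^ 3 * N ^ 3 * (5 - 3 * S)" .
  have t3: "c\<^sup>2 * m * f * \<kappa> * (h1 * f + \<kappa> * p) = - 4 * N ^ 3 * h\<^sup>2 * f ^ 3 * \<mu> * (S * (10 + 2 * S))"
    unfolding kp unfolding h1 c' k' S by algebra
  have "16 * R\<^sup>2 * (h1 * \<kappa> ^ 3 * m\<^sup>2) + 25 * (R\<^sup>2 * h ^ 4) * (c ^ 4 * f ^ 3 * p) +
           20 * (R\<^sup>2 * h\<^sup>2) * (- 3 * (c\<^sup>2 * m * f * \<kappa> * (h1 * f + \<kappa> * p))) =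
         16 * R\<^sup>2 * h ^ 4 * f ^ 3 * \<mu> * (S + 5) ^ 3 * N ^ 3"
    unfolding t1 t2 t3 by algebra
  then show ?A
    by (simp add: N_def power_inverse mult.assoc divide_inverse)
  have "4 * R * \<kappa>\<^sup>2 * m + 5 * (R * h\<^sup>2) * (c\<^sup>2 * f\<^sup>2) = 4 * R * h\<^sup>2 * f\<^sup>2 * (S + 5) * N\<^sup>2"
    unfolding k' c' S by algebra
  then show ?B
    by (simp add: N_def power_inverse divide_inverse)
  have "c\<^sup>2 * p\<^sup>2 = (c * p)\<^sup>2" by algebra
  then show ?C
    unfolding cp h1 S by algebra
qed

text \<open>Pointwise data of an embedding \<open>z \<mapsto> (f z, h)\<close>, with \<open>f\<close> and \<open>h\<close> depending on \<open>|z|\<close> only and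
  \<open>df = f\<^sub>1 (z \<bullet> dz)\<close>, \<open>dh = h\<^sub>1 (z \<bullet> dz)\<close>.  The last two assumptions are the Cayley equation for the
  profile curve, written projectively (with factor \<open>\<mu>\<close>) to include the cone \<open>3 |f z|\<^sup>2 = 5\<close>, on which
  \<open>f + f\<^sub>1 |z|\<^sup>2 = 0\<close>; the sign of \<open>\<mu>\<close> is the orientation.\<close>

locale radial_point =
  fixes z :: quat and f f1 h h1 \<mu> :: real
  assumes f_pos: "f > 0" and h_pos: "h > 0" and mu_pos: "\<mu> > 0"
    and h1_eq: "h1 = \<mu> * h * f * (15 - f\<^sup>2 * (z \<bullet> z))"
    and p_eq: "f + f1 * (z \<bullet> z) = \<mu> * (1 + f\<^sup>2 * (z \<bullet> z)) * (5 - 3 * (f\<^sup>2 * (z \<bullet> z)))"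
begin

definition D :: "quat \<Rightarrow> quat \<times> quat" where
  "D w = (f *\<^sub>R w + (f1 * (z \<bullet> w)) *\<^sub>R z, qreal (h1 * (z \<bullet> w)))"

definition pt :: "quat \<times> quat" where
  "pt = (f *\<^sub>R z, qreal h)"

text \<open>The image determines \<open>h1 (z \<bullet> u)\<close> and
  \<open>p (z \<bullet> u)\<close>. The factors 15 - S and 5 - 3 S have no common zero, so
  \<open>z \<bullet> u\<close> is known, and then \<open>u\<close> because
  \<open>f > 0\<close>.\<close>

lemma inj_D: "inj D"
proof (rule injI)
  fix u v
  assume "D u = D v"
  then have 1: "f *\<^sub>R u + (f1 * (z \<bullet> u)) *\<^sub>R z = f *\<^sub>R v + (f1 * (z \<bullet> v)) *\<^sub>R z"
    and 2: "h1 * (z \<bullet> u) = h1 * (z \<bullet> v)"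
    by (simp_all add: D_def quat_eq_iff qreal_def)
  have "(f + f1 * (z \<bullet> z)) * (z \<bullet> u) = (f + f1 * (z \<bullet> z)) * (z \<bullet> v)"
    using arg_cong[OF 1, of "inner z"] by (simp add: inner_add_right algebra_simps)
  moreover have "h1 \<noteq> 0 \<or> f + f1 * (z \<bullet> z) \<noteq> 0"
  proof -
    have "1 + f\<^sup>2 * (z \<bullet> z) > 0"
      by (simp add: add_pos_nonneg)
    then show ?thesis
      unfolding h1_eq p_eq using f_pos h_pos mu_pos by auto
  qed
  ultimately have "z \<bullet> u = z \<bullet> v" using 2 by auto
  then show "u = v" using 1 f_pos by simp
qed

lemma calibration:
  assumes B: "B \<in> Sp2"
  defines "e \<equiv> \<lambda>i. D (axis i 1)"
  shows "Phi0 (stereo_gauge B) conn pt (e 0) (e 1) (e 2) (e 3) =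
    sqrt (det (\<chi> i j. metric0 (stereo_gauge B) conn pt (e i) (e j)))"
proof -
  define m where "m = z \<bullet> z"
  define S where "S = f\<^sup>2 * m"
  define n where "n = 1 + S"
  define \<kappa> where "\<kappa> = - h * f\<^sup>2 / n"
  define c where "c = - 2 / n"
  define p where "p = f + f1 * m"
  define R where "R = h powr (-4/5)"
  have m0: "m \<ge> 0" by (simp add: m_def)
  then have S0: "S \<ge> 0" by (simp add: S_def)
  then have n0: "n > 0" by (simp add: n_def)
  have R0: "R > 0" using h_pos by (simp add: R_def)
  have yn: "1 + (f *\<^sub>R z) \<bullet> (f *\<^sub>R z) = n"
    by (simp add: n_def S_def m_def power2_eq_square)
  have xi: "vert_form conn pt i (D w) = radial_vert z h1 \<kappa> i w" for i w
  proof -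
    have "i = 0 \<or> i = 1 \<or> i = 2 \<or> i = 3"
      using UNIV_4' UNIV_I[of i] by blast
    \<comment> \<open>The \<open>f1\<close> part of the tangent vector disappears, because conj(z) z
      is real.\<close>
    then have "i \<noteq> 0 \<Longrightarrow> conn i (f *\<^sub>R z) (f *\<^sub>R w + (f1 * (z \<bullet> w)) *\<^sub>R z) = f\<^sup>2 * (qcnj z \<odot> w) $ i / n"
      unfolding conn_def yn
      by (elim disjE) (simp_all add: qcnj_def qmul_def power2_eq_square algebra_simps)
    then show ?thesis
      by (simp add: pt_def D_def vert_form_conn_real radial_vert_def \<kappa>_def)
  qed
  have b: "base_form (stereo_gauge B) pt i (D w) = radial_base z c f f1 i w" for i w
    unfolding base_form_gauge[OF B] pt_def D_def fst_conv yn radial_base_def c_def by simp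
  have nrm: "norm (snd pt) = h"
    using h_pos by (simp add: pt_def norm_eq_sqrt_inner quat_inner qreal_def)
  \<comment> \<open>Every power of the radius is an integer power of \<open>R\<close> times one of
    \<open>h\<close>; fractional exponents do not occur beyond this point.\<close>
  have pw: "h powr (-8/5) = R\<^sup>2" "h powr (12/5) = R\<^sup>2 * h ^ 4" "h powr (2/5) = R\<^sup>2 * h\<^sup>2" "h powr (6/5) = R * h\<^sup>2"
  proof -
    have "h\<^sup>2 = h powr 2" "h ^ 4 = h powr 4" "R\<^sup>2 = h powr (-8/5)"
      using h_pos by (simp_all add: R_def powr_power)
    then show "h powr (-8/5) = R\<^sup>2" "h powr (12/5) = R\<^sup>2 * h ^ 4" "h powr (2/5) = R\<^sup>2 * h\<^sup>2"
      "h powr (6/5) = R * h\<^sup>2"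
      by (simp_all add: R_def flip: powr_add)
  qed
  have h1': "h1 = \<mu> * h * f * (15 - S)" and p': "p = \<mu> * n * (5 - 3 * S)"
    using h1_eq p_eq by (simp_all add: S_def m_def n_def p_def)
  note ids = calibration_identity[OF n0 S_def \<kappa>_def c_def h1' p', of R]
  have "Phi0 (stereo_gauge B) conn pt (e 0) (e 1) (e 2) (e 3) =
      16 * R\<^sup>2 * (h1 * \<kappa> ^ 3 * m\<^sup>2) + 25 * (R\<^sup>2 * h ^ 4) * (c ^ 4 * f ^ 3 * p) +
           20 * (R\<^sup>2 * h\<^sup>2) * (- 3 * c\<^sup>2 * m * f * \<kappa> * (h1 * f + \<kappa> * p))"
    unfolding Phi0_def Let_def nrm pw e_def vol_form_comp wedge22_asd_form_comp xi b
      vol_form_radial_vert vol_form_radial_base mixed_form_radial m_def p_def ..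
  also note ids(1)
  also have "16 * R\<^sup>2 * h ^ 4 * f ^ 3 * \<mu> * (S + 5) ^ 3 / n ^ 3 =
      sqrt (det (\<chi> i j. metric0 (stereo_gauge B) conn pt (e i) (e j)))"
  proof -
    define \<alpha> where "\<alpha> = 4 * R * \<kappa>\<^sup>2 * m + 5 * (R * h\<^sup>2) * (c\<^sup>2 * f\<^sup>2)"
    define \<beta> where "\<beta> = 4 * R * (h1\<^sup>2 - \<kappa>\<^sup>2) + 5 * (R * h\<^sup>2) * (c\<^sup>2 * (2 * f * f1 + f1\<^sup>2 * m))"
    have "metric0 (stereo_gauge B) conn pt (D u) (D v) = \<alpha> * (u \<bullet> v) + \<beta> * (z \<bullet> u) * (z \<bullet> v)" for u v
      unfolding metric0_def Let_def nrm pw xi b inner_radial_vert inner_radial_base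
        R_def[symmetric] m_def[symmetric] \<alpha>_def \<beta>_def by algebra
    then have "det (\<chi> i j. metric0 (stereo_gauge B) conn pt (e i) (e j)) =
        det (\<chi> i j. \<alpha> * (axis i 1 \<bullet> (axis j 1 :: quat)) + \<beta> * (z $ i) * (z $ j))"
      by (simp add: e_def inner_axis)
    also have "\<dots> = \<alpha> ^ 3 * (\<alpha> + \<beta> * m)"
      unfolding det_scalar_plus_rank_one m_def ..
    also have "\<alpha> + \<beta> * m = 4 * R * h1\<^sup>2 * m + 5 * (R * h\<^sup>2) * (c\<^sup>2 * p\<^sup>2)"
      unfolding \<alpha>_def \<beta>_def p_def by algebra
    also note ids(3)
    also have "\<alpha> = 4 * R * h\<^sup>2 * f\<^sup>2 * (S + 5) / n\<^sup>2"
      unfolding \<alpha>_def by (rule ids(2))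
    also have "(4 * R * h\<^sup>2 * f\<^sup>2 * (S + 5) / n\<^sup>2) ^ 3 * (4 * R * h\<^sup>2 * \<mu>\<^sup>2 * (S + 5) ^ 3) =
        (16 * R\<^sup>2 * h ^ 4 * f ^ 3 * \<mu> * (S + 5) ^ 3 / n ^ 3)\<^sup>2"
      by (simp add: power_divide) algebra
    finally show ?thesis
      using R0 f_pos mu_pos S0 n0 by simp
  qed
  finally show ?thesis .
qed

end

section \<open>Submanifolds given by one chart\<close>

lemma continuous_on_hom_coord_triv_gauge: "continuous_on A (\<lambda>x. hom_coord (triv (stereo_gauge B) x))"
proof -
  have "hom_coord (triv (stereo_gauge B) x) = (1 + fst x \<bullet> fst x) powr (-1/2) *\<^sub>R
     ((B$1$1 \<odot> fst x + B$1$2) \<odot> qcnj (snd x), (B$2$1 \<odot> fst x + B$2$2) \<odot> qcnj (snd x))" for x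
    using hom_coord_triv_gauge[of B "fst x" "snd x"] by simp
  then show ?thesis
    by (auto intro!: continuous_intros bounded_bilinear.continuous_on[OF bounded_bilinear_qmul]
        bounded_linear.continuous_on[OF bounded_linear_qcnj] simp: one_plus_inner_pos(2))
qed

lemma homeomorphism_imp_homeomorphic_map:
  assumes "homeomorphism S T f g"
  shows "homeomorphic_map (top_of_set S) (top_of_set T) f"
proof -
  have "homeomorphic_maps (top_of_set S) (top_of_set T) f g"
    using assms unfolding homeomorphic_maps_def homeomorphism_def
    by (auto simp: continuous_map_subtopology_eu)
  then show ?thesis unfolding homeomorphic_map_maps by blast
qed

lemma homeomorphic_imp_homeomorphic_space:
  "S homeomorphic T \<Longrightarrow> top_of_set S homeomorphic_space top_of_set T"
  unfolding homeomorphic_def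
  using homeomorphism_imp_homeomorphic_map homeomorphic_map_imp_homeomorphic_space by blast

text \<open>The continuous left inverse \<open>k\<close>, read in homogeneous coordinates, makes the
  chart an embedding; an injective immersion need not be a homeomorphism onto its image.\<close>

locale single_chart =
  fixes V :: "quat set" and B :: qmat and \<psi> :: "quat \<Rightarrow> quat \<times> quat" and N :: "spinor set"
    and k :: "quat \<times> quat \<Rightarrow> quat"
  assumes open_V: "open V" and B: "B \<in> Sp2" and smooth_psi: "smooth_on V \<psi>"
    and snd_psi: "\<And>z. z \<in> V \<Longrightarrow> snd (\<psi> z) \<noteq> 0"
    and inj_psi: "\<And>z. z \<in> V \<Longrightarrow> inj (frechet_derivative \<psi> (at z))"
    and calibrated: "\<And>z. z \<in> V \<Longrightarrow>
      (let e = (\<lambda>i. frechet_derivative \<psi> (at z) (axis i 1)) in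
         Phi0 (stereo_gauge B) conn (\<psi> z) (e 0) (e 1) (e 2) (e 3) =
         sqrt (det (\<chi> i j. metric0 (stereo_gauge B) conn (\<psi> z) (e i) (e j))))"
    and N_eq: "N = (\<lambda>z. triv (stereo_gauge B) (\<psi> z)) ` V"
    and continuous_k: "continuous_on (hom_coord ` N) k"
    and k: "\<And>z. z \<in> V \<Longrightarrow> k (hom_coord (triv (stereo_gauge B) (\<psi> z))) = z"
begin

abbreviation \<phi> :: "quat \<Rightarrow> spinor" where
  "\<phi> z \<equiv> triv (stereo_gauge B) (\<psi> z)"

lemma N_subset: "N \<subseteq> M0"
  using snd_psi by (auto simp: N_eq triv_gauge_in_M0 B)

lemma homeomorphic_map_chart: "homeomorphic_map (top_of_set V) (subtopology M0_top N) \<phi>"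
proof -
  have "homeomorphism V (hom_coord ` N) (hom_coord \<circ> \<phi>) k"
    unfolding homeomorphism_def comp_def
    using continuous_on_compose2[OF continuous_on_hom_coord_triv_gauge
        smooth_on_imp_continuous_on[OF smooth_psi] subset_UNIV] continuous_k k
    by (auto simp: N_eq image_image)
  then have 1: "homeomorphic_map (top_of_set V) (top_of_set (hom_coord ` N)) (hom_coord \<circ> \<phi>)"
    by (rule homeomorphism_imp_homeomorphic_map)
  have im: "hom_coord ` N \<subseteq> - {0}"
    using N_subset hom_coord_M0_nonzero by auto
  have "homeomorphic_map (subtopology M0_top N) (subtopology (top_of_set (- {0})) (hom_coord ` N)) hom_coord"
    using N_subset im
    by (intro homeomorphic_map_subtopologies[OF homeomorphic_map_hom_coord])
      (auto simp: topspace_M0_top Int_absorb1)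
  then obtain g where g: "homeomorphic_maps (subtopology M0_top N) (top_of_set (hom_coord ` N)) hom_coord g"
    using im by (auto simp: homeomorphic_map_maps subtopology_subtopology Int_absorb1)
  then have "homeomorphic_map (top_of_set (hom_coord ` N)) (subtopology M0_top N) g"
    using homeomorphic_maps_sym homeomorphic_map_maps by blast
  from homeomorphic_map_compose[OF 1 this]
  show ?thesis
  proof (rule homeomorphic_map_eq)
    fix z
    assume "z \<in> topspace (top_of_set V)"
    then have "\<phi> z \<in> topspace (subtopology M0_top N)"
      using N_subset by (auto simp: N_eq topspace_M0_top)
    then show "(g \<circ> (hom_coord \<circ> \<phi>)) z = \<phi> z"
      using g unfolding homeomorphic_maps_def by simp
  qed
qed

lemma homeomorphic_space_chart: "subtopology M0_top N homeomorphic_space top_of_set V"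
  using homeomorphic_map_imp_homeomorphic_space[OF homeomorphic_map_chart]
  by (rule homeomorphic_space_sym[THEN iffD1])

lemma local_rep_chart: "z \<in> V \<Longrightarrow> local_rep \<phi> z UNIV (stereo_gauge B) \<psi>"
  unfolding local_rep_def
  using open_V smooth_psi snd_psi by (intro exI[of _ V]) (auto simp: mem_Times_iff)

text \<open>With a single chart the only transition map is the identity, of Jacobian 1, so
  \<open>N\<close> is oriented by the chart itself.\<close>

lemma Cayley_chart: "Cayley N"
proof -
  have inj: "inj_on \<phi> V"
    using k by (rule inj_on_inverseI[where g = "\<lambda>p. k (hom_coord p)"])
  have sg: "spin_gauge UNIV (stereo_gauge B) conn"
    by (rule spin_gauge_gauge[OF B])
  have "immersion V \<phi>"
    unfolding immersion_def using sg local_rep_chart inj_psi by fast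
  moreover have im: "\<phi> ` V = N" by (rule N_eq[symmetric])
  moreover have "openin (subtopology M0_top N) N"
    using openin_topspace[of "subtopology M0_top N"] N_subset
    by (simp add: topspace_M0_top Int_absorb1)
  ultimately have "local_param N V \<phi>"
    unfolding local_param_def im by (intro conjI open_V homeomorphic_map_chart)
  moreover have "\<exists>D. ((\<lambda>z. the_inv_into V \<phi> (\<phi> z)) has_derivative D) (at y) \<and> det (matrix D) > 0"
    if "y \<in> V" for y
  proof (intro exI[of _ "\<lambda>z. z"] conjI)
    show "((\<lambda>z. the_inv_into V \<phi> (\<phi> z)) has_derivative (\<lambda>z. z)) (at y)"
      by (rule has_derivative_transform_within_open[OF has_derivative_ident open_V that])
        (simp add: the_inv_into_f_f[OF inj])
    have "matrix (\<lambda>z::quat. z) = mat 1"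
      by (auto simp: matrix_def mat_def axis_def vec_eq_iff)
    then show "det (matrix (\<lambda>z::quat. z)) > 0" by simp
  qed
  ultimately have "oriented_atlas N {(V, \<phi>)}"
    unfolding oriented_atlas_def using N_subset by (auto simp: N_eq)
  moreover have "calibrated_at \<phi> y" if "y \<in> V" for y
    unfolding calibrated_at_def using sg local_rep_chart[OF that] calibrated[OF that] by fast
  ultimately show ?thesis
    unfolding Cayley_def by (intro exI[of _ "{(V, \<phi>)}"]) auto
qed

end

locale radial_chart =
  fixes V :: "quat set" and f f1 h h1 \<mu> :: "quat \<Rightarrow> real"
  assumes open_V: "open V" and smooth_f: "smooth_on V f" and smooth_h: "smooth_on V h"
    and der_f: "\<And>z. z \<in> V \<Longrightarrow> (f has_derivative (\<lambda>w. f1 z * (z \<bullet> w))) (at z)"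
    and der_h: "\<And>z. z \<in> V \<Longrightarrow> (h has_derivative (\<lambda>w. h1 z * (z \<bullet> w))) (at z)"
    and radial: "\<And>z. z \<in> V \<Longrightarrow> radial_point z (f z) (f1 z) (h z) (h1 z) (\<mu> z)"
begin

definition \<psi> :: "quat \<Rightarrow> quat \<times> quat" where
  "\<psi> z = (f z *\<^sub>R z, qreal (h z))"

lemma derivative_psi:
  assumes "z \<in> V"
  shows "frechet_derivative \<psi> (at z) = radial_point.D z (f z) (f1 z) (h1 z)"
proof -
  interpret radial_point z "f z" "f1 z" "h z" "h1 z" "\<mu> z" by (rule radial[OF assms])
  have "(\<psi> has_derivative D) (at z)"
    unfolding \<psi>_def[abs_def] D_def[abs_def]
    by (intro has_derivative_Pair bounded_linear.has_derivative[OF bounded_linear_qreal] der_h[OF assms])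
      (auto intro!: derivative_eq_intros der_f[OF assms])
  then show ?thesis by (metis frechet_derivative_at)
qed

text \<open>The positive real fibre coordinate \<open>h z\<close> keeps q2 on the ray through
  \<open>v\<close>, while q1 / |q2| is \<open>f z\<close> times \<open>z\<close>.\<close>

lemma hom_coord_radial:
  assumes "z \<in> V"
  shows "hom_coord (triv (stereo_gauge (qdiag (qreal 1) v)) (\<psi> z)) =
    ((1 + (f z)\<^sup>2 * (z \<bullet> z)) powr (-1/2) * h z) *\<^sub>R (f z *\<^sub>R z, v)"
  unfolding \<psi>_def by (simp add: hom_coord_triv_gauge_simps power2_eq_square scaleR_left_commute mult_ac)

lemma single_chart_radial:
  assumes v: "v \<in> Sp1" and N: "N = (\<lambda>z. triv (stereo_gauge (qdiag (qreal 1) v)) (\<psi> z)) ` V"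
    and c: "continuous_on (hom_coord ` N) k"
    and k: "\<And>z. z \<in> V \<Longrightarrow>
      k (((1 + (f z)\<^sup>2 * (z \<bullet> z)) powr (-1/2) * h z) *\<^sub>R (f z *\<^sub>R z, v)) = z"
  shows "single_chart V (qdiag (qreal 1) v) \<psi> N k"
proof
  show "smooth_on V \<psi>"
    unfolding \<psi>_def[abs_def]
    by (intro smooth_on_Pair smooth_on_scaleR smooth_on_id open_V smooth_f smooth_h
        smooth_on_compose_linear[OF _ bounded_linear_qreal])
  show "snd (\<psi> z) \<noteq> 0" if "z \<in> V" for z
    using radial_point.h_pos[OF radial[OF that]] by (simp add: \<psi>_def quat_eq_iff qreal_def)
  show "inj (frechet_derivative \<psi> (at z))" if "z \<in> V" for z
    unfolding derivative_psi[OF that] by (rule radial_point.inj_D[OF radial[OF that]])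
  show "let e = (\<lambda>i. frechet_derivative \<psi> (at z) (axis i 1)) in
         Phi0 (stereo_gauge (qdiag (qreal 1) v)) conn (\<psi> z) (e 0) (e 1) (e 2) (e 3) =
         sqrt (det (\<chi> i j. metric0 (stereo_gauge (qdiag (qreal 1) v)) conn (\<psi> z) (e i) (e j)))"
    if "z \<in> V" for z
    unfolding derivative_psi[OF that] Let_def
    using radial_point.calibration[OF radial[OF that] qdiag_in_Sp2[OF v]]
    unfolding radial_point.pt_def[OF radial[OF that]] \<psi>_def .
  show "k (hom_coord (triv (stereo_gauge (qdiag (qreal 1) v)) (\<psi> z))) = z" if "z \<in> V" for z
    unfolding hom_coord_radial[OF that] by (rule k[OF that])
qed (use open_V qdiag_in_Sp2[OF v] N c in auto)

end

section \<open>Topological types of the chart domains\<close>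

lemma homeomorphic_sphere_times_UNIV:
  fixes I :: "real set" and \<tau> \<sigma> :: "real \<Rightarrow> real"
  assumes h: "homeomorphism I UNIV \<tau> \<sigma>" and I: "I \<subseteq> {0<..}"
  shows "{x::quat. norm x \<in> I} homeomorphic (sphere (0::quat) 1 \<times> (UNIV::real set))"
proof -
  have \<sigma>: "\<sigma> s > 0" "\<sigma> s \<in> I" for s
    using h I by (auto simp: homeomorphism_def)
  have "homeomorphism {x::quat. norm x \<in> I} (sphere (0::quat) 1 \<times> (UNIV::real set))
      (\<lambda>x. ((1 / norm x) *\<^sub>R x, \<tau> (norm x))) (\<lambda>(u, s). \<sigma> s *\<^sub>R u)"
  proof (rule homeomorphismI)
    have c: "continuous_on I \<tau>" "continuous_on UNIV \<sigma>"
      using h by (simp_all add: homeomorphism_def)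
    have "\<forall>x\<in>{x::quat. norm x \<in> I}. norm x \<noteq> 0"
      using I by auto
    then show "continuous_on {x::quat. norm x \<in> I} (\<lambda>x. ((1 / norm x) *\<^sub>R x, \<tau> (norm x)))"
      by (intro continuous_on_Pair continuous_on_scaleR continuous_on_divide continuous_on_const
          continuous_on_norm continuous_on_id continuous_on_compose2[OF c(1) continuous_on_norm[OF continuous_on_id]])
        auto
    show "continuous_on (sphere 0 1 \<times> UNIV) (\<lambda>(u::quat, s). \<sigma> s *\<^sub>R u)"
      unfolding case_prod_beta
      by (intro continuous_on_scaleR continuous_on_compose2[OF c(2) continuous_on_snd[OF continuous_on_id]]
          continuous_on_fst continuous_on_id) auto
    show "(\<lambda>x. ((1 / norm x) *\<^sub>R x, \<tau> (norm x))) ` {x::quat. norm x \<in> I} \<subseteq> sphere 0 1 \<times> UNIV"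
      using I by auto
    show "(\<lambda>(u, s). \<sigma> s *\<^sub>R u) ` (sphere (0::quat) 1 \<times> UNIV) \<subseteq> {x. norm x \<in> I}"
      using \<sigma> by (auto simp: less_imp_le)
    show "(case ((1 / norm x) *\<^sub>R x, \<tau> (norm x)) of (u, s) \<Rightarrow> \<sigma> s *\<^sub>R u) = x"
      if "x \<in> {x. norm x \<in> I}" for x :: quat
      using that h I by (auto simp: homeomorphism_def)
    show "((1 / norm (case y of (u, s) \<Rightarrow> \<sigma> s *\<^sub>R u)) *\<^sub>R (case y of (u, s) \<Rightarrow> \<sigma> s *\<^sub>R u),
         \<tau> (norm (case y of (u, s) \<Rightarrow> \<sigma> s *\<^sub>R u))) = y"
      if "y \<in> sphere (0::quat) 1 \<times> UNIV" for y
      using that h \<sigma> less_imp_neq[OF \<sigma>(1)] by (auto simp: homeomorphism_def less_imp_le)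
  qed
  then show ?thesis unfolding homeomorphic_def by blast
qed

lemma punctured_space_homeomorphic_S3_times_R: "top_of_set (- {0::quat}) homeomorphic_space S3_times_R"
proof -
  have "homeomorphism {0<..} UNIV ln (exp :: real \<Rightarrow> real)"
    by (rule homeomorphismI) (auto intro!: continuous_intros)
  from homeomorphic_sphere_times_UNIV[OF this] 
  have "{x::quat. norm x \<in> {0<..}} homeomorphic (sphere (0::quat) 1 \<times> (UNIV::real set))" by simp
  moreover have "{x::quat. norm x \<in> {0<..}} = - {0}" by auto
  ultimately have "(- {0::quat}) homeomorphic (sphere (0::quat) 1 \<times> (UNIV::real set))"
    by (simp only:)
  then show ?thesis
    unfolding S3_times_R_def by (rule homeomorphic_imp_homeomorphic_space)
qed

lemma punctured_ball_homeomorphic_S3_times_R: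
  assumes "\<rho> > 0"
  shows "top_of_set {z::quat. z \<noteq> 0 \<and> norm z < \<rho>} homeomorphic_space S3_times_R"
proof -
  have p: "1 + exp s > 0" "1 + exp s \<noteq> 0" for s :: real
    by (simp_all add: add_pos_pos) (metis add_pos_pos exp_gt_zero less_irrefl zero_less_one)
  \<comment> \<open>The logistic function stretches the interval of radii to the whole line.\<close>
  have "homeomorphism {0<..<\<rho>} UNIV (\<lambda>r. ln (r / (\<rho> - r))) (\<lambda>s. \<rho> * (exp s / (1 + exp s)))"
  proof (rule homeomorphismI)
    show "continuous_on {0<..<\<rho>} (\<lambda>r. ln (r / (\<rho> - r)))"
      by (auto intro!: continuous_intros)
    show "continuous_on UNIV (\<lambda>s. \<rho> * (exp s / (1 + exp s)))"
      using p by (auto intro!: continuous_intros)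
    show "(\<lambda>s. \<rho> * (exp s / (1 + exp s))) ` UNIV \<subseteq> {0<..<\<rho>}"
    proof clarify
      fix s :: real
      have "exp s / (1 + exp s) < 1" using p[of s] by simp
      moreover have "exp s / (1 + exp s) > 0" using p[of s] by simp
      ultimately show "\<rho> * (exp s / (1 + exp s)) \<in> {0<..<\<rho>}"
        using assms mult_strict_left_mono[of "exp s / (1 + exp s)" 1 \<rho>] mult_pos_pos[of \<rho> "exp s / (1 + exp s)"]
        by (simp only: greaterThanLessThan_iff mult_1_right)
    qed
    show "\<rho> * (exp (ln (r / (\<rho> - r))) / (1 + exp (ln (r / (\<rho> - r))))) = r" if "r \<in> {0<..<\<rho>}" for r
    proof -
      have "r / (\<rho> - r) > 0" using that by simp
      then show ?thesis using that by (simp add: field_simps)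
    qed
    show "ln (\<rho> * (exp s / (1 + exp s)) / (\<rho> - \<rho> * (exp s / (1 + exp s)))) = s" for s
    proof -
      have "\<rho> - \<rho> * (exp s / (1 + exp s)) = \<rho> / (1 + exp s)"
        using p[of s] by (simp add: field_simps)
      then show ?thesis using assms p[of s] by simp
    qed
  qed auto
  moreover have "{0<..<\<rho>} \<subseteq> {0<..}" by auto
  ultimately have "{x::quat. norm x \<in> {0<..<\<rho>}} homeomorphic (sphere (0::quat) 1 \<times> (UNIV::real set))"
    by (rule homeomorphic_sphere_times_UNIV)
  moreover have "{x::quat. norm x \<in> {0<..<\<rho>}} = {z. z \<noteq> 0 \<and> norm z < \<rho>}" by auto
  ultimately have "{z::quat. z \<noteq> 0 \<and> norm z < \<rho>} homeomorphic (sphere (0::quat) 1 \<times> (UNIV::real set))"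
    by (simp only:)
  then show ?thesis
    unfolding S3_times_R_def by (rule homeomorphic_imp_homeomorphic_space)
qed

lemma ball_homeomorphic_euclidean:
  "\<rho> > 0 \<Longrightarrow> top_of_set (ball (0::quat) \<rho>) homeomorphic_space (euclidean :: quat topology)"
  using homeomorphic_imp_homeomorphic_space[OF homeomorphic_ball_UNIV[of \<rho> "0::quat"]] by simp

section \<open>The fibres\<close>

text \<open>\<open>level\<close> is the fifth root of the first integral \<open>t\<^sup>2 (5 t\<^sup>2 - 3 s\<^sup>2)\<^sup>5 / (s\<^sup>2 + t\<^sup>2)\<^sup>3\<close>, where \<open>s = |q\<^sub>1|\<close>,
  \<open>t = |q\<^sub>2|\<close>.  Unlike the integral itself it has no critical points on its zero set.  \<open>fibre_map\<close>
  identifies the pairs (level, \<open>q\<^sub>2 / t\<close>) with \<open>\<real>\<^sup>4 - {0}\<close>.\<close>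

definition level :: "quat \<times> quat \<Rightarrow> real" where
  "level Q = (let S = (fst Q \<bullet> fst Q) / (snd Q \<bullet> snd Q) in
     norm (snd Q) powr (6/5) * (5 - 3 * S) / (1 + S) powr (3/5))"

definition fibre_map :: "spinor \<Rightarrow> real^4" where
  "fibre_map p = (let Q = hom_coord p in
     if snd Q = 0 then 0 else (exp (level Q) / norm (snd Q)) *\<^sub>R snd Q)"

definition fibre :: "real^4 \<Rightarrow> spinor set" where
  "fibre b = {p \<in> M0. fibre_map p = b}"

section \<open>Fibres in homogeneous coordinates\<close>

lemma level_scaleR:
  assumes "t > 0" "v \<in> Sp1"
  shows "level (t *\<^sub>R (x, v)) = t powr (6/5) * (5 - 3 * (x \<bullet> x)) / (1 + x \<bullet> x) powr (3/5)"
proof -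
  have "v \<bullet> v = 1" "norm v = 1" using assms(2) by (simp_all add: Sp1_def norm_eq_1)
  then show ?thesis using assms(1) by (simp add: level_def Let_def)
qed

lemma fibre_map_scaleR:
  assumes "t > 0" "v \<in> Sp1" "hom_coord p = t *\<^sub>R (x, v)"
  shows "fibre_map p = exp (t powr (6/5) * (5 - 3 * (x \<bullet> x)) / (1 + x \<bullet> x) powr (3/5)) *\<^sub>R v"
proof -
  have "norm v = 1" "v \<noteq> 0" using assms(2) by (auto simp: Sp1_def)
  then show ?thesis
    using assms(1) by (simp add: fibre_map_def Let_def assms(3) flip: level_scaleR[OF assms(1,2)])
qed

text \<open>The value 0 is free for q2 = 0: elsewhere the norm of \<open>fibre_map\<close> is an
  exponential.\<close>

lemma fibre_0: "p \<in> fibre 0 \<longleftrightarrow> p \<in> M0 \<and> snd (hom_coord p) = 0"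
  by (auto simp: fibre_def fibre_map_def Let_def)

text \<open>Here t = |q2| and x = q1 / |q2|; the direction of \<open>b\<close> gives that of q2, and
  ln |b| is the level.\<close>

lemma fibre_nonzero:
  assumes b: "b \<noteq> 0"
  shows "p \<in> fibre b \<longleftrightarrow> p \<in> M0 \<and> (\<exists>t>0. \<exists>x. hom_coord p = t *\<^sub>R (x, (1 / norm b) *\<^sub>R b) \<and>
    t powr (6/5) * (5 - 3 * (x \<bullet> x)) / (1 + x \<bullet> x) powr (3/5) = ln (norm b))" (is "_ \<longleftrightarrow> _ \<and> ?R")
proof -
  let ?v = "(1 / norm b) *\<^sub>R b"
  have v: "?v \<in> Sp1" using b by (simp add: Sp1_def)
  have "?R \<longleftrightarrow> fibre_map p = b"
  proof
    assume ?R
    then obtain t x where "t > 0" "hom_coord p = t *\<^sub>R (x, ?v)"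
      "t powr (6/5) * (5 - 3 * (x \<bullet> x)) / (1 + x \<bullet> x) powr (3/5) = ln (norm b)" by blast
    with fibre_map_scaleR[OF _ v] b show "fibre_map p = b" by simp
  next
    assume p: "fibre_map p = b"
    define q1 q2 where "q1 = fst (hom_coord p)" and "q2 = snd (hom_coord p)"
    have q2: "q2 \<noteq> 0" using p b by (auto simp: fibre_map_def q2_def Let_def)
    then have b': "b = (exp (level (q1, q2)) / norm q2) *\<^sub>R q2"
      using p by (simp add: fibre_map_def q1_def q2_def Let_def)
    then have nb: "norm b = exp (level (q1, q2))" using q2 by simp
    then have "?v = (1 / norm q2) *\<^sub>R q2" using b' by simp
    then have q: "(q1, q2) = norm q2 *\<^sub>R ((1 / norm q2) *\<^sub>R q1, ?v)"
      using q2 by simp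
    moreover have "level (q1, q2) = ln (norm b)" by (simp add: nb)
    ultimately show ?R
      using q2 level_scaleR[OF _ v, of "norm q2" "(1 / norm q2) *\<^sub>R q1"]
      by (intro exI[of _ "norm q2"] exI[of _ "(1 / norm q2) *\<^sub>R q1"] conjI)
        (simp_all add: q1_def q2_def)
  qed
  then show ?thesis by (auto simp: fibre_def)
qed

text \<open>Treats both signs of the level \<open>C\<close>. On a fibre the points x = q1 / |q2|
  fill the region where 5 - 3 |x|^2 has the sign of \<open>C\<close>, and z \<mapsto> f(z) z
  parametrises this region with inverse \<open>inv_f\<close>. The assumption \<open>orient\<close>
  amounts to positivity of \<mu>.\<close>

locale conical_chart =
  fixes V :: "quat set" and f f1 :: "quat \<Rightarrow> real" and C :: real and inv_f :: "quat \<Rightarrow> quat"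
  assumes C_nonzero: "C \<noteq> 0" and open_V: "open V" and smooth_f: "smooth_on V f"
    and der_f: "\<And>z. z \<in> V \<Longrightarrow> (f has_derivative (\<lambda>w. f1 z * (z \<bullet> w))) (at z)"
    and f_pos: "\<And>z. z \<in> V \<Longrightarrow> f z > 0"
    and pos: "\<And>z. z \<in> V \<Longrightarrow> C / (5 - 3 * ((f z)\<^sup>2 * (z \<bullet> z))) > 0"
    and orient: "\<And>z. z \<in> V \<Longrightarrow> (f z + f1 z * (z \<bullet> z)) / (5 - 3 * ((f z)\<^sup>2 * (z \<bullet> z))) > 0"
    and inv_f_V: "\<And>x. C / (5 - 3 * (x \<bullet> x)) > 0 \<Longrightarrow> inv_f x \<in> V"
    and f_inv_f: "\<And>x. C / (5 - 3 * (x \<bullet> x)) > 0 \<Longrightarrow> f (inv_f x) *\<^sub>R inv_f x = x"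
    and inv_f_f: "\<And>z. z \<in> V \<Longrightarrow> inv_f (f z *\<^sub>R z) = z"
    and continuous_inv_f: "continuous_on {x. C / (5 - 3 * (x \<bullet> x)) > 0} inv_f"
begin

definition S :: "quat \<Rightarrow> real" where "S z = (f z)\<^sup>2 * (z \<bullet> z)"
definition p :: "quat \<Rightarrow> real" where "p z = f z + f1 z * (z \<bullet> z)"
text \<open>The solution of the Cayley equation dh / dS = h (15 - S) / (2 (1 + S) (5 - 3 S)), by the
  partial fractions (15 - S) / ((1 + S) (5 - 3 S)) = 2 / (1 + S) + 5 / (5 - 3 S). The constant of
  integration is chosen to give level \<open>C\<close>, see \<open>t_powr\<close>.\<close>

definition h :: "quat \<Rightarrow> real" where "h z = (1 + S z) * (C / (5 - 3 * S z)) powr (5/6)"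
definition \<mu> :: "quat \<Rightarrow> real" where "\<mu> z = p z / ((1 + S z) * (5 - 3 * S z))"
definition h1 :: "quat \<Rightarrow> real" where "h1 z = \<mu> z * h z * f z * (15 - S z)"

lemma S_nonneg: "S z \<ge> 0" by (simp add: S_def)

lemma S_eq: "S z = (f z *\<^sub>R z) \<bullet> (f z *\<^sub>R z)"
  by (simp add: S_def power2_eq_square)

lemma pos': "z \<in> V \<Longrightarrow> C / (5 - 3 * S z) > 0" and orient': "z \<in> V \<Longrightarrow> p z / (5 - 3 * S z) > 0"
  using pos orient by (simp_all add: S_def p_def)

lemma S_ne: "z \<in> V \<Longrightarrow> 5 - 3 * S z \<noteq> 0"
  using pos'[of z] by auto

lemma has_derivative_S:
  assumes "z \<in> V"
  shows "(S has_derivative (\<lambda>w. 2 * f z * p z * (z \<bullet> w))) (at z)"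
  unfolding S_def[abs_def]
  by (auto intro!: derivative_eq_intros der_f[OF assms] simp: p_def inner_commute power2_eq_square algebra_simps)

lemma has_derivative_h:
  assumes "z \<in> V"
  shows "(h has_derivative (\<lambda>w. h1 z * (z \<bullet> w))) (at z)"
proof -
  define s where "s = S z"
  have s: "5 - 3 * s \<noteq> 0" "1 + s > 0" "C / (5 - 3 * s) > 0"
    using S_ne[OF assms] S_nonneg[of z] pos'[OF assms] by (simp_all add: s_def)
  define P where "P = (C / (5 - 3 * s)) powr (5/6)"
  have C: "C \<noteq> 0" using s(3) by auto
  have "((\<lambda>s. (C / (5 - 3 * s))) has_real_derivative (3 * C / (5 - 3 * s)\<^sup>2)) (at s)"
    using s by (auto intro!: derivative_eq_intros simp: field_simps power2_eq_square)
  from has_real_derivative_powr[OF s(3), of "5/6"] this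
  have "((\<lambda>s. (C / (5 - 3 * s)) powr (5/6)) has_real_derivative
      (5/6 * (C / (5 - 3 * s)) powr (5/6 - 1) * (3 * C / (5 - 3 * s)\<^sup>2))) (at s)"
    by (rule DERIV_chain2)
  moreover have "(C / (5 - 3 * s)) powr (5/6 - 1) = P / (C / (5 - 3 * s))"
    by (metis P_def less_imp_le powr_diff powr_one s(3))
  moreover have "5/6 * (P / (C / d)) * (3 * C / d\<^sup>2) = 5/2 * P / d" if "d \<noteq> 0" for d
    using that C by (simp add: power2_eq_square)
  from this[OF s(1)] have "5/6 * (P / (C / (5 - 3 * s))) * (3 * C / (5 - 3 * s)\<^sup>2) = 5/2 * P / (5 - 3 * s)" .
  ultimately have "((\<lambda>s. (C / (5 - 3 * s)) powr (5/6)) has_real_derivative 5/2 * P / (5 - 3 * s)) (at s)"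
    by (simp only:)
  then have "((\<lambda>s. (1 + s) * (C / (5 - 3 * s)) powr (5/6)) has_real_derivative
       P + (1 + s) * (5/2 * P / (5 - 3 * s))) (at s)"
    by (rule DERIV_cong[OF DERIV_mult[OF DERIV_add[OF DERIV_const DERIV_ident]]])
      (simp add: P_def mult.commute)
  then have "(h has_derivative (\<lambda>w. (P + (1 + s) * (5/2 * P / (5 - 3 * s))) * (2 * f z * p z * (z \<bullet> w)))) (at z)"
    using has_derivative_compose[OF has_derivative_S[OF assms]]
    unfolding has_field_derivative_def h_def[abs_def] s_def by blast
  moreover have "(P + (1 + s) * (5/2 * P / (5 - 3 * s))) * (2 * f z * p z) = h1 z"
  proof -
    \<comment> \<open>Rests on 2 (5 - 3 s) + 5 (1 + s) = 15 - s.\<close>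
    have "(P + (1 + s) * (5/2 * P / (5 - 3 * s))) * (2 * f z * p z) =
        p z * f z * (15 - s) * P / (5 - 3 * s)"
      using s by (simp add: field_simps)
    also have "\<dots> = h1 z"
      using s by (simp add: h1_def \<mu>_def h_def P_def flip: s_def)
    finally show ?thesis .
  qed
  ultimately show ?thesis by (simp flip: mult.assoc)
qed

lemma radial_chart: "radial_chart V f f1 h h1 \<mu>"
proof (rule radial_chart.intro)
  have sm: "smooth_on V S"
    unfolding S_def[abs_def] power2_eq_square
    by (intro smooth_on_mult smooth_on_inner smooth_on_id smooth_f open_V)
  \<comment> \<open>With the base of the power inverted, it is an affine function of
    \<open>S\<close> and \<open>smooth_on_powr\<close> applies.\<close>
  have sm_h: "smooth_on V (\<lambda>z. (1 + S z) * (((1 / C) * (5 - 3 * S z)) powr (-5/6)))"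
  proof (intro smooth_on_mult smooth_on_add smooth_on_powr smooth_on_diff smooth_on_const sm open_V)
    show "(1 / C) * (5 - 3 * S z) > 0" if "z \<in> V" for z
      using pos'[OF that] by (auto simp: zero_less_divide_iff)
  qed
  have eq_h: "(1 + S z) * (((1 / C) * (5 - 3 * S z)) powr (-5/6)) = h z" if "z \<in> V" for z
  proof -
    have "(1 / C) * (5 - 3 * S z) = (C / (5 - 3 * S z)) powr (-1)"
    proof -
      have "r powr (-1) = 1 / r" if "r > 0" for r :: real
        using that by (simp add: powr_minus_divide)
      from this[OF pos'[OF that]] show ?thesis by simp
    qed
    moreover have "((C / (5 - 3 * S z)) powr (-1)) powr (-5/6) = (C / (5 - 3 * S z)) powr (5/6)"
      by (simp only: powr_powr) simp
    ultimately show ?thesis by (simp only: h_def)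
  qed
  show "smooth_on V h"
    by (rule smooth_on_cong[OF open_V eq_h, THEN iffD1, OF _ sm_h])
  fix z assume z: "z \<in> V"
  show "radial_point z (f z) (f1 z) (h z) (h1 z) (\<mu> z)"
  proof
    show "h z > 0"
      unfolding h_def using pos'[OF z] S_nonneg[of z]
      by (intro mult_pos_pos powr_gt_zero[THEN iffD2]) linarith+
    show "\<mu> z > 0"
    proof -
      have "\<mu> z = p z / (5 - 3 * S z) / (1 + S z)" by (simp add: \<mu>_def mult.commute)
      then show ?thesis using divide_pos_pos[OF orient'[OF z], of "1 + S z"] S_nonneg[of z] by simp
    qed
    show "f z + f1 z * (z \<bullet> z) = \<mu> z * (1 + (f z)\<^sup>2 * (z \<bullet> z)) * (5 - 3 * ((f z)\<^sup>2 * (z \<bullet> z)))"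
      using S_ne[OF z] S_nonneg[of z] by (simp add: \<mu>_def p_def flip: S_def)
  qed (simp_all add: f_pos z h1_def S_def)
qed (simp_all add: open_V smooth_f der_f has_derivative_h)

sublocale radial_chart V f f1 h h1 \<mu>
  by (rule radial_chart)

definition t :: "quat \<Rightarrow> real" where "t z = (1 + S z) powr (-1/2) * h z"

lemma t_pos: "z \<in> V \<Longrightarrow> t z > 0"
  unfolding t_def h_def using pos'[of z] S_nonneg[of z]
  by (intro mult_pos_pos powr_gt_zero[THEN iffD2]) linarith+

lemma t_powr:
  assumes "z \<in> V"
  shows "t z powr (6/5) = (1 + S z) powr (3/5) * (C / (5 - 3 * S z))"
proof -
  have *: "1 + S z > 0" "C / (5 - 3 * S z) > 0"
    using S_nonneg[of z] pos'[OF assms] by auto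
  then have "t z = (1 + S z) powr (1/2) * (C / (5 - 3 * S z)) powr (5/6)"
    using powr_add[of "1 + S z" "-1/2" 1] by (simp add: t_def h_def)
  moreover have "(a powr (1/2) * c powr (5/6)) powr (6/5) = a powr (3/5) * c" if "a > 0" "c > 0" for a c :: real
    using that by (simp add: powr_mult powr_powr)
  ultimately show ?thesis using * by simp
qed

text \<open>On a level \<open>C \<noteq> 0\<close> the level equation determines |q2| from x = q1 /
  |q2|, and positivity of |q2|^(6/5) is the sign condition on 5 - 3 |x|^2. So a point of the fibre
  is known once \<open>x\<close> is.\<close>

lemma fibre_eq_image:
  assumes b: "b \<noteq> 0" "ln (norm b) = C"
  shows "fibre b = (\<lambda>z. triv (stereo_gauge (qdiag (qreal 1) ((1 / norm b) *\<^sub>R b))) (\<psi> z)) ` V" (is "_ = ?\<phi> ` V")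
proof -
  let ?v = "(1 / norm b) *\<^sub>R b"
  have v: "?v \<in> Sp1" using b by (simp add: Sp1_def)
  have hc: "hom_coord (?\<phi> z) = t z *\<^sub>R (f z *\<^sub>R z, ?v)" if "z \<in> V" for z
    using hom_coord_radial[OF that] by (simp add: t_def S_def)
  have mem: "?\<phi> z \<in> M0" if "z \<in> V" for z
  proof -
    have "snd (\<psi> z) $ 0 \<noteq> 0"
      using radial_point.h_pos[OF radial[OF that]] by (simp add: \<psi>_def qreal_def)
    then have "snd (\<psi> z) \<noteq> 0" by auto
    then show ?thesis by (rule triv_gauge_in_M0[OF qdiag_in_Sp2[OF v], THEN iffD2])
  qed
  show ?thesis
  proof (intro equalityI subsetI)
    fix P assume "P \<in> ?\<phi> ` V"
    then obtain z where z: "z \<in> V" "P = ?\<phi> z" by blast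
    have "t z powr (6/5) * (5 - 3 * S z) / (1 + S z) powr (3/5) = C"
      unfolding t_powr[OF z(1)] using S_ne[OF z(1)] S_nonneg[of z] by simp
    with z show "P \<in> fibre b"
      unfolding fibre_nonzero[OF b(1)] b(2) using mem hc t_pos S_eq by metis
  next
    fix P assume "P \<in> fibre b"
    then obtain s x where P: "P \<in> M0" "s > 0" "hom_coord P = s *\<^sub>R (x, ?v)"
      and sx: "s powr (6/5) * (5 - 3 * (x \<bullet> x)) / (1 + x \<bullet> x) powr (3/5) = C"
      unfolding fibre_nonzero[OF b(1)] b(2) by blast
    have ne: "5 - 3 * (x \<bullet> x) \<noteq> 0" using sx C_nonzero by auto
    have e: "s powr (6/5) = (1 + x \<bullet> x) powr (3/5) * (C / (5 - 3 * (x \<bullet> x)))"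
      using sx ne one_plus_inner_pos[of x] by (auto simp: field_simps)
    have "0 < s powr (6/5)" "0 < (1 + x \<bullet> x) powr (3/5)"
      using P(2) one_plus_inner_pos[of x] by auto
    then have x: "C / (5 - 3 * (x \<bullet> x)) > 0"
      unfolding e by (rule zero_less_mult_pos)
    define z where "z = inv_f x"
    have z: "z \<in> V" "f z *\<^sub>R z = x"
      using inv_f_V[OF x] f_inv_f[OF x] by (simp_all add: z_def)
    have "t z powr (6/5) = s powr (6/5)"
      unfolding t_powr[OF z(1)] e S_eq z(2) ..
    then have "(t z powr (6/5)) powr (5/6) = (s powr (6/5)) powr (5/6)" by simp
    then have "t z = s" using P(2) t_pos[OF z(1)] by (simp add: powr_powr)
    then have "hom_coord P = hom_coord (?\<phi> z)"
      using P(3) hc[OF z(1)] z(2) by simp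
    then have "P = ?\<phi> z"
      using inj_on_hom_coord P(1) mem[OF z(1)] by (simp add: inj_on_def)
    then show "P \<in> ?\<phi> ` V" using z(1) by blast
  qed
qed

lemma single_chart_fibre:
  assumes b: "b \<noteq> 0" "ln (norm b) = C"
  shows "single_chart V (qdiag (qreal 1) ((1 / norm b) *\<^sub>R b)) \<psi> (fibre b)
    (\<lambda>Q. inv_f ((1 / norm (snd Q)) *\<^sub>R fst Q))"
proof (rule single_chart_radial)
  let ?v = "(1 / norm b) *\<^sub>R b"
  show v: "?v \<in> Sp1" using b by (simp add: Sp1_def)
  then have nv: "norm ?v = 1" by (simp add: Sp1_def)
  show "fibre b = (\<lambda>z. triv (stereo_gauge (qdiag (qreal 1) ?v)) (\<psi> z)) ` V"
    by (rule fibre_eq_image[OF b])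
  have 1: "(1 / norm (snd (r *\<^sub>R (x, ?v)))) *\<^sub>R fst (r *\<^sub>R (x, ?v)) = x" if "r > 0" for r and x :: quat
    using that nv b(1) by simp
  show "inv_f ((1 / norm (snd (((1 + (f z)\<^sup>2 * (z \<bullet> z)) powr (-1/2) * h z) *\<^sub>R (f z *\<^sub>R z, ?v)))) *\<^sub>R
      fst (((1 + (f z)\<^sup>2 * (z \<bullet> z)) powr (-1/2) * h z) *\<^sub>R (f z *\<^sub>R z, ?v))) = z" if "z \<in> V" for z
    using t_pos[OF that] unfolding t_def S_def by (simp only: 1 inv_f_f[OF that])
  show "continuous_on (hom_coord ` fibre b) (\<lambda>Q. inv_f ((1 / norm (snd Q)) *\<^sub>R fst Q))"
  proof (rule continuous_on_compose2[OF continuous_inv_f])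
    have im: "\<exists>z\<in>V. Q = t z *\<^sub>R (f z *\<^sub>R z, ?v)" if "Q \<in> hom_coord ` fibre b" for Q
      using that hom_coord_radial[of _ ?v] unfolding fibre_eq_image[OF b] t_def S_def by auto
    have "snd Q \<noteq> 0" if "Q \<in> hom_coord ` fibre b" for Q
      using im[OF that] t_pos b(1) by (fastforce dest: t_pos)
    then show "continuous_on (hom_coord ` fibre b) (\<lambda>Q. (1 / norm (snd Q)) *\<^sub>R fst Q)"
      by (intro continuous_intros) auto
    show "(\<lambda>Q. (1 / norm (snd Q)) *\<^sub>R fst Q) ` hom_coord ` fibre b \<subseteq> {x. C / (5 - 3 * (x \<bullet> x)) > 0}"
    proof (rule image_subsetI)
      fix Q assume "Q \<in> hom_coord ` fibre b"
      then obtain z where z: "z \<in> V" "Q = t z *\<^sub>R (f z *\<^sub>R z, ?v)" using im by blast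
      then have "(1 / norm (snd Q)) *\<^sub>R fst Q = f z *\<^sub>R z"
        by (simp only: 1[OF t_pos[OF z(1)]])
      then show "(1 / norm (snd Q)) *\<^sub>R fst Q \<in> {x. 0 < C / (5 - 3 * (x \<bullet> x))}"
        using pos'[OF z(1)] by (simp only: S_eq mem_Collect_eq)
    qed
  qed
qed

end

section \<open>Charts for positive, negative and zero level\<close>

lemma inner_less_iff_norm_less: "r \<ge> 0 \<Longrightarrow> (z::quat) \<bullet> z < r \<longleftrightarrow> norm z < sqrt r"
  by (simp add: norm_eq_sqrt_inner)

lemma divide_pos_iff: "c / d > 0 \<longleftrightarrow> (if c > 0 then d > 0 else d < 0)" if "c \<noteq> 0" for c d :: real
  using that by (auto simp: zero_less_divide_iff)

text \<open>Here \<open>p = 1\<close> and 5 - 3 S are both positive, so the identity already has the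
  right orientation.\<close>

lemma conical_chart_pos:
  assumes "C > 0"
  shows "conical_chart (ball 0 (sqrt (5/3))) (\<lambda>z. 1) (\<lambda>z. 0) C (\<lambda>x. x)"
proof -
  have V: "z \<in> ball 0 (sqrt (5/3)) \<longleftrightarrow> 5 - 3 * (z \<bullet> z) > 0" for z :: quat
    using inner_less_iff_norm_less[of "5/3" z] by auto
  have "C / (5 - 3 * s) > 0 \<longleftrightarrow> 5 - 3 * s > 0" for s
    using divide_pos_iff[of C "5 - 3 * s"] assms by simp
  with V assms show ?thesis
    by unfold_locales (auto intro!: smooth_on_const simp: zero_less_divide_iff)
qed

lemma smooth_on_inverse_inner:
  assumes "open V" "\<And>z::quat. z \<in> V \<Longrightarrow> z \<noteq> 0"
  shows "smooth_on V (\<lambda>z. 1 / (z \<bullet> z))"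
proof -
  have "(z \<bullet> z) powr (-1) = 1 / (z \<bullet> z)" for z :: quat
    by (simp add: powr_minus_divide)
  moreover have "smooth_on V (\<lambda>z. (z \<bullet> z) powr (-1))"
    using assms by (intro smooth_on_powr smooth_on_inner smooth_on_id) auto
  ultimately show ?thesis by simp
qed

text \<open>\<open>f z\<close> is the inversion of \<open>z\<close> because the identity would parametrise these fibres with the
  orientation opposite to the Cayley one.\<close>

lemma conical_chart_neg:
  assumes "C < 0"
  shows "conical_chart {z. z \<noteq> 0 \<and> norm z < sqrt (3/5)} (\<lambda>z. 1 / (z \<bullet> z)) (\<lambda>z. - 2 / (z \<bullet> z)\<^sup>2) C
    (\<lambda>x. (1 / (x \<bullet> x)) *\<^sub>R x)"
proof
  let ?V = "{z::quat. z \<noteq> 0 \<and> norm z < sqrt (3/5)}"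
  have V: "z \<in> ?V \<longleftrightarrow> z \<noteq> 0 \<and> 5 * (z \<bullet> z) < 3" for z
    using inner_less_iff_norm_less[of "3/5" z] by auto
  have C: "C / (5 - 3 * s) > 0 \<longleftrightarrow> 3 * s > 5" for s
    using divide_pos_iff[of C "5 - 3 * s"] assms by auto
  have zz: "z \<bullet> z > 0" if "z \<in> ?V" for z using that by simp
  have S: "(1 / (z \<bullet> z))\<^sup>2 * (z \<bullet> z) = 1 / (z \<bullet> z)" if "z \<in> ?V" for z
    using that by (simp add: power2_eq_square)
  have S5: "3 * (1 / (z \<bullet> z)) > 5" if "z \<in> ?V" for z
    using that zz[OF that] unfolding V by (simp add: field_simps)
  show "C \<noteq> 0" using assms by simp
  have "?V = ball 0 (sqrt (3/5)) - {0}" by auto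
  then show o: "open ?V" by (simp only: open_Diff open_ball closed_singleton)
  show "smooth_on ?V (\<lambda>z. 1 / (z \<bullet> z))"
    by (rule smooth_on_inverse_inner[OF o]) simp
  fix z assume z: "z \<in> ?V"
  show "((\<lambda>z. 1 / (z \<bullet> z)) has_derivative (\<lambda>w. - 2 / (z \<bullet> z)\<^sup>2 * (z \<bullet> w))) (at z)"
    using zz[OF z] by (auto intro!: derivative_eq_intros simp: inner_commute power2_eq_square field_simps)
  show "1 / (z \<bullet> z) > 0" using zz[OF z] by simp
  show "C / (5 - 3 * ((1 / (z \<bullet> z))\<^sup>2 * (z \<bullet> z))) > 0"
    unfolding S[OF z] C by (rule S5[OF z])
  have "1 / (z \<bullet> z) + - 2 / (z \<bullet> z)\<^sup>2 * (z \<bullet> z) = - (1 / (z \<bullet> z))"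
    using zz[OF z] by (simp add: power2_eq_square)
  moreover have "- (1 / (z \<bullet> z)) < 0" "5 - 3 * (1 / (z \<bullet> z)) < 0"
    using zz[OF z] S5[OF z] by simp_all
  ultimately show "(1 / (z \<bullet> z) + - 2 / (z \<bullet> z)\<^sup>2 * (z \<bullet> z)) / (5 - 3 * ((1 / (z \<bullet> z))\<^sup>2 * (z \<bullet> z))) > 0"
    unfolding S[OF z] by (simp only: divide_neg_neg)
  show "(1 / (((1 / (z \<bullet> z)) *\<^sub>R z) \<bullet> ((1 / (z \<bullet> z)) *\<^sub>R z))) *\<^sub>R ((1 / (z \<bullet> z)) *\<^sub>R z) = z"
    using zz[OF z] by simp
next
  have C: "C / (5 - 3 * s) > 0 \<longleftrightarrow> 3 * s > 5" for s
    using divide_pos_iff[of C "5 - 3 * s"] assms by auto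
  fix x :: quat assume "C / (5 - 3 * (x \<bullet> x)) > 0"
  then have x: "3 * (x \<bullet> x) > 5" by (simp only: C)
  then have x0: "x \<noteq> 0" "x \<bullet> x > 0" by auto
  then have "((1 / (x \<bullet> x)) *\<^sub>R x) \<bullet> ((1 / (x \<bullet> x)) *\<^sub>R x) < 3/5"
    using x by (simp add: field_simps)
  then show "(1 / (x \<bullet> x)) *\<^sub>R x \<in> {z. z \<noteq> 0 \<and> norm z < sqrt (3/5)}"
    using x0 inner_less_iff_norm_less[of "3/5" "(1 / (x \<bullet> x)) *\<^sub>R x"] by auto
  show "(1 / (((1 / (x \<bullet> x)) *\<^sub>R x) \<bullet> ((1 / (x \<bullet> x)) *\<^sub>R x))) *\<^sub>R ((1 / (x \<bullet> x)) *\<^sub>R x) = x"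
    using x0 by simp
next
  have "x \<bullet> x \<noteq> 0" if "C / (5 - 3 * (x \<bullet> x)) > 0" for x :: quat
    using that assms by auto
  then show "continuous_on {x::quat. C / (5 - 3 * (x \<bullet> x)) > 0} (\<lambda>x. (1 / (x \<bullet> x)) *\<^sub>R x)"
    by (intro continuous_intros) auto
qed

text \<open>The factor sqrt (5/3) puts q1 / |q2| on the sphere S = 5/3. The factor sqrt (8/5) in
  \<open>cone_h\<close> normalises the chart so that q1 = z, whence \<open>fst\<close> is its
  inverse.\<close>

definition cone_f :: "quat \<Rightarrow> real" where "cone_f z = sqrt (5/3) * (z \<bullet> z) powr (-1/2)"
definition cone_h :: "quat \<Rightarrow> real" where "cone_h z = sqrt (8/5) * (z \<bullet> z) powr (1/2)"

lemma cone_facts: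
  assumes "z \<noteq> (0::quat)"
  shows "cone_f z = sqrt (5/3) / norm z" "cone_h z = sqrt (8/5) * norm z"
    "(cone_f z)\<^sup>2 * (z \<bullet> z) = 5/3"
proof -
  have "(z \<bullet> z) powr (1/2) = norm z"
    using assms by (simp add: powr_half_sqrt norm_eq_sqrt_inner)
  then show f: "cone_f z = sqrt (5/3) / norm z" and "cone_h z = sqrt (8/5) * norm z"
    using assms by (simp_all add: cone_f_def cone_h_def powr_minus_divide)
  show "(cone_f z)\<^sup>2 * (z \<bullet> z) = 5/3"
    using assms by (simp add: f power_mult_distrib power_divide dot_square_norm)
qed

lemma has_derivative_powr_inner:
  assumes "z \<noteq> (0::quat)"
  shows "((\<lambda>z. (z \<bullet> z) powr c) has_derivative (\<lambda>w. 2 * c * (z \<bullet> z) powr (c - 1) * (z \<bullet> w))) (at z)"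
proof -
  have "((\<lambda>z. z \<bullet> z) has_derivative (\<lambda>w. 2 * (z \<bullet> w))) (at z)"
    by (auto intro!: derivative_eq_intros simp: inner_commute)
  moreover have "((\<lambda>t. t powr c) has_real_derivative c * (z \<bullet> z) powr (c - 1)) (at (z \<bullet> z))"
    using assms by (intro has_real_derivative_powr) simp
  ultimately have "((\<lambda>z. (z \<bullet> z) powr c) has_derivative (\<lambda>w. c * (z \<bullet> z) powr (c - 1) * (2 * (z \<bullet> w)))) (at z)"
    unfolding has_field_derivative_def by (rule has_derivative_compose)
  then show ?thesis by (simp add: mult_ac)
qed

text \<open>\<open>S\<close> is constantly 5/3, so both sides of the equation for \<open>p\<close>
  vanish. The value of \<mu> is forced by \<open>h1 = h / |z|^2\<close> and 15 - 5/3 = 40/3.\<close>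

lemma radial_chart_cone:
  "radial_chart (- {0}) cone_f (\<lambda>z. - cone_f z / (z \<bullet> z)) cone_h (\<lambda>z. cone_h z / (z \<bullet> z))
     (\<lambda>z. 3 / (40 * (z \<bullet> z) * cone_f z))"
proof (rule radial_chart.intro)
  show o: "open (- {0::quat})" by (simp add: open_Compl)
  show "smooth_on (- {0}) cone_f" "smooth_on (- {0}) cone_h"
    unfolding cone_f_def[abs_def] cone_h_def[abs_def]
    by (intro smooth_on_mult smooth_on_const smooth_on_powr smooth_on_inner smooth_on_id o; simp)+
  fix z :: quat assume "z \<in> - {0}"
  then have z: "z \<noteq> 0" "z \<bullet> z > 0" "norm z > 0" by auto
  have p: "(z \<bullet> z) powr (c - 1) = (z \<bullet> z) powr c / (z \<bullet> z)" for c
    using z(2) by (simp add: powr_diff)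
  show "(cone_f has_derivative (\<lambda>w. - cone_f z / (z \<bullet> z) * (z \<bullet> w))) (at z)"
    unfolding cone_f_def[abs_def]
    using has_derivative_mult_right[OF has_derivative_powr_inner[OF z(1), of "-1/2"], of "sqrt (5/3)"]
    unfolding p by (simp add: mult_ac)
  show "(cone_h has_derivative (\<lambda>w. cone_h z / (z \<bullet> z) * (z \<bullet> w))) (at z)"
    unfolding cone_h_def[abs_def]
    using has_derivative_mult_right[OF has_derivative_powr_inner[OF z(1), of "1/2"], of "sqrt (8/5)"]
    unfolding p by (simp add: mult_ac)
  have f: "cone_f z > 0" and h: "cone_h z > 0" using z by (simp_all add: cone_facts)
  show "radial_point z (cone_f z) (- cone_f z / (z \<bullet> z)) (cone_h z) (cone_h z / (z \<bullet> z)) (3 / (40 * (z \<bullet> z) * cone_f z))"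
    by unfold_locales (use z f h in \<open>simp_all add: cone_facts(3)[OF z(1)]\<close>)
qed

interpretation cone: radial_chart "- {0}" cone_f "\<lambda>z. - cone_f z / (z \<bullet> z)" cone_h "\<lambda>z. cone_h z / (z \<bullet> z)"
    "\<lambda>z. 3 / (40 * (z \<bullet> z) * cone_f z)"
  by (rule radial_chart_cone)

lemma single_chart_cone:
  assumes b: "norm b = 1"
  shows "single_chart (- {0}) (qdiag (qreal 1) b) cone.\<psi> (fibre b) fst"
proof -
  have v: "b \<in> Sp1" using b by (simp add: Sp1_def)
  have b0: "b \<noteq> 0" using b by auto
  let ?\<phi> = "\<lambda>z. triv (stereo_gauge (qdiag (qreal 1) b)) (cone.\<psi> z)"
  have hc: "hom_coord (?\<phi> z) = (sqrt (3/5) * norm z) *\<^sub>R (cone_f z *\<^sub>R z, b)" if "z \<noteq> 0" for z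
  proof -
    have "sqrt (3/5) = (8/3) powr (-1/2) * sqrt (8/5)"
      by (simp add: powr_minus_divide powr_half_sqrt real_sqrt_divide field_simps flip: real_sqrt_mult)
    moreover have "z \<in> - {0}" using that by simp
    moreover have "(1 + 5/3) = (8/3 :: real)" by simp
    ultimately show ?thesis
      by (simp only: cone.hom_coord_radial cone_facts(3)[OF that] cone_facts(2)[OF that] mult.assoc)
  qed
  have mem: "?\<phi> z \<in> M0" if "z \<noteq> 0" for z
  proof -
    have "snd (cone.\<psi> z) $ 0 \<noteq> 0"
      using that by (simp add: cone.\<psi>_def qreal_def cone_facts)
    then have "snd (cone.\<psi> z) \<noteq> 0" by auto
    then show ?thesis by (rule triv_gauge_in_M0[OF qdiag_in_Sp2[OF v], THEN iffD2])
  qed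
  have ff: "(cone_f z *\<^sub>R z) \<bullet> (cone_f z *\<^sub>R z) = 5/3" if "z \<noteq> 0" for z
    using cone_facts(3)[OF that] by (simp add: power2_eq_square)
  have one: "sqrt (3/5) * norm z * cone_f z = 1" if "z \<noteq> 0" for z
    using that by (simp add: cone_facts flip: real_sqrt_mult)
  have im: "fibre b = ?\<phi> ` (- {0})"
  proof (intro equalityI subsetI)
    fix P assume "P \<in> ?\<phi> ` (- {0})"
    then obtain z where z: "z \<noteq> 0" "P = ?\<phi> z" by blast
    have "sqrt (3/5) * norm z > 0" using z(1) by simp
    then show "P \<in> fibre b"
      unfolding fibre_nonzero[OF b0] b z(2) using mem[OF z(1)] hc[OF z(1)] ff[OF z(1)]
      by (intro conjI exI[of _ "sqrt (3/5) * norm z"] exI[of _ "cone_f z *\<^sub>R z"]) simp_all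
  next
    fix P assume "P \<in> fibre b"
    then obtain s x where P: "P \<in> M0" "s > 0" "hom_coord P = s *\<^sub>R (x, b)"
      and sx: "s powr (6/5) * (5 - 3 * (x \<bullet> x)) / (1 + x \<bullet> x) powr (3/5) = 0"
      unfolding fibre_nonzero[OF b0] b by auto
    have xx: "x \<bullet> x = 5/3" using sx P(2) one_plus_inner_pos(2)[of x] by auto
    then have nx: "norm x = sqrt (5/3)" by (simp add: norm_eq_sqrt_inner)
    have z: "s *\<^sub>R x \<noteq> 0" using P(2) xx by auto
    have "cone_f (s *\<^sub>R x) * s = 1"
      unfolding cone_facts(1)[OF z] using P(2) by (simp add: nx)
    moreover have "sqrt (3/5) * norm (s *\<^sub>R x) = s"
      using P(2) by (simp add: nx flip: real_sqrt_mult)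
    ultimately have "hom_coord (?\<phi> (s *\<^sub>R x)) = hom_coord P"
      unfolding hc[OF z] P(3) by simp
    then have "P = ?\<phi> (s *\<^sub>R x)"
      using inj_on_hom_coord P(1) mem[OF z] by (simp add: inj_on_def)
    then show "P \<in> ?\<phi> ` (- {0})" using z by blast
  qed
  show ?thesis
  proof (rule cone.single_chart_radial[OF v im])
    show "continuous_on (hom_coord ` fibre b) fst" by (intro continuous_intros)
    fix z :: quat assume "z \<in> - {0}"
    then have z: "z \<noteq> 0" by simp
    show "fst (((1 + (cone_f z)\<^sup>2 * (z \<bullet> z)) powr (-1/2) * cone_h z) *\<^sub>R (cone_f z *\<^sub>R z, b)) = z"
      using hc[OF z] one[OF z] unfolding cone.hom_coord_radial[OF \<open>z \<in> - {0}\<close>] by simp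
  qed
qed

text \<open>This fibre is a punctured fibre of the vector bundle, over the point
  \<open>y = 0\<close> of the gauge of \<open>qswap\<close>. All base forms vanish on it, and both
  sides of the calibration condition reduce to 16 r^(-8/5).\<close>

lemma single_chart_zero: "single_chart (- {0}) qswap (Pair 0) (fibre 0) (\<lambda>Q. qcnj (fst Q))"
proof
  show o: "open (- {0::quat})" by (simp add: open_Compl)
  show "smooth_on (- {0}) (Pair (0::quat) :: quat \<Rightarrow> _)"
    by (intro smooth_on_Pair smooth_on_const smooth_on_id o)
  show "qswap \<in> Sp2" by (rule qswap_in_Sp2)
  have hc: "hom_coord (triv (stereo_gauge qswap) (0, z)) = (qcnj z, 0)" for z
    by (simp add: hom_coord_triv_gauge_simps)
  have d: "frechet_derivative (Pair (0::quat)) (at z) = Pair 0" for z :: quat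
    by (rule frechet_derivative_at[symmetric])
      (intro bounded_linear_imp_has_derivative bounded_linear_Pair bounded_linear_zero bounded_linear_ident)
  show "inj (frechet_derivative (Pair (0::quat)) (at z))" for z :: quat
    unfolding d by (simp add: inj_def)
  show "fibre 0 = (\<lambda>z. triv (stereo_gauge qswap) (0, z)) ` (- {0})"
  proof (intro equalityI subsetI)
    fix P assume "P \<in> fibre 0"
    then have P: "P \<in> M0" "snd (hom_coord P) = 0" by (simp_all add: fibre_0)
    define z where "z = qcnj (fst (hom_coord P))"
    have z: "z \<noteq> 0" using hom_coord_M0_nonzero[OF P(1)] P(2) by (auto simp: z_def prod_eq_iff)
    have "hom_coord (triv (stereo_gauge qswap) (0, z)) = hom_coord P"
      unfolding hc using P(2) by (simp add: z_def prod_eq_iff)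
    then have "P = triv (stereo_gauge qswap) (0, z)"
      using inj_on_hom_coord P(1) z triv_gauge_in_M0[OF qswap_in_Sp2, of "(0, z)"] by (simp add: inj_on_def)
    then show "P \<in> (\<lambda>z. triv (stereo_gauge qswap) (0, z)) ` (- {0})" using z by blast
  qed (auto simp: fibre_0 hc triv_gauge_in_M0 qswap_in_Sp2)
  show "continuous_on (hom_coord ` fibre 0) (\<lambda>Q. qcnj (fst Q))"
    by (intro bounded_linear.continuous_on[OF bounded_linear_qcnj] continuous_intros)
  show "qcnj (fst (hom_coord (triv (stereo_gauge qswap) (0, z)))) = z" for z
    by (simp add: hc)
  fix z :: quat assume "z \<in> - {0}"
  then have r: "norm z > 0" by simp
  have xi: "vert_form conn (0, z) i (0, w) = w $ i" for i w
  proof -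
    have "i = 0 \<or> i = 1 \<or> i = 2 \<or> i = 3"
      using UNIV_4' UNIV_I[of i] by blast
    then show ?thesis by (auto simp: vert_form_def conn_def)
  qed
  have b: "base_form (stereo_gauge qswap) (0, z) i (0, w) = 0" for i and w :: quat
    by (simp add: base_form_gauge qswap_in_Sp2)
  define R where "R = norm z powr (-4/5)"
  have R: "R > 0" using r by (simp add: R_def)
  have R2: "norm z powr (-8/5) = R\<^sup>2"
    unfolding R_def power2_eq_square powr_add[symmetric] by simp
  have "Phi0 (stereo_gauge qswap) conn (0, z) (0, axis 0 1) (0, axis 1 1) (0, axis 2 1) (0, axis 3 1) = 16 * R\<^sup>2"
    unfolding Phi0_def Let_def snd_conv R2
    by (simp add: vol_form_def wedge22_def wedge11_def asd_form_def xi b axis4_nth)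
  \<comment> \<open>A vanishing rank-one term is added to match
    \<open>det_scalar_plus_rank_one\<close>.\<close>
  moreover have "(\<chi> i j. metric0 (stereo_gauge qswap) conn (0, z) (0, axis i 1) (0, axis j 1)) =
      (\<chi> i j. (4 * R) * (axis i 1 \<bullet> (axis j 1 :: quat)) + 0 * ((0::quat) $ i) * ((0::quat) $ j))"
    unfolding metric0_def Let_def by (simp add: R_def xi b sum_4' quat_inner)
  then have "det (\<chi> i j. metric0 (stereo_gauge qswap) conn (0, z) (0, axis i 1) (0, axis j 1)) =
      (4 * R) ^ 3 * (4 * R + 0 * ((0::quat) \<bullet> 0))"
    by (simp only: det_scalar_plus_rank_one)
  then have "det (\<chi> i j. metric0 (stereo_gauge qswap) conn (0, z) (0, axis i 1) (0, axis j 1)) = (16 * R\<^sup>2)\<^sup>2"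
    by (simp add: power2_eq_square power3_eq_cube)
  ultimately show "let e = (\<lambda>i. frechet_derivative (Pair 0) (at z) (axis i 1)) in
         Phi0 (stereo_gauge qswap) conn (0, z) (e 0) (e 1) (e 2) (e 3) =
         sqrt (det (\<chi> i j. metric0 (stereo_gauge qswap) conn (0, z) (e i) (e j)))"
    unfolding d Let_def by (simp only: real_sqrt_abs) simp
qed simp

text \<open>Since ln |b| is the level, the cases are the exceptional fibre, the cone, and positive
  and negative level. Only fibres of positive level contain points with q1 = 0, where the orbit of
  the group collapses; this fills in the puncture and gives a 4-ball.\<close>

lemma fibre_charts:
  "Cayley (fibre b) \<and>
    (if norm b > 1 then subtopology M0_top (fibre b) homeomorphic_space (euclidean :: (real^4) topology)
     else subtopology M0_top (fibre b) homeomorphic_space S3_times_R)"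
proof -
  consider "b = 0" | "norm b = 1" | "norm b > 1" | "b \<noteq> 0" "norm b < 1" by fastforce
  then show ?thesis
  proof cases
    case 1
    interpret single_chart "- {0}" qswap "Pair 0" "fibre 0" "\<lambda>Q. qcnj (fst Q)"
      by (rule single_chart_zero)
    show ?thesis
      using 1 Cayley_chart homeomorphic_space_trans[OF homeomorphic_space_chart punctured_space_homeomorphic_S3_times_R]
      by simp
  next
    case 2
    interpret single_chart "- {0}" "qdiag (qreal 1) b" cone.\<psi> "fibre b" fst
      by (rule single_chart_cone[OF 2])
    show ?thesis
      using 2 Cayley_chart homeomorphic_space_trans[OF homeomorphic_space_chart punctured_space_homeomorphic_S3_times_R]
      by simp
  next
    case 3
    then have b: "b \<noteq> 0" "ln (norm b) > 0" by (auto intro: ln_gt_zero)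
    note sc = conical_chart.single_chart_fibre[OF conical_chart_pos[OF b(2)] b(1) refl]
    show ?thesis
      using 3 single_chart.Cayley_chart[OF sc]
        homeomorphic_space_trans[OF single_chart.homeomorphic_space_chart[OF sc] ball_homeomorphic_euclidean]
      by simp
  next
    case 4
    then have b: "ln (norm b) < 0" by simp
    note sc = conical_chart.single_chart_fibre[OF conical_chart_neg[OF b] 4(1) refl]
    show ?thesis
      using 4 single_chart.Cayley_chart[OF sc]
        homeomorphic_space_trans[OF single_chart.homeomorphic_space_chart[OF sc] punctured_ball_homeomorphic_S3_times_R]
      by simp
  qed
qed

section \<open>The projection\<close>

lemma spin_chart_at:
  assumes "p \<in> M0" "snd (hom_coord p) \<noteq> 0"
  shows "triv (stereo_gauge qone) (chart_coord (hom_coord p)) = p"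
  using inj_onD[OF inj_on_hom_coord chart_coord_inverse(1)[OF assms(2)] _ assms(1)] assms(2)
  by (simp add: triv_gauge_in_M0 qone_in_Sp2 snd_chart_coord)

lemma spin_chart_at_swap:
  assumes "p \<in> M0" "fst (hom_coord p) \<noteq> 0"
  shows "triv (stereo_gauge qswap) (chart_coord (prod.swap (hom_coord p))) = p"
proof -
  have "snd (prod.swap (hom_coord p)) \<noteq> 0" using assms(2) by simp
  from inj_onD[OF inj_on_hom_coord _ _ assms(1), of "triv (stereo_gauge qswap) (chart_coord (prod.swap (hom_coord p)))"]
    chart_coord_inverse(2)[OF this] this
  show ?thesis by (simp add: triv_gauge_in_M0 qswap_in_Sp2 snd_chart_coord)
qed

text \<open>The level in the coordinates of the gauge of \<open>qone\<close>. From |q2| = |a| (1 +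
  |y|^2)^(-1/2) the factor 1 + |y|^2 gets the exponent -3/5 - 3/5.\<close>

definition log_norm :: "quat \<times> quat \<Rightarrow> real" where
  "log_norm z = (snd z \<bullet> snd z) powr (3/5) *
     ((5 - 3 * (fst z \<bullet> fst z)) * (1 + fst z \<bullet> fst z) powr (-6/5))"

definition unit_part :: "quat \<times> quat \<Rightarrow> quat" where
  "unit_part z = (snd z \<bullet> snd z) powr (-1/2) *\<^sub>R qcnj (snd z)"

lemma fibre_map_triv:
  assumes "a \<noteq> 0"
  shows "fibre_map (triv (stereo_gauge qone) (y, a)) = exp (log_norm (y, a)) *\<^sub>R unit_part (y, a)"
proof -
  define n where "n = 1 + y \<bullet> y"
  have n: "n > 0" by (simp add: n_def one_plus_inner_pos)
  have na: "norm a > 0" using assms by simp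
  define u where "u = (1 / norm a) *\<^sub>R qcnj a"
  have u: "u \<in> Sp1" using assms by (simp add: u_def Sp1_def)
  have uu: "norm u = 1" using u by (simp add: Sp1_def)
  have a: "qcnj a = norm a *\<^sub>R u" using na by (simp add: u_def)
  have t: "n powr (-1/2) * norm a > 0" using n na by simp
  have "hom_coord (triv (stereo_gauge qone) (y, a)) = (n powr (-1/2) * norm a) *\<^sub>R (y \<odot> u, u)"
    unfolding hom_coord_triv_gauge_simps n_def[symmetric] a by (simp add: qmul_scaleR)
  note fm = fibre_map_scaleR[OF t u this]
  have S: "(y \<odot> u) \<bullet> (y \<odot> u) = y \<bullet> y"
    using uu by (simp add: inner_qmul_qmul norm_eq_1)
  have naa: "(a \<bullet> a) powr c = norm a powr (2 * c)" for c
  proof -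
    have "a \<bullet> a = norm a powr 2" using na by (simp add: dot_square_norm)
    then show ?thesis unfolding powr_powr[symmetric] by (simp only:)
  qed
  have "(n powr (-1/2) * norm a) powr (6/5) * (5 - 3 * (y \<bullet> y)) / n powr (3/5) = log_norm (y, a)"
  proof -
    have "(n powr (-1/2) * norm a) powr (6/5) = n powr (-3/5) * norm a powr (6/5)"
      using n na by (simp add: powr_mult powr_powr)
    moreover have "n powr (-3/5) / n powr (3/5) = n powr (-6/5)"
      by (simp flip: powr_diff)
    moreover have "p * q * r / s = q * (r * (p / s))" for p q r s :: real by simp
    ultimately show ?thesis
      by (simp only: log_norm_def snd_conv fst_conv naa flip: n_def) simp
  qed
  moreover have "unit_part (y, a) = u"
    unfolding unit_part_def snd_conv naa u_def using na by (simp add: powr_minus_divide)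
  ultimately show ?thesis
    unfolding fm S n_def[symmetric] by simp
qed

lemma has_derivative_log_norm:
  fixes a y :: quat
  assumes "a \<noteq> 0"
  defines "K \<equiv> (a \<bullet> a) powr (3/5) * (1 + y \<bullet> y) powr (-6/5)"
  shows "(log_norm has_derivative (\<lambda>w. K * (6/5 * (a \<bullet> snd w) / (a \<bullet> a) * (5 - 3 * (y \<bullet> y)) -
     6 * (y \<bullet> fst w) - 12/5 * (y \<bullet> fst w) * (5 - 3 * (y \<bullet> y)) / (1 + y \<bullet> y)))) (at (y, a))"
proof -
  define n where "n = 1 + y \<bullet> y"
  have n: "n > 0" by (simp add: n_def one_plus_inner_pos)
  have m: "a \<bullet> a > 0" using assms(1) by simp
  have A: "((\<lambda>z. (snd z \<bullet> snd z) powr (3/5)) has_derivative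
      (\<lambda>w. (3/5 * (a \<bullet> a) powr (3/5 - 1)) * (2 * (a \<bullet> snd w)))) (at (y, a))"
  proof -
    have "((\<lambda>z. snd z \<bullet> snd z) has_derivative (\<lambda>w. 2 * (a \<bullet> snd w))) (at (y, a))"
      by (auto intro!: derivative_eq_intros simp: inner_commute)
    moreover have "((\<lambda>t. t powr (3/5)) has_derivative (*) (3/5 * (a \<bullet> a) powr (3/5 - 1))) (at (snd (y, a) \<bullet> snd (y, a)))"
      using has_real_derivative_powr[OF m, of "3/5"] by (simp add: has_field_derivative_def)
    ultimately show ?thesis by (rule has_derivative_compose)
  qed
  have B: "((\<lambda>z. 1 + fst z \<bullet> fst z) has_derivative (\<lambda>w. 2 * (y \<bullet> fst w))) (at (y, a))"
    by (auto intro!: derivative_eq_intros simp: inner_commute)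
  have C: "((\<lambda>z. (1 + fst z \<bullet> fst z) powr (-6/5)) has_derivative
      (\<lambda>w. (-6/5 * n powr (-6/5 - 1)) * (2 * (y \<bullet> fst w)))) (at (y, a))"
  proof (rule has_derivative_compose[OF B])
    show "((\<lambda>t. t powr (-6/5)) has_derivative (*) (-6/5 * n powr (-6/5 - 1))) (at (1 + fst (y, a) \<bullet> fst (y, a)))"
      using has_real_derivative_powr[OF n, of "-6/5"] by (simp add: has_field_derivative_def n_def)
  qed
  have D: "((\<lambda>z. 5 - 3 * (fst z \<bullet> fst z)) has_derivative (\<lambda>w. - 6 * (y \<bullet> fst w))) (at (y, a))"
    by (auto intro!: derivative_eq_intros simp: inner_commute)
  have p: "(a \<bullet> a) powr (3/5 - 1) = (a \<bullet> a) powr (3/5) / (a \<bullet> a)" "n powr (-6/5 - 1) = n powr (-6/5) / n"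
    using m n unfolding powr_diff by simp_all
  show ?thesis
    unfolding log_norm_def[abs_def]
    by (rule has_derivative_eq_rhs[OF has_derivative_mult[OF A[unfolded p] has_derivative_mult[OF D C[unfolded p]]]])
      (simp add: fun_eq_iff K_def algebra_simps add_divide_distrib diff_divide_distrib flip: n_def)
qed

lemma has_derivative_unit_part:
  assumes "a \<noteq> 0"
  shows "(unit_part has_derivative (\<lambda>w. (a \<bullet> a) powr (-1/2) *\<^sub>R
     (qcnj (snd w) - ((a \<bullet> snd w) / (a \<bullet> a)) *\<^sub>R qcnj a))) (at (y, a))"
proof -
  have m: "a \<bullet> a > 0" using assms(1) by simp
  have A: "((\<lambda>z. (snd z \<bullet> snd z) powr (-1/2)) has_derivative
      (\<lambda>w. (-1/2 * (a \<bullet> a) powr (-1/2 - 1)) * (2 * (a \<bullet> snd w)))) (at (y, a))"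
  proof -
    have "((\<lambda>z. snd z \<bullet> snd z) has_derivative (\<lambda>w. 2 * (a \<bullet> snd w))) (at (y, a))"
      by (auto intro!: derivative_eq_intros simp: inner_commute)
    moreover have "((\<lambda>t. t powr (-1/2)) has_derivative (*) (-1/2 * (a \<bullet> a) powr (-1/2 - 1))) (at (snd (y, a) \<bullet> snd (y, a)))"
      using has_real_derivative_powr[OF m, of "-1/2"] by (simp add: has_field_derivative_def)
    ultimately show ?thesis by (rule has_derivative_compose)
  qed
  have B: "((\<lambda>z. qcnj (snd z)) has_derivative (\<lambda>w. qcnj (snd w))) (at (y, a))"
    by (intro bounded_linear.has_derivative[OF bounded_linear_qcnj] has_derivative_snd has_derivative_ident)
  have p: "(a \<bullet> a) powr (-1/2 - 1) = (a \<bullet> a) powr (-1/2) / (a \<bullet> a)"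
    using m unfolding powr_diff by simp
  show ?thesis
    unfolding unit_part_def[abs_def]
    by (rule has_derivative_eq_rhs[OF has_derivative_scaleR[OF A[unfolded p] B]])
      (simp add: fun_eq_iff scaleR_diff_right)
qed

text \<open>In polar coordinates on the target, directions are reached by varying \<open>a\<close>.
  The radius is reached by scaling \<open>a\<close> where the level is nonzero, and on the cone by
  moving \<open>y\<close> across it; the latter works because \<open>level\<close> has a simple zero
  there.\<close>

lemma surj_derivative_polar:
  assumes "a \<noteq> 0"
  shows "surj (frechet_derivative (\<lambda>z. exp (log_norm z) *\<^sub>R unit_part z) (at (y, a)))"
proof -
  define s where "s = 5 - 3 * (y \<bullet> y)"
  define n where "n = 1 + y \<bullet> y"
  define m where "m = a \<bullet> a"
  define K where "K = m powr (3/5) * n powr (-6/5)"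
  define r where "r = m powr (-1/2)"
  define E where "E = exp (log_norm (y, a))"
  define L where "L w = K * (6/5 * (a \<bullet> snd w) / m * s - 6 * (y \<bullet> fst w) - 12/5 * (y \<bullet> fst w) * s / n)"
    for w :: "quat \<times> quat"
  define U where "U w = r *\<^sub>R (qcnj (snd w) - ((a \<bullet> snd w) / m) *\<^sub>R qcnj a)" for w :: "quat \<times> quat"
  have m: "m > 0" using assms by (simp add: m_def)
  have n: "n > 0" by (simp add: n_def one_plus_inner_pos)
  have pos: "K > 0" "r > 0" "E > 0" using m n by (simp_all add: K_def r_def E_def)
  have "(log_norm has_derivative L) (at (y, a))" "(unit_part has_derivative U) (at (y, a))"
    using has_derivative_log_norm[OF assms, of y] has_derivative_unit_part[OF assms, of y]
    by (simp_all add: L_def[abs_def] U_def[abs_def] s_def n_def m_def K_def r_def)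
  from has_derivative_scaleR[OF has_derivative_exp[OF this(1)] this(2)]
  have "((\<lambda>z. exp (log_norm z) *\<^sub>R unit_part z) has_derivative
      (\<lambda>w. E *\<^sub>R U w + (E * L w) *\<^sub>R (r *\<^sub>R qcnj a))) (at (y, a))"
    by (simp add: E_def unit_part_def r_def m_def mult.commute)
  then have fd: "frechet_derivative (\<lambda>z. exp (log_norm z) *\<^sub>R unit_part z) (at (y, a)) =
      (\<lambda>w. E *\<^sub>R U w + (E * L w) *\<^sub>R (r *\<^sub>R qcnj a))"
    by (rule frechet_derivative_at[symmetric])
  have "\<exists>w. E *\<^sub>R U w + (E * L w) *\<^sub>R (r *\<^sub>R qcnj a) = e" for e
  proof -
    define b where "b = (1 / (E * r)) *\<^sub>R qcnj e"
    have e: "e = (E * r) *\<^sub>R qcnj b" using pos by (simp add: b_def qcnj_scaleR)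
    \<comment> \<open>\<open>U\<close> misses exactly the component (a \<bullet> b) / m of
      \<open>b\<close> along \<open>a\<close>, and it does not change under \<nu> and \<mu>. These
      parameters are therefore free to make \<open>L\<close> supply that component.\<close>
    obtain \<nu> \<mu> where L: "L (\<nu> *\<^sub>R y, b + \<mu> *\<^sub>R a) = (a \<bullet> b) / m"
    proof (cases "s = 0")
      case True
      \<comment> \<open>On the cone the derivative of the level along \<open>y\<close> is -6 K |y|^2
        = -10 K, the source of the 10.\<close>
      then have "y \<bullet> y = 5/3" by (simp add: s_def)
      then have "L ((- ((a \<bullet> b) / m / (10 * K))) *\<^sub>R y, b + 0 *\<^sub>R a) =
          K * (6/5 * (a \<bullet> (b + 0 *\<^sub>R a)) / m * 0 - 6 * (- ((a \<bullet> b) / m / (10 * K)) * (5/3)) -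
            12/5 * (- ((a \<bullet> b) / m / (10 * K)) * (5/3)) * 0 / n)"
        by (simp only: L_def True fst_conv snd_conv inner_scaleR_right)
      also have "\<dots> = (a \<bullet> b) / m" using pos(1) by simp
      finally have "L ((- ((a \<bullet> b) / m / (10 * K))) *\<^sub>R y, b + 0 *\<^sub>R a) = (a \<bullet> b) / m" .
      then show ?thesis by (rule that)
    next
      case False
      define \<mu> where "\<mu> = (a \<bullet> b) / m / (K * (6/5) * s) - (a \<bullet> b) / m"
      have "L (0 *\<^sub>R y, b + \<mu> *\<^sub>R a) = K * (6/5) * s * ((a \<bullet> b) / m + \<mu>)"
        using m by (simp add: L_def inner_add_right algebra_simps add_divide_distrib flip: m_def)
      also have "\<dots> = (a \<bullet> b) / m"
        unfolding \<mu>_def using pos(1) False by simp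
      finally show ?thesis by (rule that)
    qed
    have U: "U (\<nu> *\<^sub>R y, b + \<mu> *\<^sub>R a) = r *\<^sub>R (qcnj b - ((a \<bullet> b) / m) *\<^sub>R qcnj a)"
      using m by (simp add: U_def inner_add_right qcnj_add qcnj_scaleR add_divide_distrib scaleR_add_left flip: m_def)
    have "E *\<^sub>R U (\<nu> *\<^sub>R y, b + \<mu> *\<^sub>R a) + (E * L (\<nu> *\<^sub>R y, b + \<mu> *\<^sub>R a)) *\<^sub>R (r *\<^sub>R qcnj a) = e"
      unfolding U L e by (simp add: scaleR_diff_right mult_ac)
    then show ?thesis by blast
  qed
  then show ?thesis
    unfolding fd surj_def by metis
qed

lemma smooth_on_polar:
  assumes "open T" "\<And>z. z \<in> T \<Longrightarrow> snd z \<noteq> 0"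
  shows "smooth_on T (\<lambda>z. exp (log_norm z) *\<^sub>R unit_part z)"
  unfolding log_norm_def unit_part_def
  using assms
  by (intro smooth_on_scaleR smooth_on_exp smooth_on_mult smooth_on_powr smooth_on_diff smooth_on_add
      smooth_on_inner smooth_on_fst smooth_on_snd smooth_on_const smooth_on_id
      smooth_on_compose_linear[OF _ bounded_linear_qcnj] one_plus_inner_pos) auto

lemma frechet_derivative_cong:
  assumes "open T" "z \<in> T" "\<And>x. x \<in> T \<Longrightarrow> f x = g x"
  shows "frechet_derivative f (at z) = frechet_derivative g (at z)"
proof -
  have "(f has_derivative D) (at z) \<longleftrightarrow> (g has_derivative D) (at z)" for D
    using assms has_derivative_transform_within_open[of f D z UNIV T g]
      has_derivative_transform_within_open[of g D z UNIV T f] by auto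
  then show ?thesis by (simp add: frechet_derivative_def)
qed

lemma smooth_submersion_gaugeI:
  assumes B: "B \<in> Sp2" and W: "openin M0_top W" and T: "open T" "\<And>z. z \<in> T \<Longrightarrow> snd z \<noteq> 0"
    and G: "\<And>z. z \<in> T \<Longrightarrow> f (triv (stereo_gauge B) z) = G z" "smooth_on T G"
    and surj: "\<And>z. z \<in> T \<Longrightarrow> surj (frechet_derivative G (at z))"
    and cover: "\<And>p. p \<in> W \<Longrightarrow> \<exists>z\<in>T. triv (stereo_gauge B) z = p"
  shows "smooth_submersion W f"
  unfolding smooth_submersion_def
proof (intro conjI ballI W)
  fix p assume "p \<in> W"
  then obtain z where z: "z \<in> T" "triv (stereo_gauge B) z = p" using cover by blast
  have "smooth_on T (\<lambda>x. f (triv (stereo_gauge B) x))"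
    by (rule smooth_on_cong[OF T(1), THEN iffD2, OF G(1) G(2)])
  moreover have "surj (frechet_derivative (\<lambda>x. f (triv (stereo_gauge B) x)) (at z))"
    using surj[OF z(1)] frechet_derivative_cong[OF T(1) z(1), of "\<lambda>x. f (triv (stereo_gauge B) x)" G] G(1) by simp
  moreover have "T \<subseteq> UNIV \<times> (- {0})" 
  proof
    show "x \<in> UNIV \<times> (- {0})" if "x \<in> T" for x
      using T(2)[OF that] by (simp add: mem_Times_iff)
  qed
  ultimately show "\<exists>U g \<rho> T z. spin_gauge U g \<rho> \<and> open T \<and> T \<subseteq> U \<times> (- {0}) \<and> z \<in> T \<and> triv g z = p \<and>
      smooth_on T (\<lambda>x. f (triv g x)) \<and> surj (frechet_derivative (\<lambda>x. f (triv g x)) (at z))"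
    using z T(1) spin_gauge_gauge[OF B] by (intro exI[of _ UNIV] exI[of _ "stereo_gauge B"] exI[of _ conn] exI[of _ T] exI[of _ z] conjI)
qed

section \<open>The projection away from the fibre over 0\<close>

definition generic_part :: "spinor set" where
  "generic_part = {p \<in> M0. snd (hom_coord p) \<noteq> 0}"

lemma openin_hom_coord:
  assumes "open {Q. P Q}"
  shows "openin M0_top {p \<in> M0. P (hom_coord p)}"
proof -
  have "hom_coord ` {p \<in> M0. P (hom_coord p)} = {Q \<in> hom_coord ` M0. P Q}" by auto
  also have "\<dots> = {Q. P Q} \<inter> - {0}" unfolding hom_coord_image_M0 by auto
  finally have "open (hom_coord ` {p \<in> M0. P (hom_coord p)})"
    using assms by (simp add: open_Int open_Compl)
  then show ?thesis by (auto simp: openin_M0_top_iff)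
qed

lemma open_snd_nonzero: "open {Q::quat \<times> quat. snd Q \<noteq> 0}"
  by (auto intro!: open_Collect_neq continuous_intros)

lemma submersion_generic: "smooth_submersion generic_part fibre_map"
proof (rule smooth_submersion_gaugeI[OF qone_in_Sp2 _ open_snd_nonzero,
      where G = "\<lambda>z. exp (log_norm z) *\<^sub>R unit_part z"])
  show "openin M0_top generic_part"
    unfolding generic_part_def by (rule openin_hom_coord[OF open_snd_nonzero])
  show "smooth_on {z. snd z \<noteq> 0} (\<lambda>z. exp (log_norm z) *\<^sub>R unit_part z)"
    by (rule smooth_on_polar[OF open_snd_nonzero]) simp
  fix z :: "quat \<times> quat" assume "z \<in> {z. snd z \<noteq> 0}"
  then have z: "snd z \<noteq> 0" by simp
  show "fibre_map (triv (stereo_gauge qone) z) = exp (log_norm z) *\<^sub>R unit_part z"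
    using fibre_map_triv[OF z, of "fst z"] by simp
  show "surj (frechet_derivative (\<lambda>z. exp (log_norm z) *\<^sub>R unit_part z) (at z))"
    using surj_derivative_polar[OF z, of "fst z"] by simp
next
  fix p assume "p \<in> generic_part"
  then show "\<exists>z\<in>{z. snd z \<noteq> 0}. triv (stereo_gauge qone) z = p"
    using spin_chart_at[of p]
    by (intro bexI[of _ "chart_coord (hom_coord p)"]) (auto simp: generic_part_def snd_chart_coord)
qed simp

text \<open>\<open>fibre_map\<close> is discontinuous along the fibre over 0: as \<open>q\<^sub>2 \<rightarrow> 0\<close> the level tends to 0 from below,
  so that the norm of \<open>fibre_map\<close> tends to 1.  \<open>zero_chart\<close> therefore reverses the radius; the exponent
  \<open>5/2\<close> turns \<open>t\<^bsup>2/5\<^esup>\<close> into \<open>t\<close> and makes the composition smooth.\<close>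

definition zero_chart :: "real^4 \<Rightarrow> real^4" where
  "zero_chart b = (if b = 0 then 0 else ((- ln (norm b)) powr (5/2) / norm b) *\<^sub>R b)"

section \<open>The projection near the fibre over 0\<close>

lemma inj_on_zero_chart: "inj_on zero_chart (ball 0 1)"
proof (rule inj_onI)
  have pos: "norm (zero_chart b) = (- ln (norm b)) powr (5/2)" "- ln (norm b) > 0" if "b \<noteq> 0" "b \<in> ball 0 1" for b
    using that by (simp_all add: zero_chart_def)
  have nz: "zero_chart b \<noteq> 0" if "b \<noteq> 0" "b \<in> ball 0 1" for b
  proof -
    have "norm (zero_chart b) > 0"
      unfolding pos(1)[OF that] using pos(2)[OF that] by simp
    then show ?thesis by auto
  qed
  fix b b'
  assume b: "b \<in> ball 0 1" "b' \<in> ball 0 1" and eq: "zero_chart b = zero_chart b'"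
  show "b = b'"
  proof (cases "b = 0 \<or> b' = 0")
    case True
    then show ?thesis using nz b eq by (metis zero_chart_def)
  next
    case False
    then have "(- ln (norm b)) powr (5/2) = (- ln (norm b')) powr (5/2)"
      using pos(1) b eq by metis
    then have "((- ln (norm b)) powr (5/2)) powr (2/5) = ((- ln (norm b')) powr (5/2)) powr (2/5)" by simp
    then have "ln (norm b) = ln (norm b')"
      using pos(2)[of b] pos(2)[of b'] False b by (simp add: powr_powr)
    then have n: "norm b = norm b'" using False by simp
    have c: "(- ln (norm b)) powr (5/2) / norm b > 0"
      using pos(2)[of b] False b by simp
    have "((- ln (norm b)) powr (5/2) / norm b) *\<^sub>R b = ((- ln (norm b)) powr (5/2) / norm b) *\<^sub>R b'"
      using eq False unfolding zero_chart_def n by simp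
    then show ?thesis using c by (simp only: scaleR_cancel_left) auto
  qed
qed

definition zero_weight :: "quat \<times> quat \<Rightarrow> real" where
  "zero_weight z = (3 - 5 * (fst z \<bullet> fst z)) powr (5/2) * (1 + fst z \<bullet> fst z) powr (-3)"

text \<open>In the gauge of \<open>qswap\<close> one has |y| = |q2| / |q1|, so the inequality
  selects q2 = 0 together with the negative levels.\<close>

definition zero_bundle :: "(quat \<times> quat) set" where
  "zero_bundle = {z. snd z \<noteq> 0 \<and> 3 - 5 * (fst z \<bullet> fst z) > 0}"

text \<open>The coordinate expression of \<open>zero_chart \<circ> fibre_map\<close>. The factor |y|
  in the reversed radius cancels the denominator of the unit vector along y conj(a), so nothing
  singular remains at \<open>y = 0\<close>.\<close>

definition zero_local :: "quat \<times> quat \<Rightarrow> quat" where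
  "zero_local z = (zero_weight z * (snd z \<bullet> snd z)) *\<^sub>R (fst z \<odot> qcnj (snd z))"

lemma open_zero_bundle: "open zero_bundle"
  unfolding zero_bundle_def
  by (intro open_Collect_conj open_Collect_neq open_Collect_less continuous_intros)

lemma zero_chart_fibre_map:
  assumes "(y, a) \<in> zero_bundle"
  shows "zero_chart (fibre_map (triv (stereo_gauge qswap) (y, a))) = zero_local (y, a)"
    and "fibre_map (triv (stereo_gauge qswap) (y, a)) \<in> ball 0 1"
proof -
  define n where "n = 1 + y \<bullet> y"
  have n: "n > 0" by (simp add: n_def one_plus_inner_pos)
  have a: "a \<noteq> 0" and s: "3 - 5 * (y \<bullet> y) > 0" using assms by (simp_all add: zero_bundle_def)
  have hc: "hom_coord (triv (stereo_gauge qswap) (y, a)) = n powr (-1/2) *\<^sub>R (qcnj a, y \<odot> qcnj a)"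
    by (simp only: hom_coord_triv_gauge_simps n_def)
  have "zero_chart (fibre_map (triv (stereo_gauge qswap) (y, a))) = zero_local (y, a) \<and>
    fibre_map (triv (stereo_gauge qswap) (y, a)) \<in> ball 0 1"
  proof (cases "y = 0")
    case True
    have "fibre_map (triv (stereo_gauge qswap) (y, a)) = 0"
      unfolding fibre_map_def hc Let_def using True by simp
    with True show ?thesis by (simp add: zero_chart_def zero_local_def)
  next
    case False
    define \<eta> \<alpha> where "\<eta> = norm y" and "\<alpha> = norm a"
    have pos: "\<eta> > 0" "\<alpha> > 0" using False a by (simp_all add: \<eta>_def \<alpha>_def)
    have yy: "y \<bullet> y = \<eta> powr 2" "a \<bullet> a = \<alpha> powr 2"
      using pos by (simp_all add: \<eta>_def \<alpha>_def dot_square_norm)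
    define u where "u = (1 / (\<eta> * \<alpha>)) *\<^sub>R (y \<odot> qcnj a)"
    have nu: "norm u = 1" using pos by (simp add: u_def norm_qmul flip: \<eta>_def \<alpha>_def)
    then have u: "u \<in> Sp1" by (simp add: Sp1_def)
    define x where "x = (1 / (\<eta> * \<alpha>)) *\<^sub>R qcnj a"
    define t where "t = n powr (-1/2) * (\<eta> * \<alpha>)"
    have t: "t > 0" using n pos by (simp add: t_def)
    have "hom_coord (triv (stereo_gauge qswap) (y, a)) = t *\<^sub>R (x, u)"
      unfolding hc t_def x_def u_def using pos by simp
    note fm = fibre_map_scaleR[OF t u this]
    have "norm x = 1 / \<eta>" using pos by (simp add: x_def flip: \<alpha>_def)
    then have xx: "x \<bullet> x = \<eta> powr (-2)"
      using pos by (simp add: dot_square_norm powr_minus power_one_over inverse_eq_divide)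
    \<comment> \<open>Minus the level. The exponent of \<eta> is 6/5 - 2 + 6/5, from the power of
      \<open>t\<close>, from |x|^2 = 1 / |y|^2 and from the denominator.\<close>
    define lev where "lev = \<alpha> powr (6/5) * \<eta> powr (2/5) * (3 - 5 * (y \<bullet> y)) * n powr (-6/5)"
    have l: "lev > 0" using pos s n by (simp add: lev_def)
    have level_eq: "t powr (6/5) * (5 - 3 * (x \<bullet> x)) / (1 + x \<bullet> x) powr (3/5) = - lev"
    proof -
      have 1: "t powr (6/5) = n powr (-3/5) * (\<eta> powr (6/5) * \<alpha> powr (6/5))"
        using n pos by (simp add: t_def powr_mult powr_powr)
      have ee: "\<eta> powr 2 * \<eta> powr (-2) = 1"
        unfolding powr_add[symmetric] using pos by simp
      have 2: "5 - 3 * (x \<bullet> x) = - (3 - 5 * (y \<bullet> y)) * \<eta> powr (-2)"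
        unfolding xx yy using ee by (simp add: algebra_simps)
      have "1 + x \<bullet> x = n * \<eta> powr (-2)"
        unfolding n_def xx yy using ee by (simp add: algebra_simps)
      then have 3: "(1 + x \<bullet> x) powr (3/5) = n powr (3/5) * \<eta> powr (-6/5)"
        using n pos by (simp add: powr_mult powr_powr)
      have 4: "n powr (-3/5) / n powr (3/5) = n powr (-6/5)" by (simp flip: powr_diff)
      have 5: "\<eta> powr (6/5) * \<eta> powr (-2) / \<eta> powr (-6/5) = \<eta> powr (2/5)"
        by (simp flip: powr_diff powr_add)
      have "A * (e1 * B) * (- s * e2) / (C * e3) = - (B * (e1 * e2 / e3) * s * (A / C))"
        for A B C e1 e2 e3 s :: real by (simp add: mult_ac)
      then show ?thesis
        unfolding 1 2 3 by (simp only: 4 5 lev_def)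
    qed
    have F: "fibre_map (triv (stereo_gauge qswap) (y, a)) = exp (- lev) *\<^sub>R u"
      unfolding fm level_eq ..
    have "zero_chart (exp (- lev) *\<^sub>R u) = lev powr (5/2) *\<^sub>R u"
      using nu by (auto simp: zero_chart_def)
    also have "\<dots> = zero_local (y, a)"
    proof -
      have "lev powr (5/2) = \<alpha> powr 3 * \<eta> powr 1 * (3 - 5 * (y \<bullet> y)) powr (5/2) * n powr (-3)"
        unfolding lev_def using pos s n by (simp add: powr_mult powr_powr)
      also have "\<dots> = (zero_weight (y, a) * (a \<bullet> a)) * (\<eta> * \<alpha>)"
        unfolding zero_weight_def yy(2) fst_conv n_def[symmetric]
        using pos by (simp add: power3_eq_cube power2_eq_square)
      finally show ?thesis
        using pos by (simp add: zero_local_def u_def)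
    qed
    finally show ?thesis
      using F l nu by simp
  qed
  then show "zero_chart (fibre_map (triv (stereo_gauge qswap) (y, a))) = zero_local (y, a)"
    "fibre_map (triv (stereo_gauge qswap) (y, a)) \<in> ball 0 1" by blast+
qed

lemma smooth_on_zero_weight: "smooth_on zero_bundle zero_weight"
  unfolding zero_weight_def
  by (intro smooth_on_mult smooth_on_powr smooth_on_diff smooth_on_add smooth_on_inner smooth_on_fst
      smooth_on_const smooth_on_id open_zero_bundle one_plus_inner_pos) (simp add: zero_bundle_def)

lemma smooth_on_zero_local: "smooth_on zero_bundle zero_local"
  unfolding zero_local_def
  by (intro smooth_on_mult smooth_on_scaleR smooth_on_inner smooth_on_fst smooth_on_snd smooth_on_id
      open_zero_bundle smooth_on_zero_weight smooth_on_bilinear[OF _ bounded_bilinear_qmul]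
      smooth_on_compose_linear[OF _ bounded_linear_qcnj])

text \<open>At \<open>y = 0\<close> varying \<open>y\<close> suffices, since right multiplication by
  conj(a) is bijective. For \<open>y \<noteq> 0\<close> varying \<open>a\<close> suffices, since
  left multiplication by \<open>y\<close> is bijective and a \<mapsto> |a|^2 conj(a) has invertible
  derivative.\<close>

lemma surj_derivative_zero_local:
  assumes "(y, a) \<in> zero_bundle"
  shows "surj (frechet_derivative zero_local (at (y, a)))"
proof -
  have a: "a \<noteq> 0" and s: "3 - 5 * (y \<bullet> y) > 0" using assms by (simp_all add: zero_bundle_def)
  define m where "m = a \<bullet> a"
  have m: "m > 0" using a by (simp add: m_def)
  define W where "W = (3 - 5 * (y \<bullet> y)) powr (5/2) * (1 + y \<bullet> y) powr (-3)"
  have W: "W > 0"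
    unfolding W_def using s one_plus_inner_pos[of y] by (intro mult_pos_pos powr_gt_zero[THEN iffD2]) linarith+
  \<comment> \<open>Only the existence of a derivative of the weight is needed: in the two cases
    below it is multiplied by y conj(a) = 0 or evaluated at 0.\<close>
  define P where "P y = (3 - 5 * (y \<bullet> y)) powr (5/2) * (1 + y \<bullet> y) powr (-3)" for y :: quat
  have "open {y::quat. 3 - 5 * (y \<bullet> y) > 0}"
    by (intro open_Collect_less continuous_intros)
  then have "smooth_on {y::quat. 3 - 5 * (y \<bullet> y) > 0} P"
    unfolding P_def
    by (intro smooth_on_mult smooth_on_powr smooth_on_diff smooth_on_add smooth_on_inner
      smooth_on_const smooth_on_id one_plus_inner_pos) auto
  then have "times_differentiable_on (Suc 0) P {y::quat. 3 - 5 * (y \<bullet> y) > 0}"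
    unfolding smooth_on_def by blast
  from times_differentiable_on_Suc_derivative[OF this, of y] s
  obtain P' where P': "(P has_derivative P') (at y)" by auto
  then have P'0: "P' 0 = 0" by (simp add: has_derivative_bounded_linear linear_simps)
  have "((\<lambda>z. P (fst z)) has_derivative (\<lambda>w. P' (fst w))) (at (y, a))"
    by (rule has_derivative_compose[of fst fst "(y, a)" UNIV P P'])
      (use P' in \<open>auto intro!: derivative_eq_intros\<close>)
  moreover have "((\<lambda>z. (snd z \<bullet> snd z) *\<^sub>R (fst z \<odot> qcnj (snd z))) has_derivative
      (\<lambda>w. m *\<^sub>R (y \<odot> qcnj (snd w) + fst w \<odot> qcnj a) + (2 * (a \<bullet> snd w)) *\<^sub>R (y \<odot> qcnj a))) (at (y, a))"
    (is "(?Q has_derivative ?Q') _")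
  proof -
    have "((\<lambda>z. qcnj (snd z)) has_derivative (\<lambda>w. qcnj (snd w))) (at (y, a))"
      by (intro bounded_linear.has_derivative[OF bounded_linear_qcnj] has_derivative_snd has_derivative_ident)
    from bounded_bilinear.FDERIV[OF bounded_bilinear_qmul has_derivative_fst[OF has_derivative_ident] this]
    have "((\<lambda>z. fst z \<odot> qcnj (snd z)) has_derivative (\<lambda>w. y \<odot> qcnj (snd w) + fst w \<odot> qcnj a)) (at (y, a))"
      by simp
    moreover have "((\<lambda>z. snd z \<bullet> snd z) has_derivative (\<lambda>w. 2 * (a \<bullet> snd w))) (at (y, a))"
      by (auto intro!: derivative_eq_intros simp: inner_commute)
    ultimately show ?thesis
      using has_derivative_scaleR[of "\<lambda>z. snd z \<bullet> snd z" "\<lambda>w. 2 * (a \<bullet> snd w)" "(y, a)" UNIV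
        "\<lambda>z. fst z \<odot> qcnj (snd z)"] by (simp add: m_def)
  qed
  ultimately have "((\<lambda>z. P (fst z) *\<^sub>R ?Q z) has_derivative
      (\<lambda>w. W *\<^sub>R ?Q' w + P' (fst w) *\<^sub>R (m *\<^sub>R (y \<odot> qcnj a)))) (at (y, a))"
    using has_derivative_scaleR[of "\<lambda>z. P (fst z)" "\<lambda>w. P' (fst w)" "(y, a)" UNIV ?Q ?Q']
    by (simp add: m_def W_def P_def)
  moreover have "(\<lambda>z. P (fst z) *\<^sub>R ?Q z) = zero_local"
    by (simp add: fun_eq_iff zero_local_def zero_weight_def P_def)
  ultimately have "(zero_local has_derivative
      (\<lambda>w. W *\<^sub>R ?Q' w + P' (fst w) *\<^sub>R (m *\<^sub>R (y \<odot> qcnj a)))) (at (y, a))"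
    by (simp only:)
  then have fd: "frechet_derivative zero_local (at (y, a)) =
      (\<lambda>w. W *\<^sub>R ?Q' w + P' (fst w) *\<^sub>R (m *\<^sub>R (y \<odot> qcnj a)))"
    by (rule frechet_derivative_at[symmetric])
  have "\<exists>w. W *\<^sub>R ?Q' w + P' (fst w) *\<^sub>R (m *\<^sub>R (y \<odot> qcnj a)) = e" for e
  proof (cases "y = 0")
    case True
    let ?d = "(1 / (W * m * m)) *\<^sub>R (e \<odot> a)"
    have "W *\<^sub>R ?Q' (?d, 0) + P' (fst (?d, 0::quat)) *\<^sub>R (m *\<^sub>R (y \<odot> qcnj a)) = e"
      using True W m by (simp add: qmul_scaleR qmul_right_inverse flip: m_def)
    then show ?thesis by blast
  next
    case False
    define c where "c = y \<bullet> y"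
    have c: "c > 0" using False by (simp add: c_def)
    define r where "r = (1 / (W * c)) *\<^sub>R (qcnj y \<odot> e)"
    have yr: "W *\<^sub>R (y \<odot> r) = e"
      using W c by (simp add: r_def qmul_scaleR qmul_qcnj flip: c_def qmul_assoc)
    define k where "k = a \<bullet> qcnj r"
    \<comment> \<open>The map a \<mapsto> |a|^2 conj(a) has degree 3, so its derivative scales by 3
      m along \<open>a\<close> and by \<open>m\<close> across it. Subtracting 2/3 of the component
      along \<open>a\<close> inverts this.\<close>
    define d where "d = (1 / m) *\<^sub>R (qcnj r - (2/3 * k / m) *\<^sub>R a)"
    have ad: "a \<bullet> d = k / (3 * m)"
      using m by (simp add: d_def inner_diff_right k_def[symmetric] m_def[symmetric] field_simps)
    have qd: "m *\<^sub>R qcnj d = r - (2/3 * k / m) *\<^sub>R qcnj a"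
    proof -
      have "m *\<^sub>R d = qcnj r - (2/3 * k / m) *\<^sub>R a" using m by (simp add: d_def)
      then have "qcnj (m *\<^sub>R d) = qcnj (qcnj r - (2/3 * k / m) *\<^sub>R a)" by simp
      then show ?thesis
        using bounded_linear.linear[OF bounded_linear_qcnj] by (simp add: qcnj_scaleR linear_diff)
    qed
    have "?Q' (0, d) = y \<odot> (m *\<^sub>R qcnj d) + (2 * (k / (3 * m))) *\<^sub>R (y \<odot> qcnj a)"
      by (simp add: ad qmul_scaleR)
    also have "\<dots> = y \<odot> r"
      unfolding qd by (simp add: qmul_diff qmul_scaleR)
    finally have "W *\<^sub>R ?Q' (0, d) + P' (fst (0::quat, d)) *\<^sub>R (m *\<^sub>R (y \<odot> qcnj a)) = e"
      using yr P'0 by simp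
    then show ?thesis by blast
  qed
  then show ?thesis unfolding fd surj_def by metis
qed

lemma fibre_map_in_ball_iff:
  assumes "p \<in> M0"
  shows "fibre_map p \<in> ball 0 1 \<longleftrightarrow>
    5 * (snd (hom_coord p) \<bullet> snd (hom_coord p)) < 3 * (fst (hom_coord p) \<bullet> fst (hom_coord p))"
proof -
  define q1 q2 where "q1 = fst (hom_coord p)" and "q2 = snd (hom_coord p)"
  have Q: "hom_coord p = (q1, q2)" by (simp add: q1_def q2_def)
  show ?thesis
  proof (cases "q2 = 0")
    case True
    then have "q1 \<noteq> 0" using hom_coord_M0_nonzero[OF assms] Q by (auto simp: zero_prod_def)
    with True show ?thesis by (simp add: Q fibre_map_def Let_def)
  next
    case False
    define S where "S = (q1 \<bullet> q1) / (q2 \<bullet> q2)"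
    have S: "S \<ge> 0" by (simp add: S_def)
    have "norm (fibre_map p) = exp (level (q1, q2))"
      using False by (simp add: fibre_map_def Q Let_def)
    then have "fibre_map p \<in> ball 0 1 \<longleftrightarrow> level (q1, q2) < 0" by simp
    also have "\<dots> \<longleftrightarrow> 5 - 3 * S < 0"
    proof -
      have "norm q2 powr (6/5) > 0" "(1 + S) powr (3/5) > 0" using False S by auto
      moreover have "level (q1, q2) = norm q2 powr (6/5) * (5 - 3 * S) / (1 + S) powr (3/5)"
        by (simp add: level_def Let_def S_def)
      ultimately show ?thesis by (simp only: divide_less_0_iff mult_less_0_iff) auto
    qed
    also have "\<dots> \<longleftrightarrow> 5 * (q2 \<bullet> q2) < 3 * (q1 \<bullet> q1)"
      using False by (simp add: S_def field_simps)
    finally show ?thesis by (simp add: Q)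
  qed
qed

lemma submersion_zero: "smooth_submersion {p \<in> M0. fibre_map p \<in> ball 0 1} (\<lambda>p. zero_chart (fibre_map p))"
proof (rule smooth_submersion_gaugeI[OF qswap_in_Sp2 _ open_zero_bundle, where G = zero_local])
  have "{p \<in> M0. fibre_map p \<in> ball 0 1} =
      {p \<in> M0. 5 * (snd (hom_coord p) \<bullet> snd (hom_coord p)) < 3 * (fst (hom_coord p) \<bullet> fst (hom_coord p))}"
    using fibre_map_in_ball_iff by auto
  moreover have "open {Q::quat \<times> quat. 5 * (snd Q \<bullet> snd Q) < 3 * (fst Q \<bullet> fst Q)}"
    by (intro open_Collect_less continuous_intros)
  ultimately show "openin M0_top {p \<in> M0. fibre_map p \<in> ball 0 1}"
    using openin_hom_coord[of "\<lambda>Q. 5 * (snd Q \<bullet> snd Q) < 3 * (fst Q \<bullet> fst Q)"] by simp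
  show "snd z \<noteq> 0" if "z \<in> zero_bundle" for z using that by (simp add: zero_bundle_def)
  show "zero_chart (fibre_map (triv (stereo_gauge qswap) z)) = zero_local z" if "z \<in> zero_bundle" for z
    using zero_chart_fibre_map(1)[of "fst z" "snd z"] that by simp
  show "smooth_on zero_bundle zero_local" by (rule smooth_on_zero_local)
  show "surj (frechet_derivative zero_local (at z))" if "z \<in> zero_bundle" for z
    using surj_derivative_zero_local[of "fst z" "snd z"] that by simp
  fix p assume "p \<in> {p \<in> M0. fibre_map p \<in> ball 0 1}"
  then have p: "p \<in> M0"
    and *: "5 * (snd (hom_coord p) \<bullet> snd (hom_coord p)) < 3 * (fst (hom_coord p) \<bullet> fst (hom_coord p))"
    using fibre_map_in_ball_iff by auto
  define q1 q2 where "q1 = fst (hom_coord p)" and "q2 = snd (hom_coord p)"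
  have "q1 \<noteq> 0"
  proof
    assume "q1 = 0"
    with * have "5 * (q2 \<bullet> q2) < 0" by (simp add: q1_def q2_def)
    then show False using inner_ge_zero[of q2] by linarith
  qed
  define z where "z = chart_coord (prod.swap (hom_coord p))"
  have "triv (stereo_gauge qswap) z = p"
    unfolding z_def using \<open>q1 \<noteq> 0\<close> by (intro spin_chart_at_swap p) (simp add: q1_def)
  moreover have "snd z \<noteq> 0"
    using \<open>q1 \<noteq> 0\<close> by (simp add: z_def snd_chart_coord q1_def)
  moreover have fz: "fst z \<bullet> fst z = (q2 \<bullet> q2) / (q1 \<bullet> q1)"
    using \<open>q1 \<noteq> 0\<close>
    by (simp add: z_def chart_coord_def Let_def q1_def q2_def inner_qmul_qmul inner_qcnj)
  have "q1 \<bullet> q1 > 0" using \<open>q1 \<noteq> 0\<close> by simp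
  then have "3 - 5 * (fst z \<bullet> fst z) > 0"
    unfolding fz using * by (simp add: field_simps flip: q1_def q2_def)
  ultimately show "\<exists>z\<in>zero_bundle. triv (stereo_gauge qswap) z = p"
    by (intro bexI[of _ z]) (simp_all add: zero_bundle_def)
qed

section \<open>Invariance, density and assembly\<close>

lemma fibre_nonempty: "fibre b \<noteq> {}"
proof
  assume "fibre b = {}"
  then have t: "subtopology M0_top (fibre b) = trivial_topology" by simp
  have "S3_times_R \<noteq> trivial_topology"
  proof
    assume "S3_times_R = trivial_topology"
    then have "topspace S3_times_R = {}" by simp
    moreover have "(axis 0 1, 0) \<in> topspace S3_times_R"
      by (simp add: S3_times_R_def norm_axis_1)
    ultimately show False by blast
  qed
  moreover have "(euclidean :: (real^4) topology) \<noteq> trivial_topology"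
    by (metis UNIV_not_empty topspace_discrete_topology topspace_euclidean)
  ultimately show False
    using fibre_charts[of b] homeomorphic_empty_space[of "subtopology M0_top (fibre b)"] t
    by (metis (full_types))
qed

text \<open>The group rotates q1 and fixes q2, while \<open>fibre_map\<close> sees q1 only through
  |q1|. The action of the conjugate undoes that of \<open>p\<close>, which gives equality rather
  than inclusion.\<close>

lemma SU2_invariant_fibre: "SU2_invariant (fibre b)"
proof -
  have act: "act_M p P \<in> fibre b \<and> act_M (qcnj p) (act_M p P) = P" if p: "p \<in> Sp1" and P: "P \<in> fibre b" for p P
  proof -
    have M: "P \<in> M0" "fibre_map P = b" using P by (simp_all add: fibre_def)
    have pp: "p \<bullet> p = 1" using p by (simp add: Sp1_def norm_eq_1)
    have in_M0: "act_M q R \<in> M0" if q: "q \<in> Sp1" and R: "R \<in> M0" for q R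
    proof -
      obtain A a where A: "R = assoc A a" "A \<in> Sp2" "a \<noteq> 0" using R by (auto simp: M0_def)
      have "qdiag q (qreal 1) \<in> Sp2"
        using q by (simp add: Sp2_def qdiag_def qmat_eq_iff qmm_nth qadj_nth Sp1_mult_qcnj)
      then have "act_Spin q A \<in> Sp2" unfolding act_Spin_def using A(2) by (rule qmm_in_Sp2)
      then show ?thesis using A hom_coord_act_M(2)[OF A(1), of q] by (simp add: assoc_in_M0)
    qed
    have hc: "hom_coord (act_M q R) = (q \<odot> fst (hom_coord R), snd (hom_coord R))" if "R \<in> M0" for q R
      using that hom_coord_act_M(1) by (auto simp: M0_def)
    have "level (p \<odot> q1, q2) = level (q1, q2)" for q1 q2
      by (simp add: level_def inner_qmul_qmul pp)
    then have "fibre_map (act_M p P) = fibre_map P"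
      by (simp add: fibre_map_def Let_def hc[OF M(1)])
    moreover have "hom_coord (act_M (qcnj p) (act_M p P)) = hom_coord P"
      using hc[OF in_M0[OF p M(1)]] hc[OF M(1)] Sp1_mult_qcnj(2)[OF p]
      by (simp flip: qmul_assoc)
    then have "act_M (qcnj p) (act_M p P) = P"
      using inj_on_hom_coord in_M0[OF _ in_M0[OF p M(1)], of "qcnj p"] M(1) p
      by (simp add: inj_on_def qcnj_in_Sp1)
    ultimately show ?thesis using M in_M0[OF p M(1)] by (simp add: fibre_def)
  qed
  show ?thesis
    unfolding SU2_invariant_def
  proof (intro ballI equalityI subsetI)
    fix p P assume p: "p \<in> Sp1"
    show "P \<in> fibre b" if "P \<in> act_M p ` fibre b" using that act[OF p] by auto
    show "P \<in> act_M p ` fibre b" if P: "P \<in> fibre b"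
      using act[of "qcnj p" P] p P by (intro image_eqI[of _ _ "act_M (qcnj p) P"]) (simp_all add: qcnj_in_Sp1)
  qed
qed

lemma singular_Cayley_if_Cayley:
  assumes "Cayley N"
  shows "singular_Cayley N"
proof -
  have N: "N \<subseteq> M0" using assms by (auto simp: Cayley_def oriented_atlas_def)
  have "openin (subtopology M0_top N) N"
    using openin_topspace[of "subtopology M0_top N"] N by (simp add: topspace_M0_top Int_absorb1)
  moreover have "N \<subseteq> M0_top closure_of N"
    using N by (intro closure_of_subset) (simp add: topspace_M0_top)
  ultimately show ?thesis
    unfolding singular_Cayley_def using N assms by blast
qed

lemma closure_generic_part: "M0_top closure_of generic_part = M0"
proof
  show "M0_top closure_of generic_part \<subseteq> M0"
    using closure_of_subset_topspace[of M0_top] by (simp add: topspace_M0_top)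
  show "M0 \<subseteq> M0_top closure_of generic_part"
  proof
    fix p assume p: "p \<in> M0"
    have "\<exists>y. y \<in> generic_part \<and> y \<in> T" if T: "p \<in> T" "openin M0_top T" for T
    proof -
      have o: "open (hom_coord ` T)" and TM: "T \<subseteq> M0" using T(2) by (auto simp: openin_M0_top_iff)
      have "hom_coord p \<in> hom_coord ` T" using T(1) by simp
      then obtain A B where AB: "open A" "open B" "hom_coord p \<in> A \<times> B" "A \<times> B \<subseteq> hom_coord ` T"
        using o by (metis open_prod_elim)
      have s: "snd (hom_coord p) \<in> B" using AB(3) by (simp add: mem_Times_iff)
      \<comment> \<open>An open subset of the quaternions is no singleton, so q2 can be moved off 0
        inside \<open>B\<close>.\<close>
      have "B \<noteq> {snd (hom_coord p)}" using AB(2) not_open_singleton by metis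
      with s obtain b where "b \<in> B" "b \<noteq> snd (hom_coord p)" by blast
      with s obtain q where q: "q \<in> B" "q \<noteq> 0"
        by (cases "snd (hom_coord p) = 0") auto
      then have "(fst (hom_coord p), q) \<in> hom_coord ` T" using AB(3,4) by (auto simp: mem_Times_iff)
      then obtain P where "P \<in> T" "hom_coord P = (fst (hom_coord p), q)" by force
      then show ?thesis using q TM by (auto simp: generic_part_def)
    qed
    then show "p \<in> M0_top closure_of generic_part"
      using p by (auto simp: in_closure_of topspace_M0_top)
  qed
qed

lemma fibre_map_eq_0_iff: "fibre_map p = 0 \<longleftrightarrow> snd (hom_coord p) = 0"
  by (simp add: fibre_map_def Let_def)

text \<open>The fibre over 0 is disjoint from \<open>generic_part\<close>, so 0 has to be left out
  of the dense set that the generic projection reaches.\<close>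

lemma Cayley_fibration_fibre: "Cayley_fibration fibre"
  unfolding Cayley_fibration_def
proof (intro conjI allI exI[of _ "- {0 :: real^4}"] exI[of _ generic_part] exI[of _ fibre_map])
  show "singular_Cayley (fibre b)" for b
    using fibre_charts[of b] singular_Cayley_if_Cayley by blast
  show "(\<Union>b. fibre b) = M0" by (auto simp: fibre_def)
  show "open (- {0 :: real^4})" by (simp add: open_Compl)
  show "closure (- {0 :: real^4}) = UNIV" by (simp add: closure_complement)
  show "\<forall>b\<in>- {0}. Cayley (fibre b)" using fibre_charts by blast
  show "openin M0_top generic_part"
    unfolding generic_part_def by (rule openin_hom_coord[OF open_snd_nonzero])
  show "M0_top closure_of generic_part = M0" by (rule closure_generic_part)
  show "smooth_submersion generic_part fibre_map" by (rule submersion_generic)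
  show "{p \<in> generic_part. fibre_map p = b} = fibre b \<inter> generic_part" for b
    by (auto simp: fibre_def generic_part_def)
  show "- {0} \<subseteq> fibre_map ` generic_part"
  proof
    fix b :: "real^4" assume b: "b \<in> - {0}"
    obtain p where "p \<in> M0" "fibre_map p = b" using fibre_nonempty[of b] by (auto simp: fibre_def)
    moreover from this b have "p \<in> generic_part"
      using fibre_map_eq_0_iff[of p] by (auto simp: generic_part_def)
    ultimately show "b \<in> fibre_map ` generic_part" by blast
  qed
qed

text \<open>Two charts suffice, the identity off 0 and \<open>zero_chart\<close> on the unit ball.
  They overlap in the punctured ball, where \<open>zero_chart\<close> sends |b| \<rightarrow> 1 to
  0; this is the non-Hausdorff gluing of the cones to the fibre over 0.\<close>

lemma fibration_with_fibres_fibre: "fibration_with_fibres fibre"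
  unfolding fibration_with_fibres_def
proof (intro conjI exI[of _ fibre_map] allI)
  show "{p \<in> M0. fibre_map p = b} = fibre b" for b by (simp add: fibre_def)
  have "b \<in> fibre_map ` M0" for b using fibre_nonempty[of b] by (auto simp: fibre_def)
  then show "fibre_map ` M0 = UNIV" by blast
  let ?K = "\<lambda>D \<kappa>. D = - {0::real^4} \<and> \<kappa> = (\<lambda>b. b) \<or> D = ball 0 1 \<and> \<kappa> = zero_chart"
  have "{p \<in> M0. fibre_map p \<in> - {0}} = generic_part"
    using fibre_map_eq_0_iff by (auto simp: generic_part_def)
  then have "smooth_submersion {p \<in> M0. fibre_map p \<in> - {0}} (\<lambda>p. fibre_map p)"
    using submersion_generic by (simp only:)
  then have "\<forall>D \<kappa>. ?K D \<kappa> \<longrightarrow> inj_on \<kappa> D \<and> smooth_submersion {p \<in> M0. fibre_map p \<in> D} (\<lambda>p. \<kappa> (fibre_map p))"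
    using inj_on_zero_chart submersion_zero by auto
  moreover have "\<exists>D \<kappa>. ?K D \<kappa> \<and> b \<in> D" for b
  proof (cases "b = 0")
    case True
    then have "?K (ball 0 1) zero_chart \<and> b \<in> ball 0 1" by simp
    then show ?thesis by blast
  next
    case False
    then have "?K (- {0}) (\<lambda>b. b) \<and> b \<in> - {0}" by simp
    then show ?thesis by blast
  qed
  ultimately show "\<exists>\<K>. (\<forall>b. \<exists>D \<kappa>. \<K> D \<kappa> \<and> b \<in> D) \<and>
      (\<forall>D \<kappa>. \<K> D \<kappa> \<longrightarrow> inj_on \<kappa> D \<and> smooth_submersion {p \<in> M0. fibre_map p \<in> D} (\<lambda>p. \<kappa> (fibre_map p)))"
    by (intro exI[of _ ?K]) blast
qed

theorem theorem6p9:
  shows "\<exists>N :: real^4 \<Rightarrow> spinor set.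
     Cayley_fibration N \<and>
     (\<forall>b. SU2_invariant (N b)) \<and>
     (\<forall>b. Cayley (N b)) \<and>
     (\<forall>b. subtopology M0_top (N b) homeomorphic_space S3_times_R \<or>
          subtopology M0_top (N b) homeomorphic_space (euclidean :: (real^4) topology)) \<and>
     (\<exists>b. subtopology M0_top (N b) homeomorphic_space S3_times_R) \<and>
     (\<exists>b. subtopology M0_top (N b) homeomorphic_space (euclidean :: (real^4) topology)) \<and>
     disjoint_family N \<and>
     fibration_with_fibres N"
proof (intro exI[of _ fibre] conjI allI)
  show "Cayley_fibration fibre" by (rule Cayley_fibration_fibre)
  show "SU2_invariant (fibre b)" for b by (rule SU2_invariant_fibre)
  show "Cayley (fibre b)" for b using fibre_charts by blast
  show "subtopology M0_top (fibre b) homeomorphic_space S3_times_R \<or>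
      subtopology M0_top (fibre b) homeomorphic_space (euclidean :: (real^4) topology)" for b
    using fibre_charts[of b] by (auto split: if_splits)
  show "\<exists>b. subtopology M0_top (fibre b) homeomorphic_space S3_times_R"
    using fibre_charts[of 0] by (intro exI[of _ 0]) simp
  \<comment> \<open>Any vector of norm above 1, i.e. of positive level, would do.\<close>
  have "norm (axis 0 2 :: real^4) > 1" by (simp add: norm_eq_sqrt_inner inner_axis_axis)
  then show "\<exists>b. subtopology M0_top (fibre b) homeomorphic_space (euclidean :: (real^4) topology)"
    using fibre_charts[of "axis 0 2"] by (intro exI[of _ "axis 0 2"]) simp
  show "disjoint_family fibre" by (auto simp: disjoint_family_on_def fibre_def)
  show "fibration_with_fibres fibre" by (rule fibration_with_fibres_fibre)
qed

end
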